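(* The group $T\mathcal{A}$ is $2$-generated (i.e. it is generated by two elements).
   Context: Thompson's group $T$ is the group of all piecewise-linear homeomorphisms of $S^1=\mathbb{R}/\mathbb{Z}$ whose breakpoints are dyadic and whose linear segments all have the form $t\mapsto 2^nt+b$ with $n\in\mathbb{Z}$, $b\in\mathbb{Z}[\tfrac12]$. For $f\in\mathrm{Homeo}(S^1)$, let $\mathrm{sing}(f)$ be the set of points $p\in S^1$ such that $f$ does not agree with any element of $T$ on any neighborhood of $p$. $T\mathcal{A}$ is the group of all $f\in\mathrm{Homeo}(S^1)$ such that: (1) $\mathrm{sing}(f)$ is a finite set of dyadic points; (2) if $p\in\mathrm{sing}(f)$, then $L_{f(p)}\circ f$ agrees with $f\circ L_p$ in some neighborhood of $p$, where $L_p$ denotes the linear map in a neighborhood of $p$ that fixes $p$ and has slope $2$. *)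

theory Defs
  imports "HOL-Analysis.Analysis" "HOL-Algebra.Generated_Groups"
begin

quotient_type circle = real / "\<lambda>x y :: real. x - y \<in> \<int>"
  morphisms rep_circle to_circle
proof (rule equivpI)
  show "reflp (\<lambda>x y :: real. x - y \<in> \<int>)"
    by (rule reflpI) simp
  show "symp (\<lambda>x y :: real. x - y \<in> \<int>)"
  proof (rule sympI)
    fix x y :: real
    assume "x - y \<in> \<int>"
    then have "- (x - y) \<in> \<int>" by (rule Ints_minus)
    then show "y - x \<in> \<int>" by (simp only: minus_diff_eq)
  qed
  show "transp (\<lambda>x y :: real. x - y \<in> \<int>)"
  proof (rule transpI)
    fix x y z :: real
    assume "x - y \<in> \<int>" "y - z \<in> \<int>"
    then have "(x - y) + (y - z) \<in> \<int>" by (rule Ints_add)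
    then show "x - z \<in> \<int>" by (simp only: diff_add_cancel add_diff_eq)
  qed
qed

text \<open>The quotient topology along the projection \<open>to_circle\<close>.\<close>

instantiation circle :: topological_space
begin

definition open_circle :: "circle set \<Rightarrow> bool"
  where "open_circle U \<longleftrightarrow> open (to_circle -` U)"

instance
  by standard (auto simp: open_circle_def vimage_Union)

end

definition homeo_circle :: "(circle \<Rightarrow> circle) monoid"
  where "homeo_circle =
    \<lparr>carrier = {f. \<exists>g. homeomorphism UNIV UNIV f g}, mult = (\<circ>), one = id\<rparr>"

lemma group_homeo_circle: "group homeo_circle"
proof (rule groupI)
  fix f g assume "f \<in> carrier homeo_circle" "g \<in> carrier homeo_circle"
  then obtain f' g' where "homeomorphism UNIV UNIV f f'" "homeomorphism UNIV UNIV g g'"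
    by (auto simp: homeo_circle_def)
  then have "homeomorphism UNIV UNIV (f \<circ> g) (g' \<circ> f')"
    by (rule homeomorphism_compose[rotated])
  then show "f \<otimes>\<^bsub>homeo_circle\<^esub> g \<in> carrier homeo_circle"
    by (auto simp: homeo_circle_def)
next
  show "\<one>\<^bsub>homeo_circle\<^esub> \<in> carrier homeo_circle"
    using homeomorphism_ident[of UNIV] by (auto simp: homeo_circle_def id_def)
next
  fix f assume "f \<in> carrier homeo_circle"
  then obtain g where g: "homeomorphism UNIV UNIV f g"
    by (auto simp: homeo_circle_def)
  then have "g \<circ> f = id" "homeomorphism UNIV UNIV g f"
    by (auto simp: homeomorphism_def)
  then show "\<exists>g \<in> carrier homeo_circle. g \<otimes>\<^bsub>homeo_circle\<^esub> f = \<one>\<^bsub>homeo_circle\<^esub>"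
    by (auto simp: homeo_circle_def)
qed (auto simp: homeo_circle_def)

definition dyadics :: "real set"
  where "dyadics = {of_int a / 2 ^ k | (a :: int) (k :: nat). True}"

text \<open>The circle is cut at \<open>0\<close>; since \<open>0\<close> is dyadic and a map may agree with the same linear map on
  adjacent intervals, this does not force \<open>0\<close> to be a genuine breakpoint.\<close>

definition thompson_T :: "(circle \<Rightarrow> circle) set"
  where "thompson_T = {f \<in> carrier homeo_circle.
    \<exists>(N :: nat) (x :: nat \<Rightarrow> real).
      x 0 = 0 \<and> x N = 1 \<and> (\<forall>i<N. x i < x (Suc i)) \<and> (\<forall>i\<le>N. x i \<in> dyadics) \<and>
      (\<forall>i<N. \<exists>n :: int. \<exists>b\<in>dyadics. \<forall>t\<in>{x i..x (Suc i)}.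
         f (to_circle t) = to_circle (2 powi n * t + b))}"

definition sing :: "(circle \<Rightarrow> circle) \<Rightarrow> circle set"
  where "sing f = {p. \<not> (\<exists>g\<in>thompson_T. eventually (\<lambda>q. f q = g q) (nhds p))}"

text \<open>The map \<open>x + t \<mapsto> x + 2 * t\<close>, which is well defined modulo \<open>\<int>\<close> on the whole circle (as a map
  of degree two). Only its germ at the base point \<open>p\<close> is used: near \<open>p\<close> it is the linear map fixing
  \<open>p\<close> with slope \<open>2\<close>.\<close>

lift_definition expand_at :: "circle \<Rightarrow> circle \<Rightarrow> circle"
  is "\<lambda>x y :: real. x + 2 * (y - x)"
proof -
  fix x x' y y' :: real
  assume "x - x' \<in> \<int>" "y - y' \<in> \<int>"
  then have "2 * (y - y') - (x - x') \<in> \<int>" by (rule Ints_diff[OF Ints_mult[OF Ints_numeral], rotated])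
  moreover have "x + 2 * (y - x) - (x' + 2 * (y' - x')) = 2 * (y - y') - (x - x')"
    by (simp add: algebra_simps)
  ultimately show "x + 2 * (y - x) - (x' + 2 * (y' - x')) \<in> \<int>"
    by (simp only:)
qed

lemma expand_at_to_circle:
  "expand_at (to_circle x) (to_circle (x + t)) = to_circle (x + 2 * t)"
  by (simp add: expand_at.abs_eq)

definition TA :: "(circle \<Rightarrow> circle) set"
  where "TA = {f \<in> carrier homeo_circle.
    finite (sing f) \<and> sing f \<subseteq> to_circle ` dyadics \<and>
    (\<forall>p\<in>sing f. eventually (\<lambda>q. expand_at (f p) (f q) = f (expand_at p q)) (nhds p))}"

end

theory Submission imports Defs begin

text \<open>
  \<^bold>\<open>Lifts.\<close> Everything happens on the line. An element of TA is induced by an increasing homeomorphism of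
  the line that commutes with the translation by the length of the circle, that is dyadic affine on
  both sides of all points outside a discrete set of dyadic points, and that commutes with doubling
  at the points of that set. These lifts form the group \<open>lifts_TA M\<close>, where \<open>M\<close> is the length of the
  circle; those without singular points form \<open>lifts_T M\<close>, which induces Thompson's group T. Rescaling
  by a power of two allows \<open>M = 2^9\<close> in place of \<open>1\<close>.

  \<^bold>\<open>The two generators.\<close> One is the translation by \<open>1/2\<close>. The other one acts on each unit block
  \<open>[q, q + 1]\<close> separately: for \<open>i < 8\<close> it acts on the blocks \<open>q \<equiv> 2^i\<close> modulo \<open>M\<close> by the \<open>i\<close>-th of eight
  pieces, and it is the identity on all other blocks. Conjugating it by a translation brings any
  chosen piece to block \<open>0\<close>. Since a sum of two powers of two determines the two powers, block
  \<open>0\<close> is the only block on which both conjugates act when two different pieces are brought there. Their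
  commutator is therefore the commutator of the two pieces on block \<open>0\<close>, and the identity on
  the rest of the circle. So the set \<open>N\<close> of maps whose copy in block \<open>0\<close> lies in the generated group
  contains the commutators of the pieces, and the pieces normalise it (\<open>N_comm\<close>, \<open>N_conj\<close>).

  \<^bold>\<open>Thompson's group.\<close> A homeomorphism \<open>psi\<close> from the line onto \<open>(0, 1)\<close> turns the translation by
  one near the ends of the line into multiplication by two or one half near the ends of the interval.
  Two pieces are the translation \<open>tau\<close> and the map \<open>stretch\<close> that doubles \<open>[0, 1]\<close> and translates the rest;
  together they generate a copy of Thompson's group F. Every compactly supported map in that copy is
  a quotient of two words of the same length in the translates of \<open>stretch\<close>, and modulo a normal
  subgroup containing the commutator of \<open>tau\<close> and \<open>stretch\<close> these translates coincide. Hence \<open>N\<close>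
  contains all compactly supported maps (\<open>normal_contains_compactly_supported\<close>). Conjugates by the
  half translation have overlapping supports, and such overlapping copies generate \<open>lifts_T M\<close>
  (\<open>lifts_T_generated\<close>).

  \<^bold>\<open>Singular germs.\<close> A right germ at a dyadic point that commutes with doubling becomes under \<open>psi\<close>
  a map near minus infinity that commutes with the translation by one, i.e. an element of \<open>lifts_T 1\<close>.
  So the statement that generates \<open>lifts_T M\<close> can be used a second time, now for germs: three further pieces
  produce all right germs inside \<open>N\<close> (\<open>all_left_germs\<close>), and the mirror images of these three produce
  all left germs. An element of \<open>lifts_TA M\<close> has finitely many singular points per period, and
  composing it with elements of the generated group removes them one after the other until an element
  of \<open>lifts_T M\<close> remains (\<open>lifts_TA_generated\<close>).
\<close>

(* From here on inv is the inverse function, not the inverse in a group. *)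
unbundle no m_inv_syntax

section \<open>Dyadic numbers\<close>

lemma dyadics_iff: "x \<in> dyadics \<longleftrightarrow> (\<exists>k::nat. x * 2 ^ k \<in> \<int>)"
proof
  assume "x \<in> dyadics"
  then obtain a :: int and k :: nat where "x = of_int a / 2 ^ k" by (auto simp: dyadics_def)
  then have "x * 2 ^ k = of_int a" by simp
  then show "\<exists>k::nat. x * 2 ^ k \<in> \<int>" by (metis Ints_of_int)
next
  assume "\<exists>k::nat. x * 2 ^ k \<in> \<int>"
  then obtain k :: nat and a :: int where "x * 2 ^ k = of_int a" by (auto elim: Ints_cases)
  then have "x = of_int a / 2 ^ k" by (simp add: field_simps)
  then show "x \<in> dyadics" by (auto simp: dyadics_def)
qed

lemma dyadics_Ints [simp]: "x \<in> \<int> \<Longrightarrow> x \<in> dyadics"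
  unfolding dyadics_iff by (rule exI[of _ 0]) simp

lemma dyadics_numeral [simp]: "0 \<in> dyadics" "1 \<in> dyadics" "numeral w \<in> dyadics"
  "of_int i \<in> dyadics" "of_nat j \<in> dyadics"
  by simp_all

lemma dyadics_mult [simp]: "x \<in> dyadics \<Longrightarrow> y \<in> dyadics \<Longrightarrow> x * y \<in> dyadics"
proof -
  assume "x \<in> dyadics" "y \<in> dyadics"
  then obtain k l :: nat where "x * 2 ^ k \<in> \<int>" "y * 2 ^ l \<in> \<int>" by (auto simp: dyadics_iff)
  then have "(x * 2 ^ k) * (y * 2 ^ l) \<in> \<int>" by (rule Ints_mult)
  then have "(x * y) * 2 ^ (k + l) \<in> \<int>" by (simp add: power_add algebra_simps)
  then show ?thesis unfolding dyadics_iff by blast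
qed

lemma dyadics_add [simp]: "x \<in> dyadics \<Longrightarrow> y \<in> dyadics \<Longrightarrow> x + y \<in> dyadics"
proof -
  assume "x \<in> dyadics" "y \<in> dyadics"
  then obtain k l :: nat where "x * 2 ^ k \<in> \<int>" "y * 2 ^ l \<in> \<int>" by (auto simp: dyadics_iff)
  then have "(x * 2 ^ k) * 2 ^ l + (y * 2 ^ l) * 2 ^ k \<in> \<int>"
    by (metis Ints_add Ints_mult Ints_numeral Ints_power)
  then have "(x + y) * 2 ^ (k + l) \<in> \<int>" by (simp add: power_add algebra_simps)
  then show ?thesis unfolding dyadics_iff by blast
qed

lemma dyadics_minus [simp]: "x \<in> dyadics \<Longrightarrow> - x \<in> dyadics"
  using dyadics_mult[of "-1" x] by (simp del: dyadics_mult)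

lemma dyadics_diff [simp]: "x \<in> dyadics \<Longrightarrow> y \<in> dyadics \<Longrightarrow> x - y \<in> dyadics"
  using dyadics_add[of x "-y"] by (simp del: dyadics_add)

lemma dyadics_inverse_power [simp]: "1 / 2 ^ k \<in> dyadics"
  unfolding dyadics_iff by (rule exI[of _ k]) simp

lemma dyadics_divide_power [simp]: "x \<in> dyadics \<Longrightarrow> x / 2 ^ k \<in> dyadics"
  using dyadics_mult[of x "1 / 2 ^ k"] by (simp del: dyadics_mult)

lemma dyadics_divide_2 [simp]: "x \<in> dyadics \<Longrightarrow> x / 2 \<in> dyadics"
  using dyadics_divide_power[of x 1] by simp

lemma dyadics_powi [simp]: "(2::real) powi n \<in> dyadics"
proof (cases "n \<ge> 0")
  case True
  then show ?thesis by (simp add: power_int_def)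
next
  case False
  then have "2 powi n = 1 / (2::real) ^ nat (- n)" by (simp add: power_int_def divide_simps)
  then show ?thesis by simp
qed

lemma powi_pos [simp]: "0 < (2::real) powi n"
  by simp

lemma powi_add2: "(2::real) powi (m + n) = 2 powi m * 2 powi n"
  by (simp add: power_int_add)

lemma dyadics_affine_iff [simp]:
  assumes "b \<in> dyadics"
  shows "2 powi n * x + b \<in> dyadics \<longleftrightarrow> x \<in> dyadics"
proof
  assume "2 powi n * x + b \<in> dyadics"
  then have "2 powi (- n) * ((2 powi n * x + b) - b) \<in> dyadics"
    using assms by (intro dyadics_mult dyadics_diff) auto
  moreover have "2 powi (- n) * ((2 powi n * x + b) - b) = x" by (simp add: power_int_minus)
  ultimately show "x \<in> dyadics" by (simp only:)
qed (use assms in auto)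

lemma dyadics_add_iff [simp]: "b \<in> dyadics \<Longrightarrow> x + b \<in> dyadics \<longleftrightarrow> x \<in> dyadics"
  using dyadics_affine_iff[of b 0 x] by simp

lemma dyadics_dense:
  assumes "a < b"
  obtains d where "d \<in> dyadics" "a < d" "d < b"
proof -
  obtain k :: nat where k: "1 / (b - a) < 2 ^ k"
    using real_arch_pow[of 2 "1 / (b - a)"] by auto
  then have k': "1 < (b - a) * 2 ^ k" using assms by (simp add: field_simps)
  define d where "d = of_int (\<lfloor>a * 2 ^ k\<rfloor> + 1) / (2::real) ^ k"
  have "d \<in> dyadics" unfolding d_def by (intro dyadics_divide_power) auto
  moreover have "a * 2 ^ k < of_int (\<lfloor>a * 2 ^ k\<rfloor> + 1)" by linarith
  then have "a < d" by (simp add: d_def field_simps)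
  moreover have "of_int (\<lfloor>a * 2 ^ k\<rfloor> + 1) < b * 2 ^ k" using k' by (simp add: algebra_simps) linarith
  then have "d < b" by (simp add: d_def field_simps)
  ultimately show ?thesis by (rule that)
qed

section \<open>Dyadic affine germs\<close>

text \<open>Restriction to \<open>S\<close> of a map \<open>t \<mapsto> 2^n t + b\<close> with \<open>b\<close> dyadic, the local model of Thompson's group.\<close>

definition daff :: "real set \<Rightarrow> (real \<Rightarrow> real) \<Rightarrow> bool"
  where "daff S f \<longleftrightarrow> (\<exists>n::int. \<exists>b\<in>dyadics. \<forall>t\<in>S. f t = 2 powi n * t + b)"

text \<open>The germ of \<open>f\<close> at \<open>x\<close> is that of an element of T: the slope may jump at \<open>x\<close> only if \<open>x\<close> is dyadic.\<close>

definition reg :: "(real \<Rightarrow> real) \<Rightarrow> real \<Rightarrow> bool"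
  where "reg f x \<longleftrightarrow> (\<exists>e>0. daff {x - e..x} f \<and> daff {x..x + e} f \<and>
    (x \<in> dyadics \<or> daff {x - e..x + e} f))"

lemma daff_mono: "daff S f \<Longrightarrow> S' \<subseteq> S \<Longrightarrow> daff S' f"
  by (auto simp: daff_def subset_iff)

lemma daff_cong: "daff S f \<Longrightarrow> (\<And>t. t \<in> S \<Longrightarrow> f t = g t) \<Longrightarrow> daff S g"
  by (auto simp: daff_def)

lemma daff_comp: "daff S g \<Longrightarrow> daff (g ` S) f \<Longrightarrow> daff S (f \<circ> g)"
proof -
  assume "daff S g" "daff (g ` S) f"
  then obtain n m b c where *: "b \<in> dyadics" "c \<in> dyadics"
    "\<And>t. t \<in> S \<Longrightarrow> g t = 2 powi n * t + b" "\<And>t. t \<in> S \<Longrightarrow> f (g t) = 2 powi m * g t + c"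
    by (fastforce simp: daff_def)
  have "\<forall>t\<in>S. (f \<circ> g) t = 2 powi (m + n) * t + (2 powi m * b + c)"
    using *(3,4) by (simp add: powi_add2 algebra_simps)
  then show ?thesis unfolding daff_def using * by (metis dyadics_add dyadics_mult dyadics_powi)
qed

lemma daff_inv: "daff S f \<Longrightarrow> (\<And>t. t \<in> S \<Longrightarrow> g (f t) = t) \<Longrightarrow> daff (f ` S) g"
proof -
  assume "daff S f" and g: "\<And>t. t \<in> S \<Longrightarrow> g (f t) = t"
  then obtain n b where *: "b \<in> dyadics" "\<And>t. t \<in> S \<Longrightarrow> f t = 2 powi n * t + b"
    by (auto simp: daff_def)
  have "\<forall>y\<in>f ` S. g y = 2 powi (- n) * y + - (2 powi (- n) * b)"
  proof
    fix y assume "y \<in> f ` S"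
    then obtain t where "t \<in> S" "y = f t" by auto
    then show "g y = 2 powi (- n) * y + - (2 powi (- n) * b)"
      using *(2)[of t] g[of t] by (simp add: power_int_minus field_simps)
  qed
  then show ?thesis unfolding daff_def using * by (metis dyadics_minus dyadics_mult dyadics_powi)
qed

lemma daff_affine: "b \<in> dyadics \<Longrightarrow> daff S (\<lambda>t. 2 powi n * t + b)"
  by (auto simp: daff_def)

lemma daff_dyadic: "daff S f \<Longrightarrow> x \<in> S \<Longrightarrow> f x \<in> dyadics \<longleftrightarrow> x \<in> dyadics"
  by (metis daff_def dyadics_affine_iff)

lemma daff_Icc_mono: "daff {a..b} f \<Longrightarrow> a \<le> a' \<Longrightarrow> b' \<le> b \<Longrightarrow> daff {a'..b'} f"
  by (erule daff_mono) auto

lemma regI_sides: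
  assumes "e > 0" "daff {x - e..x} f" "e' > 0" "daff {x..x + e'} f" "x \<in> dyadics"
  shows "reg f x"
  unfolding reg_def using assms
  by (intro exI[of _ "min e e'"] conjI disjI1 daff_Icc_mono[OF assms(2)] daff_Icc_mono[OF assms(4)]) auto

lemma regI_open:
  assumes "e > 0" "daff {x - e..x + e} f"
  shows "reg f x"
  unfolding reg_def using assms
  by (intro exI[of _ e] conjI disjI2 daff_Icc_mono[OF assms(2)]) auto

lemma reg_dyadic: "reg f x \<Longrightarrow> f x \<in> dyadics \<longleftrightarrow> x \<in> dyadics"
  by (auto simp: reg_def dest!: daff_dyadic[of _ _ x])

lemma reg_small:
  assumes "reg f x" "d > 0"
  obtains e where "0 < e" "e \<le> d" "daff {x - e..x} f" "daff {x..x + e} f"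
    "x \<in> dyadics \<or> daff {x - e..x + e} f"
proof -
  obtain e where e: "e > 0" "daff {x - e..x} f" "daff {x..x + e} f"
    "x \<in> dyadics \<or> daff {x - e..x + e} f" using assms by (auto simp: reg_def)
  show ?thesis
  proof (rule that[of "min e d"])
    show "x \<in> dyadics \<or> daff {x - min e d..x + min e d} f"
      using e(4) daff_Icc_mono[of "x - e" "x + e" f "x - min e d" "x + min e d"] by auto
  qed (use e assms(2) in \<open>auto intro: daff_Icc_mono[OF e(2)] daff_Icc_mono[OF e(3)]\<close>)
qed

lemma reg_cong:
  assumes "reg f x" "e > 0" "\<And>t. \<bar>t - x\<bar> \<le> e \<Longrightarrow> f t = g t"
  shows "reg g x"
proof -
  obtain d where d: "0 < d" "d \<le> e" "daff {x - d..x} f" "daff {x..x + d} f"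
    "x \<in> dyadics \<or> daff {x - d..x + d} f" by (rule reg_small[OF assms(1,2)])
  then show ?thesis unfolding reg_def
    by (intro exI[of _ d]) (smt (verit, best) assms(3) atLeastAtMost_iff daff_cong)
qed

lemma reg_cong_open:
  assumes "reg f x" "a < x" "x < b" "\<And>t. a < t \<Longrightarrow> t < b \<Longrightarrow> f t = g t"
  shows "reg g x"
proof (rule reg_cong[OF assms(1)])
  show "min (x - a) (b - x) / 2 > 0" using assms by auto
  fix t assume "\<bar>t - x\<bar> \<le> min (x - a) (b - x) / 2"
  then show "f t = g t" using assms(2,3) by (intro assms(4)) (auto simp: min_def abs_if split: if_splits)
qed

lemma daff_image:
  assumes "daff {u..v} f" "u \<le> v"
  shows "f ` {u..v} = {f u..f v}" "u < v \<Longrightarrow> f u < f v"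
proof -
  obtain n b where *: "\<And>t. t \<in> {u..v} \<Longrightarrow> f t = 2 powi n * t + b" using assms by (auto simp: daff_def)
  show "u < v \<Longrightarrow> f u < f v" using *[of u] *[of v] assms by auto
  have "f ` {u..v} = (\<lambda>t. 2 powi n * t + b) ` {u..v}" using * by auto
  also have "\<dots> = {f u..f v}" using *[of u] *[of v] assms
    by (simp add: image_affinity_atLeastAtMost)
  finally show "f ` {u..v} = {f u..f v}" .
qed

text \<open>Both one-sided neighbourhoods of \<open>x\<close> in a composition need a smaller interval whose image stays
  inside a prescribed one; this provides it at either end.\<close>

lemma daff_shrink_image:
  assumes "daff {u..v} f" "u < v" "d > 0"
  obtains r where "0 < r" "r \<le> v - u" "f (u + r) \<le> f u + d" "f (v - r) \<ge> f v - d"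
proof -
  obtain n b where *: "\<And>t. t \<in> {u..v} \<Longrightarrow> f t = 2 powi n * t + b" using assms by (auto simp: daff_def)
  define r where "r = min (v - u) (d / 2 powi n)"
  have r: "0 < r" "r \<le> v - u" "r \<le> d / 2 powi n" using assms by (auto simp: r_def)
  have "2 powi n * r \<le> d" using r(3) by (simp add: field_simps)
  moreover have "f (u + r) = f u + 2 powi n * r" "f (v - r) = f v - 2 powi n * r"
    using *[of u] *[of v] *[of "u + r"] *[of "v - r"] r by (auto simp: algebra_simps)
  ultimately show ?thesis using r by (intro that[of r]) auto
qed

lemma daff_comp_right:
  assumes "daff {x..x + e} g" "e > 0" "daff {g x..g x + d} f" "d > 0"
  obtains r where "0 < r" "r \<le> e" "daff {x..x + r} (f \<circ> g)"
proof -
  obtain r where r: "0 < r" "r \<le> e" "g (x + r) \<le> g x + d"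
    using daff_shrink_image[OF assms(1) _ assms(4)] assms(2) by auto
  have g: "daff {x..x + r} g" by (rule daff_mono[OF assms(1)]) (use r in auto)
  have "g ` {x..x + r} \<subseteq> {g x..g x + d}" using daff_image(1)[OF g] r by auto
  then have "daff {x..x + r} (f \<circ> g)" using g assms(3) by (blast intro: daff_comp daff_mono)
  then show ?thesis using r that by blast
qed

lemma daff_comp_left:
  assumes "daff {x - e..x} g" "e > 0" "daff {g x - d..g x} f" "d > 0"
  obtains r where "0 < r" "r \<le> e" "daff {x - r..x} (f \<circ> g)"
proof -
  obtain r where r: "0 < r" "r \<le> e" "g (x - r) \<ge> g x - d"
    using daff_shrink_image[OF assms(1) _ assms(4)] assms(2) by auto
  have g: "daff {x - r..x} g" by (rule daff_mono[OF assms(1)]) (use r in auto)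
  have "g ` {x - r..x} \<subseteq> {g x - d..g x}" using daff_image(1)[OF g] r by auto
  then have "daff {x - r..x} (f \<circ> g)" using g assms(3) by (blast intro: daff_comp daff_mono)
  then show ?thesis using r that by blast
qed

lemma reg_comp:
  assumes "reg g x" "reg f (g x)"
  shows "reg (f \<circ> g) x"
proof -
  obtain e where e: "e > 0" "daff {x - e..x} g" "daff {x..x + e} g"
    "x \<in> dyadics \<or> daff {x - e..x + e} g" using assms(1) by (auto simp: reg_def)
  obtain d where d: "d > 0" "daff {g x - d..g x} f" "daff {g x..g x + d} f"
    "g x \<in> dyadics \<or> daff {g x - d..g x + d} f" using assms(2) by (auto simp: reg_def)
  obtain r where r: "0 < r" "r \<le> e" "g (x + r) \<le> g x + d"
    using daff_shrink_image[OF e(3) _ d(1)] e(1) by auto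
  obtain s where s: "0 < s" "s \<le> e" "g (x - s) \<ge> g x - d"
    using daff_shrink_image[OF e(2) _ d(1)] e(1) by auto
  show ?thesis
  proof (cases "x \<in> dyadics")
    case True
    obtain r' where "0 < r'" "daff {x..x + r'} (f \<circ> g)" using daff_comp_right[OF e(3,1) d(3,1)] by blast
    moreover obtain s' where "0 < s'" "daff {x - s'..x} (f \<circ> g)"
      using daff_comp_left[OF e(2,1) d(2,1)] by blast
    ultimately show ?thesis using True by (blast intro: regI_sides)
  next
    case False
    then have gx: "g x \<notin> dyadics" using reg_dyadic[OF assms(1)] by simp
    define m where "m = min r s"
    have g: "daff {x - e..x + e} g" using False e by auto
    have gm: "daff {x - m..x + m} g" by (rule daff_mono[OF g]) (use r s in \<open>auto simp: m_def\<close>)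
    have m0: "m > 0" using r s by (auto simp: m_def)
    have *: "g ` {x - m..x + m} = {g (x - m)..g (x + m)}" by (rule daff_image(1)[OF gm]) (use m0 in simp)
    have m1: "m \<le> r" "m \<le> s" by (auto simp: m_def)
    obtain n b where n: "\<And>t. t \<in> {x - e..x + e} \<Longrightarrow> g t = 2 powi n * t + b" using g by (auto simp: daff_def)
    have "g (x + m) \<le> g (x + r)" "g (x - s) \<le> g (x - m)"
      using m0 m1 r(1,2) s(1,2) n[of "x + m"] n[of "x + r"] n[of "x - s"] n[of "x - m"] by auto
    then have "g ` {x - m..x + m} \<subseteq> {g x - d..g x + d}" using r s * by auto
    then have "daff {x - m..x + m} (f \<circ> g)" using gm d gx by (blast intro: daff_comp daff_mono)
    then show ?thesis using r s by (intro regI_open[of m]) (auto simp: m_def)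
  qed
qed

lemma reg_inv:
  assumes "reg f x" "\<And>t. g (f t) = t"
  shows "reg g (f x)"
proof -
  obtain e where e: "e > 0" "daff {x - e..x} f" "daff {x..x + e} f"
    "x \<in> dyadics \<or> daff {x - e..x + e} f" using assms(1) by (auto simp: reg_def)
  show ?thesis
  proof (cases "x \<in> dyadics")
    case True
    have "daff {f x..f (x + e)} g" "f x < f (x + e)"
      using daff_inv[OF e(3), of g] daff_image[OF e(3)] e(1) assms(2) by auto
    moreover have "daff {f (x - e)..f x} g" "f (x - e) < f x"
      using daff_inv[OF e(2), of g] daff_image[OF e(2)] e(1) assms(2) by auto
    moreover have "f x \<in> dyadics" using True reg_dyadic assms by blast
    ultimately show ?thesis by (intro regI_sides[of "f x - f (x - e)" _ _ "f (x + e) - f x"]) auto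
  next
    case False
    then have g: "daff {x - e..x + e} f" using e by auto
    have *: "daff {f (x - e)..f (x + e)} g"
      using daff_inv[OF g, of g] daff_image[OF g] e(1) assms(2) by auto
    have "f x < f (x + e)" "f (x - e) < f x" 
      using daff_image(2)[OF e(3)] daff_image(2)[OF e(2)] e(1) by auto
    then show ?thesis
      by (intro regI_open[of "min (f x - f (x - e)) (f (x + e) - f x)"] daff_Icc_mono[OF *]) auto
  qed
qed

lemma reg_affine [simp]: "b \<in> dyadics \<Longrightarrow> reg (\<lambda>t. 2 powi n * t + b) x"
  by (rule regI_open[of 1]) (auto intro: daff_affine)

lemma reg_add [simp]: "b \<in> dyadics \<Longrightarrow> reg (\<lambda>t. t + b) x"
  using reg_affine[of b 0 x] by simp

lemma reg_id [simp]: "reg (\<lambda>t. t) x" "reg id x"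
  using reg_add[of 0 x] by (simp_all add: id_def)

lemma reg_shift:
  assumes "reg f (x + b)" "b \<in> dyadics" "c \<in> dyadics"
  shows "reg (\<lambda>t. f (t + b) + c) x"
  using reg_comp[OF reg_comp[of "\<lambda>t. t + b" x f] reg_add[of c]] assms by (simp add: comp_def)

text \<open>One-sided affinity on an interval gives two-sided affinity at its interior points, so being regular
  is an open condition. In particular singular points form a closed set.\<close>

lemma reg_punctured:
  assumes "reg f x"
  obtains e where "e > 0" "\<And>y. \<bar>y - x\<bar> < e \<Longrightarrow> reg f y"
proof -
  obtain e where e: "e > 0" "daff {x - e..x} f" "daff {x..x + e} f" using assms by (auto simp: reg_def)
  have "reg f y" if y: "\<bar>y - x\<bar> < e" for y
  proof -
    consider "y < x" | "y = x" | "y > x" by linarith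
    then show ?thesis
    proof cases
      case 1
      show ?thesis by (rule regI_open[of "min (x - y) (y - (x - e))"]) (use 1 y in \<open>auto intro!: daff_Icc_mono[OF e(2)]\<close>)
    next
      case 3
      show ?thesis by (rule regI_open[of "min (y - x) (x + e - y)"]) (use 3 y in \<open>auto intro!: daff_Icc_mono[OF e(3)]\<close>)
    qed (use assms in simp)
  qed
  then show ?thesis using that e(1) by blast
qed

text \<open>Conjugation by \<open>t \<mapsto> - t\<close>; it exchanges left and right germs.\<close>

definition refl_fun :: "(real \<Rightarrow> real) \<Rightarrow> real \<Rightarrow> real"
  where "refl_fun f t = - f (- t)"

lemma daff_refl: "daff (uminus ` S) f \<Longrightarrow> daff S (refl_fun f)"
proof -
  assume "daff (uminus ` S) f"
  then obtain n b where "b \<in> dyadics" "\<And>t. t \<in> S \<Longrightarrow> f (-t) = 2 powi n * (-t) + b" by (auto simp: daff_def)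
  then show ?thesis unfolding daff_def
    by (intro exI[of _ n] bexI[of _ "-b"]) (auto simp: refl_fun_def)
qed

lemma reg_refl:
  assumes "reg f (- x)"
  shows "reg (refl_fun f) x"
proof -
  obtain e where e: "e > 0" "daff {- x - e..- x} f" "daff {- x..- x + e} f"
    "- x \<in> dyadics \<or> daff {- x - e..- x + e} f" using assms(1) by (auto simp: reg_def)
  have *: "uminus ` {x - e..x} = {- x..- x + e}" "uminus ` {x..x + e} = {- x - e..- x}"
    "uminus ` {x - e..x + e} = {- x - e..- x + e}" by (auto simp: algebra_simps)
  show ?thesis unfolding reg_def
    using e dyadics_minus[of "- x"] by (intro exI[of _ e] conjI daff_refl) (auto simp: * intro!: daff_refl)
qed

section \<open>Homeomorphisms of the line\<close>

definition rhomeo :: "(real \<Rightarrow> real) set"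
  where "rhomeo = {f. strict_mono f \<and> surj f}"

text \<open>Groups of bijections are handled as closed sets of functions. This keeps membership of a composition
  independent of an ambient group structure.\<close>

definition fun_group :: "(real \<Rightarrow> real) set \<Rightarrow> bool"
  where "fun_group G \<longleftrightarrow> id \<in> G \<and> (\<forall>f\<in>G. \<forall>g\<in>G. f \<circ> g \<in> G) \<and> (\<forall>f\<in>G. inv f \<in> G)"

definition plh :: "(real \<Rightarrow> real) set"
  where "plh = {f \<in> rhomeo. \<forall>x. reg f x}"

lemma fun_groupD:
  "fun_group G \<Longrightarrow> id \<in> G" "fun_group G \<Longrightarrow> f \<in> G \<Longrightarrow> g \<in> G \<Longrightarrow> f \<circ> g \<in> G" "fun_group G \<Longrightarrow> f \<in> G \<Longrightarrow> inv f \<in> G"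
  by (auto simp: fun_group_def)

lemma rhomeo_less: "f \<in> rhomeo \<Longrightarrow> f x < f y \<longleftrightarrow> x < y"
  and rhomeo_le: "f \<in> rhomeo \<Longrightarrow> f x \<le> f y \<longleftrightarrow> x \<le> y"
  and rhomeo_eq: "f \<in> rhomeo \<Longrightarrow> f x = f y \<longleftrightarrow> x = y"
  by (auto simp: rhomeo_def strict_mono_less strict_mono_less_eq strict_mono_eq)

lemma rhomeo_bij: "f \<in> rhomeo \<Longrightarrow> bij f"
  by (auto simp: rhomeo_def bij_def strict_mono_imp_inj_on)

lemma rhomeo_inv_f [simp]: "f \<in> rhomeo \<Longrightarrow> inv f (f x) = x"
  and rhomeo_f_inv [simp]: "f \<in> rhomeo \<Longrightarrow> f (inv f x) = x"
  by (auto dest!: rhomeo_bij simp: bij_is_inj bij_is_surj surj_f_inv_f)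

lemma rhomeo_inv_comp: "f \<in> rhomeo \<Longrightarrow> inv f \<circ> f = id" "f \<in> rhomeo \<Longrightarrow> f \<circ> inv f = id"
  by (auto simp: fun_eq_iff)

lemma rhomeo_id [simp]: "id \<in> rhomeo" "(\<lambda>t. t) \<in> rhomeo"
  by (auto simp: rhomeo_def strict_mono_def)

lemma rhomeo_comp [simp]: "f \<in> rhomeo \<Longrightarrow> g \<in> rhomeo \<Longrightarrow> f \<circ> g \<in> rhomeo"
  unfolding rhomeo_def mem_Collect_eq by (intro conjI comp_surj) (auto simp: strict_mono_def)

lemma rhomeo_inv [simp]:
  assumes "f \<in> rhomeo" shows "inv f \<in> rhomeo"
proof -
  have "strict_mono (inv f)"
  proof (rule strict_monoI)
    fix x y :: real assume "x < y"
    then have "f (inv f x) < f (inv f y)" using assms by simp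
    then show "inv f x < inv f y" using rhomeo_less[OF assms] by blast
  qed
  then show ?thesis using rhomeo_bij[OF assms] by (auto simp: rhomeo_def bij_imp_bij_inv bij_is_surj)
qed

lemma rhomeo_inv_inv [simp]: "f \<in> rhomeo \<Longrightarrow> inv (inv f) = f"
  by (simp add: rhomeo_bij inv_inv_eq)

lemma rhomeo_inv_eq: "f \<in> rhomeo \<Longrightarrow> inv f y = x \<longleftrightarrow> y = f x"
  by auto

lemma rhomeo_inv_o: "f \<in> rhomeo \<Longrightarrow> g \<in> rhomeo \<Longrightarrow> inv (f \<circ> g) = inv g \<circ> inv f"
  by (simp add: o_inv_distrib rhomeo_bij)

lemma rhomeo_continuous: "f \<in> rhomeo \<Longrightarrow> continuous_on S f"
  by (rule continuous_on_subset[of UNIV], rule continuous_onI_mono)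
    (auto simp: rhomeo_def strict_mono_less_eq)

lemma rhomeo_near:
  assumes "f \<in> rhomeo" "u < f x" "f x < v" "d > 0"
  obtains e where "0 < e" "e < d" "\<And>t. \<bar>t - x\<bar> \<le> e \<Longrightarrow> u < f t \<and> f t < v"
proof -
  have "x - inv f u > 0" "inv f v - x > 0"
    using rhomeo_less[OF assms(1), of "inv f u" x] rhomeo_less[OF assms(1), of x "inv f v"] assms by auto
  define e where "e = min (min (x - inv f u) (inv f v - x)) d / 2"
  have e: "e > 0" "e < d" "e < x - inv f u" "e < inv f v - x"
    using \<open>x - inv f u > 0\<close> \<open>inv f v - x > 0\<close> assms(4) unfolding e_def by (auto simp: min_def)
  show ?thesis
  proof (rule that[of e])
    fix t assume "\<bar>t - x\<bar> \<le> e"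
    then have "inv f u < t" "t < inv f v" using e by auto
    then show "u < f t \<and> f t < v"
      using rhomeo_less[OF assms(1), of "inv f u" t] rhomeo_less[OF assms(1), of t "inv f v"] assms by auto
  qed (use e in auto)
qed

lemma plhI: "f \<in> rhomeo \<Longrightarrow> (\<And>x. reg f x) \<Longrightarrow> f \<in> plh"
  unfolding plh_def by blast

lemma plh_comp [simp]: "f \<in> plh \<Longrightarrow> g \<in> plh \<Longrightarrow> f \<circ> g \<in> plh"
  by (auto simp: plh_def intro!: reg_comp)

lemma reg_inv_rhomeo:
  assumes "f \<in> rhomeo" "reg f (inv f y)" shows "reg (inv f) y"
  using reg_inv[of f "inv f y" "inv f"] assms by auto

lemma plh_inv [simp]: "f \<in> plh \<Longrightarrow> inv f \<in> plh"
  by (auto simp: plh_def intro!: reg_inv_rhomeo)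

lemma plh_id [simp]: "id \<in> plh" "(\<lambda>t. t) \<in> plh"
  by (auto simp: plh_def)

lemma plh_rhomeo [simp]: "f \<in> plh \<Longrightarrow> f \<in> rhomeo"
  unfolding plh_def by blast

lemma plh_reg [simp]: "f \<in> plh \<Longrightarrow> reg f x"
  unfolding plh_def by blast

lemma rhomeo_affine: "(\<lambda>t. 2 powi n * t + b) \<in> rhomeo"
proof -
  have "\<exists>x. y = 2 powi n * x + b" for y :: real
    by (rule exI[of _ "(y - b) / 2 powi n"]) simp
  then have "surj (\<lambda>t. 2 powi n * t + b)" unfolding surj_def by blast
  moreover have "strict_mono (\<lambda>t. 2 powi n * t + b)"
    by (rule strict_monoI, rule add_strict_right_mono, rule mult_strict_left_mono) (assumption, rule powi_pos)
  ultimately show ?thesis unfolding rhomeo_def by blast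
qed

lemma plh_affine: "b \<in> dyadics \<Longrightarrow> (\<lambda>t. 2 powi n * t + b) \<in> plh"
  by (rule plhI) (auto simp: rhomeo_affine)

lemma plh_add [simp]: "b \<in> dyadics \<Longrightarrow> (\<lambda>t. t + b) \<in> plh"
  using plh_affine[of b 0] by simp

lemma refl_refl [simp]: "refl_fun (refl_fun f) = f"
  by (auto simp: refl_fun_def)

lemma refl_comp: "refl_fun (f \<circ> g) = refl_fun f \<circ> refl_fun g"
  by (auto simp: refl_fun_def)

lemma refl_id: "refl_fun id = id"
  by (auto simp: refl_fun_def)

lemma refl_rhomeo: "f \<in> rhomeo \<Longrightarrow> refl_fun f \<in> rhomeo"
proof -
  assume f: "f \<in> rhomeo"
  have "strict_mono (refl_fun f)" using rhomeo_less[OF f] by (auto simp: strict_mono_def refl_fun_def)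
  moreover have "refl_fun f (- (inv f (- y))) = y" for y using f by (simp add: refl_fun_def)
  then have "surj (refl_fun f)" by (metis surj_def)
  ultimately show ?thesis by (simp add: rhomeo_def)
qed

lemma refl_inv: "f \<in> rhomeo \<Longrightarrow> inv (refl_fun f) = refl_fun (inv f)"
  by (rule inv_equality) (auto simp: refl_fun_def)

lemma refl_plh: "f \<in> plh \<Longrightarrow> refl_fun f \<in> plh"
  by (rule plhI) (auto intro: refl_rhomeo reg_refl)

section \<open>Gluing and interpolation\<close>

definition glue :: "real \<Rightarrow> (real \<Rightarrow> real) \<Rightarrow> (real \<Rightarrow> real) \<Rightarrow> real \<Rightarrow> real"
  where "glue p f g t = (if t \<le> p then f t else g t)"

lemma glue_le [simp]: "t \<le> p \<Longrightarrow> glue p f g t = f t"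
  and glue_gt [simp]: "t > p \<Longrightarrow> glue p f g t = g t"
  by (auto simp: glue_def)

lemma glue_ge: "f p = g p \<Longrightarrow> t \<ge> p \<Longrightarrow> glue p f g t = g t"
  by (auto simp: glue_def)

lemma glue_rhomeo:
  assumes "f \<in> rhomeo" "g \<in> rhomeo" "f p = g p"
  shows "glue p f g \<in> rhomeo"
proof -
  have "strict_mono (glue p f g)"
  proof (rule strict_monoI)
    fix x y :: real assume "x < y"
    show "glue p f g x < glue p f g y"
    proof (cases "y \<le> p \<or> x > p")
      case True
      then show ?thesis using \<open>x < y\<close> rhomeo_less[OF assms(1)] rhomeo_less[OF assms(2)] by (auto simp: glue_def)
    next
      case False
      then have "f x \<le> f p" "g p < g y" using rhomeo_le[OF assms(1)] rhomeo_less[OF assms(2)] by auto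
      then show ?thesis using False assms(3) by (simp add: glue_def)
    qed
  qed
  moreover have "\<exists>x. glue p f g x = y" for y
  proof (cases "y \<le> f p")
    case True
    then have "f (inv f y) \<le> f p" using assms by simp
    then have "inv f y \<le> p" using rhomeo_le[OF assms(1)] by blast
    then show ?thesis using assms by (intro exI[of _ "inv f y"]) simp
  next
    case False
    then have "g p < g (inv g y)" using assms by simp
    then have "p < inv g y" using rhomeo_less[OF assms(2)] by blast
    then show ?thesis using assms by (intro exI[of _ "inv g y"]) simp
  qed
  ultimately show ?thesis unfolding rhomeo_def surj_def by (auto, metis)
qed

text \<open>At a dyadic point no compatibility of slopes is required, so agreement of the values suffices.\<close>

lemma reg_glue:
  assumes "p \<in> dyadics" "f p = g p" "x \<le> p \<Longrightarrow> reg f x" "x \<ge> p \<Longrightarrow> reg g x"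
  shows "reg (glue p f g) x"
proof -
  consider "x < p" | "x > p" | "x = p" by linarith
  then show ?thesis
  proof cases
    case 1
    then show ?thesis using reg_cong_open[of f x "x - 1" p "glue p f g"] assms by auto
  next
    case 2
    then show ?thesis using reg_cong_open[of g x p "x + 1" "glue p f g"] assms by auto
  next
    case 3
    obtain e where e: "e > 0" "daff {p - e..p} f" using assms(3) 3 by (auto simp: reg_def)
    obtain d where d: "d > 0" "daff {p..p + d} g" using assms(4) 3 by (auto simp: reg_def)
    have "daff {p - e..p} (glue p f g)" by (rule daff_cong[OF e(2)]) auto
    moreover have "daff {p..p + d} (glue p f g)" by (rule daff_cong[OF d(2)]) (use assms(2) in \<open>auto simp: glue_ge\<close>)
    ultimately show ?thesis unfolding 3 using assms(1) e(1) d(1) by (blast intro: regI_sides)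
  qed
qed

lemma glue_plh: "f \<in> plh \<Longrightarrow> g \<in> plh \<Longrightarrow> p \<in> dyadics \<Longrightarrow> f p = g p \<Longrightarrow> glue p f g \<in> plh"
  by (rule plhI) (auto intro!: glue_rhomeo reg_glue)

text \<open>Two slopes suffice. If \<open>2^i\<close> is the largest power of two not exceeding the quotient of the lengths, a map with
  slope \<open>2^(i+1)\<close> up to a break point and slope \<open>2^i\<close> after it has the right length for exactly one position of the
  break point, and that position is dyadic because the difference of the slopes is a power of two.\<close>

lemma plh_interpolate:
  assumes "a < b" "a' < b'" "a \<in> dyadics" "b \<in> dyadics" "a' \<in> dyadics" "b' \<in> dyadics"
  obtains j where "j \<in> plh" "j a = a'" "j b = b'"
proof -
  define i where "i = \<lfloor>log 2 ((b' - a') / (b - a))\<rfloor>"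
  define q where "q = (b' - a') / (b - a)"
  have q: "q > 0" using assms by (simp add: q_def)
  have "2 powi i \<le> q" "q < 2 powi (i + 1)"
  proof -
    have "real_of_int i \<le> log 2 q" "log 2 q < real_of_int (i + 1)"
      unfolding i_def q_def[symmetric] by linarith+
    then have "2 powr real_of_int i \<le> q" "q < 2 powr real_of_int (i + 1)"
      using q le_log_iff[of 2 q] log_less_iff[of 2 q] by auto
    moreover have "(2::real) powr real_of_int k = 2 powi k" for k
      by (rule powr_real_of_int') auto
    ultimately show "2 powi i \<le> q" "q < 2 powi (i + 1)" by (simp_all only:)
  qed
  moreover have "2 powi (i + 1) = 2 powi i * (2::real)" by (simp add: powi_add2)
  ultimately have i: "2 powi i * (b - a) \<le> b' - a'" "b' - a' < 2 powi i * 2 * (b - a)"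
    unfolding q_def using assms(1) by (simp_all only: pos_le_divide_eq pos_divide_less_eq diff_gt_0_iff_gt)
  define s where "s = (b' - a') * 2 powi (- i) - (b - a)"
  have si: "2 powi i * s = (b' - a') - 2 powi i * (b - a)"
    by (simp add: s_def right_diff_distrib power_int_minus)
  have s0: "0 \<le> s" using si i(1) mult_le_cancel_left_pos[of "2 powi i" 0 s] by simp
  have "2 powi i * s < 2 powi i * (b - a)" using si i(2) by linarith
  then have s1: "s < b - a" by (rule mult_left_less_imp_less) simp
  have sd: "s \<in> dyadics" using assms by (auto simp: s_def)
  define f where "f = (\<lambda>t. 2 powi (i + 1) * t + (a' - 2 powi (i + 1) * a))"
  define g where "g = (\<lambda>t. 2 powi i * t + (b' - 2 powi i * b))"
  have "f (a + s) - g (a + s) = 2 powi i * s - ((b' - a') - 2 powi i * (b - a))"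
    by (simp add: f_def g_def powi_add2 algebra_simps)
  then have fg: "f (a + s) = g (a + s)" using si by simp
  have "glue (a + s) f g \<in> plh"
  proof (rule glue_plh)
    show "f (a + s) = g (a + s)" by (rule fg)
  qed (use assms sd in \<open>auto simp: f_def g_def intro!: plh_affine\<close>)
  moreover have "glue (a + s) f g a = a'" using s0 by (simp add: f_def)
  moreover have "glue (a + s) f g b = b'" using s1 by (simp add: g_def)
  ultimately show ?thesis by (rule that)
qed

text \<open>A regular map can be kept on \<open>[p, p']\<close> and forced to be the identity outside any larger interval
  that contains \<open>[p, p']\<close> and its image: interpolate on the two remaining gaps.\<close>

lemma plh_extend:
  assumes f: "f \<in> rhomeo" and reg: "\<And>x. p \<le> x \<Longrightarrow> x \<le> p' \<Longrightarrow> reg f x"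
    and p: "p \<in> dyadics" "p' \<in> dyadics" "p \<le> p'"
    and c: "c < p" "c < f p" and d: "p' < d" "f p' < d"
  obtains u c' d' where "u \<in> plh" "\<And>x. p \<le> x \<Longrightarrow> x \<le> p' \<Longrightarrow> u x = f x"
    "c' \<in> dyadics" "d' \<in> dyadics" "c < c'" "c' < p" "p' < d'" "d' < d"
    "\<And>x. x \<le> c' \<or> x \<ge> d' \<Longrightarrow> u x = x"
proof -
  obtain c' where c': "c' \<in> dyadics" "c < c'" "c' < p" "c' < f p"
    using dyadics_dense[of c "min p (f p)"] c by auto
  obtain d' where d': "d' \<in> dyadics" "d' < d" "p' < d'" "f p' < d'"
    using dyadics_dense[of "max p' (f p')" d] d by auto
  have fd: "f p \<in> dyadics" "f p' \<in> dyadics"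
    using reg_dyadic[OF reg, of p] reg_dyadic[OF reg, of p'] p by auto
  obtain j where j: "j \<in> plh" "j c' = c'" "j p = f p"
    using plh_interpolate[of c' p c' "f p"] c' fd p by auto
  obtain k where k: "k \<in> plh" "k p' = f p'" "k d' = d'"
    using plh_interpolate[of p' d' "f p'" d'] d' fd p by auto
  define u1 where "u1 = glue d' k id"
  have u1: "u1 \<in> plh" unfolding u1_def by (rule glue_plh) (use k d' in auto)
  have u1p: "f p' = u1 p'" using d' k by (simp add: u1_def)
  define u2 where "u2 = glue p' f u1"
  have u2: "u2 \<in> rhomeo" "\<And>x. p \<le> x \<Longrightarrow> reg u2 x"
    using u1 u1p p f by (auto simp: u2_def intro!: glue_rhomeo reg_glue reg)
  have u2p: "j p = u2 p" using p j by (simp add: u2_def)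
  define u3 where "u3 = glue p j u2"
  have u3: "u3 \<in> plh" unfolding u3_def
    using j u2 u2p p by (auto intro!: plhI glue_rhomeo reg_glue)
  have u3c: "u3 c' = c'" using c' j by (simp add: u3_def)
  define u where "u = glue c' id u3"
  have "u \<in> plh" unfolding u_def by (rule glue_plh) (use u3 u3c c' in auto)
  moreover have "u x = f x" if "p \<le> x" "x \<le> p'" for x
    using that c' u2p by (cases "x = p") (auto simp: u_def u3_def u2_def j)
  moreover have "u x = x" if "x \<le> c' \<or> x \<ge> d'" for x
    using that c' d' p by (cases "x = d'") (auto simp: u_def u3_def u2_def u1_def k)
  ultimately show ?thesis using that c' d' by blast
qed

section \<open>Periodic maps\<close>

text \<open>The \<open>M\<close>-periodic extension of the restriction of \<open>u\<close> to \<open>[a, a + M]\<close>; it is meaningful when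
  \<open>u (a + M) = u a + M\<close>.\<close>

definition per :: "real \<Rightarrow> real \<Rightarrow> (real \<Rightarrow> real) \<Rightarrow> real \<Rightarrow> real"
  where "per M a u t = u (t - M * of_int \<lfloor>(t - a) / M\<rfloor>) + M * of_int \<lfloor>(t - a) / M\<rfloor>"

lemma per_eq:
  assumes "M > 0" "a + M * of_int k \<le> t" "t < a + M * (of_int k + 1)"
  shows "per M a u t = u (t - M * of_int k) + M * of_int k"
proof -
  have "\<lfloor>(t - a) / M\<rfloor> = k" using assms by (simp add: floor_eq_iff field_simps)
  then show ?thesis by (simp add: per_def)
qed

lemma per_eq':
  assumes "M > 0" "u (a + M) = u a + M" "a + M * of_int k \<le> t" "t \<le> a + M * (of_int k + 1)"
  shows "per M a u t = u (t - M * of_int k) + M * of_int k"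
proof (cases "t = a + M * (of_int k + 1)")
  case True
  then have "per M a u t = u (t - M * of_int (k + 1)) + M * of_int (k + 1)"
    using assms(1) by (intro per_eq) (auto simp: algebra_simps)
  then show ?thesis using assms(2) True by (simp add: algebra_simps)
qed (use assms in \<open>auto intro: per_eq\<close>)

lemma per_eq0:
  assumes "M > 0" "a \<le> t" "t < a + M" shows "per M a u t = u t"
  using per_eq[of M a 0 t u] assms by simp

lemma per_eq0':
  assumes "M > 0" "u (a + M) = u a + M" "a \<le> t" "t \<le> a + M" shows "per M a u t = u t"
  using per_eq'[of M u a 0 t] assms by simp

lemma per_add: "M > 0 \<Longrightarrow> per M a u (t + M) = per M a u t + M"
proof -
  assume "M > 0"
  then have "(t + M - a) / M = (t - a) / M + 1" by (simp add: field_simps)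
  then show ?thesis by (simp add: per_def algebra_simps)
qed

lemma floor_period:
  assumes "(M::real) > 0"
  obtains k :: int where "a + M * of_int k \<le> t" "t < a + M * (of_int k + 1)"
proof (rule that[of "\<lfloor>(t - a) / M\<rfloor>"])
  have "of_int \<lfloor>(t - a) / M\<rfloor> * M \<le> t - a" "t - a < (of_int \<lfloor>(t - a) / M\<rfloor> + 1) * M"
    using assms floor_correct[of "(t - a) / M"] by (auto simp only: pos_le_divide_eq pos_divide_less_eq of_int_add of_int_1)
  then show "a + M * of_int \<lfloor>(t - a) / M\<rfloor> \<le> t" "t < a + M * (of_int \<lfloor>(t - a) / M\<rfloor> + 1)"
    by (simp_all add: algebra_simps)
qed

lemma floor_period':
  assumes "(M::real) > 0"
  obtains k :: int where "a + M * of_int k < t" "t \<le> a + M * (of_int k + 1)"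
proof (rule that[of "\<lceil>(t - a) / M\<rceil> - 1"])
  have "(of_int \<lceil>(t - a) / M\<rceil> - 1) * M < t - a" "t - a \<le> of_int \<lceil>(t - a) / M\<rceil> * M"
    using assms ceiling_correct[of "(t - a) / M"] by (auto simp only: pos_less_divide_eq pos_divide_le_eq)
  then show "a + M * of_int (\<lceil>(t - a) / M\<rceil> - 1) < t" "t \<le> a + M * (of_int (\<lceil>(t - a) / M\<rceil> - 1) + 1)"
    by (simp_all add: algebra_simps)
qed

lemma periodic_int:
  assumes "\<And>x. f (x + M) = f x + (M::real)"
  shows "f (x + M * of_int k) = f x + M * of_int k"
proof -
  have n: "f (x + M * of_nat n) = f x + M * of_nat n" for x n
  proof (induction n)
    case (Suc n)
    have "f (x + M * of_nat (Suc n)) = f ((x + M * of_nat n) + M)" by (simp add: algebra_simps)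
    also have "\<dots> = f x + M * of_nat (Suc n)" by (simp only: assms Suc) (simp add: algebra_simps)
    finally show ?case .
  qed simp
  show ?thesis
  proof (cases "k \<ge> 0")
    case True
    then show ?thesis using n[of x "nat k"] by simp
  next
    case False
    then show ?thesis using n[of "x + M * of_int k" "nat (- k)"] by simp
  qed
qed

lemma per_rhomeo:
  assumes "u \<in> rhomeo" "u (a + M) = u a + M" "M > 0"
  shows "per M a u \<in> rhomeo"
proof -
  let ?g = "per M a u"
  have add: "?g (x + M * of_int k) = ?g x + M * of_int k" for x k
    by (rule periodic_int) (rule per_add[OF assms(3)])
  have "strict_mono ?g"
  proof (rule strict_monoI)
    fix x y :: real assume xy: "x < y"
    obtain k where k: "a + M * of_int k \<le> x" "x < a + M * (of_int k + 1)" using floor_period[OF assms(3)] .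
    obtain l where l: "a + M * of_int l \<le> y" "y < a + M * (of_int l + 1)" using floor_period[OF assms(3)] .
    have gx: "?g x = u (x - M * of_int k) + M * of_int k" by (rule per_eq[OF assms(3) k])
    have gy: "?g y = u (y - M * of_int l) + M * of_int l" by (rule per_eq[OF assms(3) l])
    have "M * of_int k < M * (of_int l + 1)" using k l xy by linarith
    then have "of_int k < (of_int l + 1 :: real)" using assms(3) by simp
    then have "k \<le> l" by linarith
    show "?g x < ?g y"
    proof (cases "k = l")
      case True
      then show ?thesis using gx gy xy rhomeo_less[OF assms(1)] by simp
    next
      case False
      then have "k + 1 \<le> l" using \<open>k \<le> l\<close> by simp
      then have "of_int (k + 1) \<le> (of_int l :: real)" by (simp only: of_int_le_iff)
      then have "M * of_int (k + 1) \<le> M * of_int l" by (rule mult_left_mono) (use assms(3) in simp)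
      moreover have "u (x - M * of_int k) < u (a + M)" using rhomeo_less[OF assms(1)] k by (simp add: algebra_simps)
      moreover have "u a \<le> u (y - M * of_int l)" using rhomeo_le[OF assms(1)] l by simp
      ultimately show ?thesis using gx gy assms(2) by (simp add: algebra_simps)
    qed
  qed
  moreover have "\<exists>x. ?g x = y" for y
  proof -
    obtain k where k: "u a + M * of_int k \<le> y" "y < u a + M * (of_int k + 1)" using floor_period[OF assms(3)] .
    define x where "x = inv u (y - M * of_int k)"
    have ux: "u x = y - M * of_int k" using assms(1) by (simp add: x_def)
    have "u a \<le> u x" "u x < u (a + M)" using k ux assms(2) by (auto simp: algebra_simps)
    then have "a \<le> x" "x < a + M" using rhomeo_le[OF assms(1)] rhomeo_less[OF assms(1)] by auto
    then have "?g x = u x" by (rule per_eq0[OF assms(3)])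
    then have "?g (x + M * of_int k) = y" using add ux by simp
    then show ?thesis by blast
  qed
  ultimately show ?thesis unfolding rhomeo_def surj_def by (auto, metis)
qed

lemma reg_periodic:
  assumes "\<And>x. f (x + M) = f x + (M::real)" "M \<in> dyadics"
  shows "reg f (x + M * of_int k) \<longleftrightarrow> reg f x"
proof -
  have *: "reg f (x + M * of_int k) \<Longrightarrow> reg f x" for x k
  proof -
    assume "reg f (x + M * of_int k)"
    then have "reg (\<lambda>t. f (t + M * of_int k) + - (M * of_int k)) x"
      by (rule reg_shift) (use assms in auto)
    then show ?thesis by (simp add: periodic_int[of f M, OF assms(1)])
  qed
  show ?thesis using *[of x k] *[of "x + M * of_int k" "- k"] by auto
qed

text \<open>At \<open>a\<close> the periodic extension joins the germs of \<open>u\<close> at \<open>a + M\<close> and at \<open>a\<close>, hence the extra hypothesis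
  for \<open>x = a\<close>.\<close>

lemma reg_per:
  assumes "M > 0" "a \<in> dyadics" "M \<in> dyadics" "u (a + M) = u a + M"
    and "a \<le> x" "x < a + M" "reg u x" "x = a \<Longrightarrow> reg u (a + M)"
  shows "reg (per M a u) x"
proof (cases "x = a")
  case False
  show ?thesis
    by (rule reg_cong_open[of u x a "a + M"]) (use assms False in \<open>auto simp: per_eq0\<close>)
next
  case True
  have "reg (\<lambda>t. u (t + M) + - M) a" by (rule reg_shift) (use assms True in auto)
  then have "reg (glue a (\<lambda>t. u (t + M) + - M) u) a"
    using assms True by (intro reg_glue) auto
  then show ?thesis unfolding True
  proof (rule reg_cong_open[of _ _ "a - M" "a + M"])
    fix t assume t: "a - M < t" "t < a + M"
    show "glue a (\<lambda>t. u (t + M) + - M) u t = per M a u t"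
    proof (cases "t \<le> a")
      case True
      then show ?thesis using per_eq'[of M u a "-1" t] t assms by (simp add: algebra_simps)
    next
      case False
      then show ?thesis using t assms by (simp add: per_eq0)
    qed
  qed (use assms in auto)
qed

text \<open>Lifts to the line of the elements of T acting on the circle of length \<open>M\<close>.\<close>

definition lifts_T :: "real \<Rightarrow> (real \<Rightarrow> real) set"
  where "lifts_T M = {f \<in> plh. \<forall>x. f (x + M) = f x + M}"

lemma periodic_inv:
  assumes "f \<in> rhomeo" "\<And>x. f (x + M) = f x + M"
  shows "inv f (x + M) = inv f x + M"
proof -
  have "x + M = f (inv f x + M)" using assms by simp
  then show ?thesis using assms(1) rhomeo_inv_eq by blast
qed

lemma fun_group_lifts_T: "fun_group (lifts_T M)"
  by (auto simp: fun_group_def lifts_T_def periodic_inv)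

lemma lifts_T_plh: "f \<in> lifts_T M \<Longrightarrow> f \<in> plh"
  by (simp add: lifts_T_def)

lemma lifts_T_add: "f \<in> lifts_T M \<Longrightarrow> f (x + M) = f x + M"
  by (simp add: lifts_T_def)

lemma per_lifts_T:
  assumes "u \<in> plh" "a \<in> dyadics" "M \<in> dyadics" "M > 0" "u (a + M) = u a + M"
  shows "per M a u \<in> lifts_T M"
proof -
  have "reg (per M a u) x" for x
  proof -
    obtain k where k: "a + M * of_int k \<le> x" "x < a + M * (of_int k + 1)" using floor_period[OF assms(4)] .
    have "reg (per M a u) (x - M * of_int k)"
      by (rule reg_per) (use assms k in \<open>auto simp: algebra_simps\<close>)
    then show ?thesis using reg_periodic[of "per M a u" M "x - M * of_int k" k] per_add assms by auto
  qed
  then have "per M a u \<in> plh" using assms per_rhomeo by (intro plhI) auto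
  then show ?thesis using assms per_add by (simp add: lifts_T_def)
qed

text \<open>The elements of \<open>lifts_T M\<close> whose support is compact in \<open>(a, b)\<close> modulo \<open>M\<close>, in the case \<open>b \<le> a + M\<close>. The condition is
  stated as triviality on the complementary interval \<open>[b', a' + M]\<close> of one period.\<close>

definition Tsupp :: "real \<Rightarrow> real \<Rightarrow> real \<Rightarrow> (real \<Rightarrow> real) set"
  where "Tsupp M a b = {g \<in> lifts_T M. \<exists>a' b'. a < a' \<and> a' \<le> b' \<and> b' < b \<and> (\<forall>t\<in>{b'..a' + M}. g t = t)}"

lemma TsuppI:
  "g \<in> lifts_T M \<Longrightarrow> a < a' \<Longrightarrow> a' \<le> b' \<Longrightarrow> b' < b \<Longrightarrow> (\<And>t. b' \<le> t \<Longrightarrow> t \<le> a' + M \<Longrightarrow> g t = t) \<Longrightarrow> g \<in> Tsupp M a b"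
  unfolding Tsupp_def mem_Collect_eq by (intro conjI exI[of _ a'] exI[of _ b'] ballI) auto

lemma TsuppE:
  assumes "g \<in> Tsupp M a b"
  obtains a' b' where "g \<in> lifts_T M" "a < a'" "a' \<le> b'" "b' < b" "\<And>t. b' \<le> t \<Longrightarrow> t \<le> a' + M \<Longrightarrow> g t = t"
  using assms unfolding Tsupp_def by auto

lemma Tsupp_mono:
  assumes "a0 \<le> a" "b \<le> b0"
  shows "Tsupp M a b \<subseteq> Tsupp M a0 b0"
proof
  fix g assume "g \<in> Tsupp M a b"
  then obtain a1 b1 where "g \<in> lifts_T M" "a < a1" "a1 \<le> b1" "b1 < b" "\<forall>t\<in>{b1..a1 + M}. g t = t"
    unfolding Tsupp_def by blast
  then show "g \<in> Tsupp M a0 b0" using assms by (intro TsuppI[of g M a0 a1 b1 b0]) auto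
qed

lemma Tsupp_lifts_T: "g \<in> Tsupp M a b \<Longrightarrow> g \<in> lifts_T M"
  by (simp add: Tsupp_def)

lemma Tsupp_comp:
  assumes "f \<in> Tsupp M a b" "g \<in> Tsupp M a b"
  shows "f \<circ> g \<in> Tsupp M a b"
proof -
  obtain a1 b1 where 1: "a < a1" "a1 \<le> b1" "b1 < b" "\<And>t. b1 \<le> t \<Longrightarrow> t \<le> a1 + M \<Longrightarrow> f t = t"
    using assms by (auto simp: Tsupp_def)
  obtain a2 b2 where 2: "a < a2" "a2 \<le> b2" "b2 < b" "\<And>t. b2 \<le> t \<Longrightarrow> t \<le> a2 + M \<Longrightarrow> g t = t"
    using assms by (auto simp: Tsupp_def)
  have "f \<circ> g \<in> lifts_T M" using assms fun_groupD(2)[OF fun_group_lifts_T] by (auto simp: Tsupp_def)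
  then show ?thesis
    by (rule TsuppI[where a' = "min a1 a2" and b' = "max b1 b2"]) (use 1 2 in auto)
qed

lemma Tsupp_inv:
  assumes "f \<in> Tsupp M a b"
  shows "inv f \<in> Tsupp M a b"
proof -
  obtain a1 b1 where 1: "a < a1" "a1 \<le> b1" "b1 < b" "\<And>t. b1 \<le> t \<Longrightarrow> t \<le> a1 + M \<Longrightarrow> f t = t"
    using assms by (auto simp: Tsupp_def)
  have f: "f \<in> rhomeo" using lifts_T_plh[OF Tsupp_lifts_T[OF assms]] by simp
  have "inv f \<in> lifts_T M" using assms fun_groupD(3)[OF fun_group_lifts_T] by (auto simp: Tsupp_def)
  moreover have "\<forall>t\<in>{b1..a1 + M}. inv f t = t" using 1(4) rhomeo_inv_eq[OF f] by auto
  ultimately show ?thesis unfolding Tsupp_def using 1 by blast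
qed

text \<open>A regular germ is realised by an element of T supported in any interval that contains the point and its
  image and is not longer than a period. The germ is first widened to a small dyadic interval around
  \<open>p\<close>, since \<open>p\<close> itself may fail to be dyadic.\<close>

lemma Tsupp_match:
  assumes g: "g \<in> rhomeo" "reg g p" and p: "a < p" "p < b" "a < g p" "g p < b" and M: "b \<le> a + M" "M \<in> dyadics"
  obtains u e where "u \<in> Tsupp M a b" "e > 0" "\<And>t. \<bar>t - p\<bar> \<le> e \<Longrightarrow> u t = g t"
proof -
  obtain r where r: "r > 0" "\<And>y. \<bar>y - p\<bar> < r \<Longrightarrow> reg g y" using reg_punctured[OF g(2)] by blast
  have "0 < min r (min (p - a) (b - p))" using p r by auto
  then obtain e0 where e0: "0 < e0" "e0 < min r (min (p - a) (b - p))" "\<And>t. \<bar>t - p\<bar> \<le> e0 \<Longrightarrow> a < g t \<and> g t < b"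
    using rhomeo_near[OF g(1) p(3,4)] by metis
  obtain p1 where p1: "p1 \<in> dyadics" "p - e0 < p1" "p1 < p" using dyadics_dense[of "p - e0" p] e0(1) by auto
  obtain p2 where p2: "p2 \<in> dyadics" "p < p2" "p2 < p + e0" using dyadics_dense[of p "p + e0"] e0(1) by auto
  have M0: "M > 0" using p M by linarith
  obtain u c' d' where u: "u \<in> plh" "\<And>x. p1 \<le> x \<Longrightarrow> x \<le> p2 \<Longrightarrow> u x = g x"
    "c' \<in> dyadics" "d' \<in> dyadics" "a < c'" "c' < p1" "p2 < d'" "d' < b"
    "\<And>x. x \<le> c' \<or> x \<ge> d' \<Longrightarrow> u x = x"
  proof (rule plh_extend[of g p1 p2 a b])
    show "reg g x" if "p1 \<le> x" "x \<le> p2" for x using that p1 p2 e0(2) by (intro r(2)) auto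
    show "a < g p1" "g p2 < b" using e0(3)[of p1] e0(3)[of p2] p1 p2 by auto
  qed (use g p1 p2 e0(2) in auto)
  let ?v = "per M c' u"
  have uc: "u (c' + M) = u c' + M" using u(9)[of c'] u(9)[of "c' + M"] u(5,8) M by auto
  have v: "?v \<in> lifts_T M" using per_lifts_T[OF u(1,3) M(2) M0 uc] .
  have eq: "?v t = u t" if "c' \<le> t" "t \<le> c' + M" for t using per_eq0'[OF M0 uc that] .
  have "?v \<in> Tsupp M a b" using v
    by (rule TsuppI[where a' = c' and b' = d']) (use u(5-8) p1 p2 in \<open>auto simp: eq u(9)\<close>)
  moreover have "?v t = g t" if "\<bar>t - p\<bar> \<le> min (p - p1) (p2 - p)" for t
  proof -
    have t: "p1 \<le> t" "t \<le> p2" using that by auto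
    have "?v t = u t" by (rule eq) (use t u(5-8) M in auto)
    also have "\<dots> = g t" by (rule u(2)[OF t])
    finally show ?thesis .
  qed
  ultimately show ?thesis using that[of ?v "min (p - p1) (p2 - p)"] p1 p2 by auto
qed

lemma lifts_T_ext:
  assumes "f \<in> lifts_T M" "g \<in> lifts_T M" "M > 0" "\<And>t. a \<le> t \<Longrightarrow> t < a + M \<Longrightarrow> f t = g t"
  shows "f = g"
proof
  fix x
  obtain k where k: "a + M * of_int k \<le> x" "x < a + M * (of_int k + 1)" using floor_period[OF assms(3)] .
  have "f (x - M * of_int k) = g (x - M * of_int k)" using k by (intro assms(4)) (auto simp: algebra_simps)
  then show "f x = g x"
    using periodic_int[of f M "x - M * of_int k" k] periodic_int[of g M "x - M * of_int k" k] assms(1,2)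
    by (auto simp: lifts_T_def)
qed

text \<open>Fragmentation over two overlapping intervals. For a dyadic \<open>p\<close> in the overlap, the image \<open>g p\<close> lies in one
  of the two intervals, so an element \<open>u\<close> of one of the two groups has \<open>u p = g p\<close>. Then \<open>u\<inverse> g\<close> fixes \<open>p\<close> and is the product of its
  restrictions to the two sides of \<open>p\<close>, which are again regular since \<open>p\<close> is dyadic.\<close>

lemma Tsupp_split:
  assumes ab: "a < b" "b < b'" "b' < c" "c \<le> a + M" and M: "M \<in> dyadics"
    and G: "fun_group G" "Tsupp M a b' \<subseteq> G" "Tsupp M b c \<subseteq> G"
  shows "Tsupp M a c \<subseteq> G"
proof
  fix g assume g: "g \<in> Tsupp M a c"
  have M0: "M > 0" using ab by linarith
  have gp: "g \<in> plh" "g \<in> rhomeo" using lifts_T_plh[OF Tsupp_lifts_T[OF g]] by simp_all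
  obtain a1 b1 where 1: "a < a1" "a1 \<le> b1" "b1 < c" "\<And>t. b1 \<le> t \<Longrightarrow> t \<le> a1 + M \<Longrightarrow> g t = t"
    using g by (auto simp: Tsupp_def)
  obtain p where p: "p \<in> dyadics" "b < p" "p < b'" using dyadics_dense[OF ab(2)] .
  have "g (a + M) = g a + M" by (rule lifts_T_add[OF Tsupp_lifts_T[OF g]])
  moreover have "g (a + M) = a + M" "g c = c" using 1 ab by auto
  ultimately have "a < g p" "g p < c"
    using rhomeo_less[OF gp(2), of a p] rhomeo_less[OF gp(2), of p c] p ab by auto
  \<comment> \<open>\<open>a < b < b' < c\<close>: the point \<open>g p\<close> is below \<open>b'\<close> or above \<open>b\<close>\<close>
  have "\<exists>u\<in>G \<inter> Tsupp M a c. u p = g p"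
  proof (cases "g p < b'")
    case True
    obtain u e where "u \<in> Tsupp M a b'" "e > 0" "\<And>t. \<bar>t - p\<bar> \<le> e \<Longrightarrow> u t = g t"
      using Tsupp_match[OF gp(2) plh_reg[OF gp(1)], of a p b' M] p ab M True \<open>a < g p\<close> by auto
    then show ?thesis using G(2) Tsupp_mono[of a a b' c M] ab by (intro bexI[of _ u]) auto
  next
    case False
    obtain u e where "u \<in> Tsupp M b c" "e > 0" "\<And>t. \<bar>t - p\<bar> \<le> e \<Longrightarrow> u t = g t"
      using Tsupp_match[OF gp(2) plh_reg[OF gp(1)], of b p c M] p ab M False \<open>g p < c\<close> by auto
    then show ?thesis using G(3) Tsupp_mono[of a b c c M] ab by (intro bexI[of _ u]) auto
  qed
  then obtain u where u: "u \<in> G" "u \<in> Tsupp M a c" "u p = g p" by auto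
  have ur: "u \<in> rhomeo" using lifts_T_plh[OF Tsupp_lifts_T[OF u(2)]] by simp
  define v where "v = inv u \<circ> g"
  have v: "v \<in> Tsupp M a c" unfolding v_def using u g by (intro Tsupp_comp Tsupp_inv)
  have vp: "v p = p" using u ur by (simp add: v_def rhomeo_inv_eq)
  have vr: "v \<in> plh" "v \<in> rhomeo" "v \<in> lifts_T M" using lifts_T_plh[OF Tsupp_lifts_T[OF v]] Tsupp_lifts_T[OF v] by simp_all
  obtain a2 b2 where 2: "a < a2" "a2 \<le> b2" "b2 < c" "\<And>t. b2 \<le> t \<Longrightarrow> t \<le> a2 + M \<Longrightarrow> v t = t"
    using v by (auto simp: Tsupp_def)
  obtain q where q: "q \<in> dyadics" "a < q" "q < min a2 b" using dyadics_dense[of a "min a2 b"] 2 ab by auto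
  have "v (q + M) = q + M" using 2 q ab by auto
  then have vq: "v q = q" "v (q + M) = v q + M" using lifts_T_add[OF vr(3)] by auto
  have qp: "q < p" "p < q + M" using q p ab 2 by auto
  let ?v1 = "glue p v id" and ?v2 = "glue p id v"
  have v1: "?v1 \<in> plh" "?v1 (q + M) = ?v1 q + M" and v2: "?v2 \<in> plh" "?v2 (q + M) = ?v2 q + M"
    using vr vp vq p qp by (auto intro!: glue_plh)
  have T1: "per M q ?v1 \<in> lifts_T M" and T2: "per M q ?v2 \<in> lifts_T M"
    by (rule per_lifts_T[OF v1(1) q(1) M M0 v1(2)], rule per_lifts_T[OF v2(1) q(1) M M0 v2(2)])
  have e1: "per M q ?v1 t = ?v1 t" and e2: "per M q ?v2 t = ?v2 t" if "q \<le> t" "t \<le> q + M" for t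
    by (rule per_eq0'[OF M0 v1(2) that], rule per_eq0'[OF M0 v2(2) that])
  have "per M q ?v1 \<in> Tsupp M a b'" using T1
    by (rule TsuppI[where a' = q and b' = p]) (use q p qp vp in \<open>auto simp: e1 glue_ge\<close>)
  then have G1: "per M q ?v1 \<in> G" using G by auto
  have "per M q ?v2 t = t" if "max p b2 \<le> t" "t \<le> p + M" for t
  proof (cases "t \<le> q + M")
    case True
    then show ?thesis using that q qp vp 2 by (auto simp: e2 glue_ge)
  next
    case False
    have "per M q ?v2 ((t - M) + M) = per M q ?v2 (t - M) + M" by (rule per_add[OF M0])
    then show ?thesis using that q qp False by (auto simp: e2)
  qed
  note v2_id = this
  have "per M q ?v2 \<in> Tsupp M b c"
    by (rule TsuppI[where a' = p and b' = "max p b2", OF T2 _ _ _ v2_id]) (use q p qp 2 ab in auto)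
  then have G2: "per M q ?v2 \<in> G" using G by auto
  have "v = per M q ?v1 \<circ> per M q ?v2"
  proof (rule lifts_T_ext[OF vr(3) _ M0, of _ q])
    show "per M q ?v1 \<circ> per M q ?v2 \<in> lifts_T M" using T1 T2 fun_groupD(2)[OF fun_group_lifts_T] by blast
    fix t assume t: "q \<le> t" "t < q + M"
    show "v t = (per M q ?v1 \<circ> per M q ?v2) t"
    proof (cases "t \<le> p")
      case True
      then show ?thesis using t by (simp add: e1 e2)
    next
      case False
      then have "p < v t" "v t \<le> q + M"
        using rhomeo_less[OF vr(2), of p t] rhomeo_le[OF vr(2), of t "q + M"] vp vq t by auto
      then show ?thesis using t False qp by (simp add: e1 e2)
    qed
  qed
  then have "v \<in> G" using fun_groupD(2)[OF G(1) G1 G2] by simp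
  then have "u \<circ> v \<in> G" using u G(1) by (intro fun_groupD)
  moreover have "u \<circ> v = g" using ur by (auto simp: v_def fun_eq_iff)
  ultimately show "g \<in> G" by simp
qed

lemma fun_group_translation:
  assumes "fun_group G" "(\<lambda>t. t + c) \<in> G"
  shows "(\<lambda>t. t + c * of_int k) \<in> G"
proof -
  have n: "(\<lambda>t. t + c * of_nat n) \<in> G" for n
  proof (induction n)
    case 0
    then show ?case using assms(1) by (simp add: fun_group_def id_def)
  next
    case (Suc n)
    have "(\<lambda>t. t + c) \<circ> (\<lambda>t. t + c * of_nat n) \<in> G" using Suc assms by (intro fun_groupD)
    then show ?case by (simp add: comp_def algebra_simps)
  qed
  show ?thesis
  proof (cases "k \<ge> 0")
    case True
    then show ?thesis using n[of "nat k"] by simp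
  next
    case False
    have "inv (\<lambda>t. t + c * of_nat (nat (- k))) \<in> G" using n assms by (intro fun_groupD)
    moreover have "inv (\<lambda>t. t + c * of_nat (nat (- k))) = (\<lambda>t. t + c * of_int k)"
      using False by (intro inv_equality) auto
    ultimately show ?thesis by simp
  qed
qed

text \<open>T is generated by the maps supported in translates by half-integers of one unit interval. By fragmentation the group
  contains all maps supported in an interval of full length \<open>M\<close> with half-integral ends. After a
  translation by a multiple of \<open>M\<close>, the given map sends \<open>3/4\<close> to a point of \<open>(0, M]\<close>; one of the two full intervals
  starting at \<open>0\<close> and \<open>1/2\<close> contains that point together with \<open>3/4\<close>, which allows its germ at \<open>3/4\<close> to be made trivial. What
  remains is supported in \<open>(3/4, 3/4 + M)\<close>. For \<open>M = 1\<close> the statement is used for germs, for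
  \<open>M = 2^9\<close> for the circle.\<close>

lemma lifts_T_generated:
  assumes m: "m \<ge> 1" and M: "M = real m" and G: "fun_group G" "(\<lambda>t. t + M) \<in> G"
    and Tsupp: "\<And>j::int. Tsupp M (of_int j / 2) (of_int j / 2 + 1) \<subseteq> G"
  shows "lifts_T M \<subseteq> G"
proof
  have Md: "M \<in> dyadics" and M1: "M \<ge> 1" using m M by auto
  have long: "1 + real n / 2 \<le> M \<Longrightarrow> Tsupp M (of_int j / 2) (of_int j / 2 + 1 + real n / 2) \<subseteq> G" for j n
  proof (induction n)
    case 0
    then show ?case using Tsupp[of j] by simp
  next
    case (Suc n)
    have "Tsupp M (of_int j / 2) (of_int (j + 1 + int n) / 2 + 1) \<subseteq> G"
    proof (rule Tsupp_split[OF _ _ _ _ Md G(1)])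
      show "Tsupp M (of_int j / 2) (of_int j / 2 + 1 + real n / 2) \<subseteq> G"
        by (rule Suc.IH) (use Suc.prems in \<open>auto simp: field_simps\<close>)
      show "Tsupp M (of_int (j + 1 + int n) / 2) (of_int (j + 1 + int n) / 2 + 1) \<subseteq> G" by (rule Tsupp)
    qed (use Suc in \<open>auto simp: field_simps\<close>)
    moreover have "of_int (j + 1 + int n) / 2 + 1 = (of_int j / 2 + 1 + real (Suc n) / 2 :: real)"
      by (simp add: field_simps)
    ultimately show ?case by (simp only:)
  qed
  have full: "Tsupp M (of_int j / 2) (of_int j / 2 + M) \<subseteq> G" for j
  proof -
    have "real (2 * (m - 1)) = 2 * M - 2" using m M by (simp add: of_nat_diff)
    then have "1 + real (2 * (m - 1)) / 2 = M" by (simp add: field_simps)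
    then show ?thesis using long[of "2 * (m - 1)" j] by (simp only: add.assoc)
  qed
  fix g assume g: "g \<in> lifts_T M"
  have add: "(\<lambda>t. t + M * of_int k) \<in> G" for k :: int
    by (rule fun_group_translation[OF G])
  obtain k where k: "0 + M * of_int k < g (3/4)" "g (3/4) \<le> 0 + M * (of_int k + 1)"
    by (rule floor_period'[of M 0 "g (3/4)"]) (use M1 in auto)
  define h where "h = (\<lambda>t. t + M * of_int (- k)) \<circ> g"
  have "(\<lambda>t. t + M * of_int (- k)) \<in> plh" using Md by (intro plh_add dyadics_mult) auto
  then have h: "h \<in> lifts_T M" using g unfolding h_def lifts_T_def by auto
  have hp: "h \<in> plh" by (rule lifts_T_plh[OF h])
  have h34: "0 < h (3/4)" "h (3/4) \<le> M" using k by (auto simp: h_def algebra_simps)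
  have "\<exists>u e. u \<in> G \<and> u \<in> lifts_T M \<and> e > 0 \<and> (\<forall>t. \<bar>t - 3/4\<bar> \<le> e \<longrightarrow> u t = h t)"
  proof (cases "h (3/4) < M")
    case True
    obtain u e where "u \<in> Tsupp M 0 (0 + M)" "e > 0" "\<And>t. \<bar>t - 3/4\<bar> \<le> e \<Longrightarrow> u t = h t"
      using Tsupp_match[OF plh_rhomeo[OF hp] plh_reg[OF hp], of 0 "3/4" "0 + M" M] True h34 M1 Md by auto
    then show ?thesis using full[of 0] Tsupp_lifts_T by (intro exI[of _ u] exI[of _ e]) auto
  next
    case False
    obtain u e where "u \<in> Tsupp M (1/2) (1/2 + M)" "e > 0" "\<And>t. \<bar>t - 3/4\<bar> \<le> e \<Longrightarrow> u t = h t"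
      using Tsupp_match[OF plh_rhomeo[OF hp] plh_reg[OF hp], of "1/2" "3/4" "1/2 + M" M] False h34 M1 Md by auto
    then show ?thesis using full[of 1] Tsupp_lifts_T by (intro exI[of _ u] exI[of _ e]) auto
  qed
  then obtain u e where u: "u \<in> G" "u \<in> lifts_T M" "e > 0" "\<And>t. \<bar>t - 3/4\<bar> \<le> e \<Longrightarrow> u t = h t" by blast
  have ur: "u \<in> rhomeo" using lifts_T_plh[OF u(2)] by simp
  define v where "v = inv u \<circ> h"
  have vT: "v \<in> lifts_T M" unfolding v_def using h u fun_group_lifts_T by (intro fun_groupD)
  have v0: "v t = t" if "\<bar>t - 3/4\<bar> \<le> e" for t using u(4)[OF that] ur by (simp add: v_def rhomeo_inv_eq)
  define d where "d = min e (1/4)"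
  have d: "d > 0" "d \<le> e" "d \<le> 1/4" using u by (auto simp: d_def)
  have "v t = t" if "3/4 + M - d \<le> t" "t \<le> 3/4 + d + M" for t
    using v0[of "t - M"] lifts_T_add[OF vT, of "t - M"] that d by auto
  note v_id = this
  have "v \<in> Tsupp M (3/4) (3/4 + M)"
    by (rule TsuppI[OF vT _ _ _ v_id, where a' = "3/4 + d" and b' = "3/4 + M - d"]) (use d M1 in auto)
  moreover have "Tsupp M (3/4) (3/4 + M) \<subseteq> G"
  proof (rule Tsupp_split[OF _ _ _ _ Md G(1)])
    show "Tsupp M (3/4) (1/2 + M) \<subseteq> G" using full[of 1] Tsupp_mono[of "1/2" "3/4" "1/2 + M" "1/2 + M" M] by auto
    show "Tsupp M M (3/4 + M) \<subseteq> G"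
      using Tsupp[of "2 * int m"] Tsupp_mono[of M M "3/4 + M" "M + 1" M] M by auto
  qed (use M1 in auto)
  ultimately have "v \<in> G" by auto
  then have "(\<lambda>t. t + M * of_int k) \<circ> (u \<circ> v) \<in> G" using add u G by (intro fun_groupD) auto
  moreover have "(\<lambda>t. t + M * of_int k) \<circ> (u \<circ> v) = g" using ur by (auto simp: v_def h_def fun_eq_iff)
  ultimately show "g \<in> G" by simp
qed

section \<open>Compactly supported maps as quotients of positive words\<close>

text \<open>A regular map is affine on all sufficiently fine standard dyadic intervals. Compactness reduces this to
  a neighbourhood of one point \<open>x\<close>. If \<open>x\<close> is dyadic, fine standard intervals do not
  straddle it, so that one-sided affinity suffices.\<close>

lemma reg_uniform:
  assumes reg: "\<And>x. a \<le> x \<Longrightarrow> x \<le> b \<Longrightarrow> reg f x" and ab: "a \<le> b"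
  shows "\<exists>K0::nat. \<forall>K\<ge>K0. \<forall>i::int. a \<le> of_int i / 2 ^ K \<and> of_int i / 2 ^ K < b \<longrightarrow>
    daff {of_int i / 2 ^ K..(of_int i + 1) / 2 ^ K} f"
  using ab
proof (induction rule: Bolzano)
  case (trans a b c)
  then obtain K1 K2 :: nat where K1: "\<And>K i. K \<ge> K1 \<Longrightarrow> a \<le> of_int i / 2 ^ K \<Longrightarrow> of_int i / 2 ^ K < b \<Longrightarrow> daff {of_int i / 2 ^ K..(of_int i + 1) / 2 ^ K} f"
    and K2: "\<And>K i. K \<ge> K2 \<Longrightarrow> b \<le> of_int i / 2 ^ K \<Longrightarrow> of_int i / 2 ^ K < c \<Longrightarrow> daff {of_int i / 2 ^ K..(of_int i + 1) / 2 ^ K} f"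
    by blast
  show ?case
  proof (intro exI[of _ "max K1 K2"] allI impI)
    fix K i assume "max K1 K2 \<le> K" "a \<le> of_int i / 2 ^ K \<and> of_int i / 2 ^ K < c"
    then show "daff {of_int i / 2 ^ K..(of_int i + 1) / 2 ^ K} f"
      using K1[of K i] K2[of K i] by (cases "of_int i / 2 ^ K < b") auto
  qed
next
  case (local x)
  obtain e where e: "e > 0" "daff {x - e..x} f" "daff {x..x + e} f"
    "x \<in> dyadics \<or> daff {x - e..x + e} f" using reg[OF local] by (auto simp: reg_def)
  obtain K1 :: nat where K1: "x \<in> dyadics \<Longrightarrow> x * 2 ^ K1 \<in> \<int>" using dyadics_iff[of x] by metis
  obtain K2 :: nat where K2: "2 / e < 2 ^ K2" using real_arch_pow[of 2 "2 / e"] by auto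
  show ?case
  proof (rule exI[of _ "e / 2"], safe)
    fix a b assume ab: "a \<le> x" "x \<le> b" "b - a < e / 2"
    show "\<exists>K0::nat. \<forall>K\<ge>K0. \<forall>i::int. a \<le> of_int i / 2 ^ K \<and> of_int i / 2 ^ K < b \<longrightarrow>
      daff {of_int i / 2 ^ K..(of_int i + 1) / 2 ^ K} f"
    proof (rule exI[of _ "max K1 K2"], safe)
      fix K i assume K: "max K1 K2 \<le> K" and i: "a \<le> of_int i / 2 ^ K" "of_int i / 2 ^ K < b"
      let ?u = "of_int i / (2::real) ^ K" and ?v = "(of_int i + 1) / (2::real) ^ K"
      have "(2::real) ^ K2 \<le> 2 ^ K" using K by (intro power_increasing) auto
      then have "2 / e < 2 ^ K" using K2 by linarith
      then have "1 / 2 ^ K < e / 2" using e(1) by (simp add: field_simps)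
      then have v: "?v < ?u + e / 2" "?u < ?v" by (auto simp: add_divide_distrib)
      then have uv: "x - e \<le> ?u" "?v \<le> x + e" using i ab by auto
      show "daff {?u..?v} f"
      proof (cases "x \<in> dyadics")
        case False
        then have "daff {x - e..x + e} f" using e by auto
        then show ?thesis by (rule daff_Icc_mono) (use uv in auto)
      next
        case True
        have "x * 2 ^ K = x * 2 ^ K1 * 2 ^ (K - K1)" using K by (simp add: power_add[symmetric])
        then have "x * 2 ^ K \<in> \<int>" using K1[OF True] by (metis Ints_mult Ints_numeral Ints_power)
        then obtain j where "x * 2 ^ K = of_int j" by (auto elim: Ints_cases)
        then have j: "x = of_int j / 2 ^ K" by (simp add: field_simps)
        show ?thesis
        proof (cases "j \<le> i")
          case True
          then have "x \<le> ?u" unfolding j by (intro divide_right_mono) auto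
          then show ?thesis by (intro daff_Icc_mono[OF e(3)] uv)
        next
          case False
          then have "i + 1 \<le> j" by simp
          then have "of_int i + 1 \<le> (of_int j :: real)" by linarith
          then have "?v \<le> x" unfolding j by (intro divide_right_mono) auto
          then show ?thesis by (intro daff_Icc_mono[OF e(2)] uv)
        qed
      qed
    qed
  qed (use e in auto)
qed

definition tau :: "real \<Rightarrow> real" where "tau t = t + 1"

text \<open>Up to the choice of coordinates, \<open>tau\<close> and this map are the standard generators of Thompson's group F.\<close>

definition stretch :: "real \<Rightarrow> real"
  where "stretch t = (if t \<le> 0 then t else if t \<le> 1 then 2 * t else t + 1)"

definition stretch_at :: "int \<Rightarrow> real \<Rightarrow> real"
  where "stretch_at k t = stretch (t - of_int k) + of_int k"

lemma tau_plh [simp]: "tau \<in> plh"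
  using plh_add[of 1] unfolding tau_def[abs_def] by simp

lemma inv_tau: "inv tau = (\<lambda>t. t - 1)"
  by (rule inv_equality) (auto simp: tau_def)

lemma stretch_plh [simp]: "stretch \<in> plh"
proof -
  have 2: "(\<lambda>t. 2 * t) \<in> plh" using plh_affine[of 0 1] by simp
  have "stretch = glue 0 id (glue 1 (\<lambda>t. 2 * t) (\<lambda>t. t + 1))" by (auto simp: stretch_def glue_def)
  also have "\<dots> \<in> plh" using 2 by (intro glue_plh) auto
  finally show ?thesis .
qed

lemma stretch_at_comp: "stretch_at k = (\<lambda>t. t + of_int k) \<circ> stretch \<circ> (\<lambda>t. t + of_int (- k))"
  by (auto simp: stretch_at_def)

lemma stretch_at_plh [simp]: "stretch_at k \<in> plh"
  unfolding stretch_at_comp by (intro plh_comp plh_add stretch_plh) auto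

lemma inv_stretch_at: "inv (stretch_at k) t = (if t \<le> of_int k then t else if t \<le> of_int k + 2 then (t + of_int k) / 2 else t - 1)"
  by (subst rhomeo_inv_eq) (auto simp: stretch_at_def stretch_def divide_simps)

text \<open>Products of \<open>n\<close> translates of \<open>stretch\<close>; the length \<open>n\<close> is the displacement near plus infinity.\<close>

inductive stretch_word :: "nat \<Rightarrow> (real \<Rightarrow> real) \<Rightarrow> bool" where
  stretch_word_0: "stretch_word 0 id"
| stretch_word_Suc: "stretch_word n x \<Longrightarrow> stretch_word (Suc n) (x \<circ> stretch_at k)"

lemma stretch_word_plh: "stretch_word n x \<Longrightarrow> x \<in> plh"
  by (induction rule: stretch_word.induct) (auto intro!: plh_comp stretch_at_plh simp del: o_apply)

lemma stretch_word_comp: "stretch_word m y \<Longrightarrow> stretch_word n x \<Longrightarrow> stretch_word (n + m) (x \<circ> y)"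
proof (induction rule: stretch_word.induct)
  case (stretch_word_Suc m y k)
  then have "stretch_word (Suc (n + m)) ((x \<circ> y) \<circ> stretch_at k)" by (intro stretch_word.stretch_word_Suc)
  then show ?case by (simp only: comp_assoc add_Suc_right)
qed simp

lemma stretch_word_displacement: "stretch_word n x \<Longrightarrow> \<exists>C. \<forall>t\<ge>C. x t = t + of_nat n"
proof (induction rule: stretch_word.induct)
  case (stretch_word_Suc n x k)
  then obtain C where C: "\<forall>t\<ge>C. x t = t + of_nat n" by auto
  have "(x \<circ> stretch_at k) t = t + of_nat (Suc n)" if "t \<ge> max C (of_int k + 1)" for t
  proof (cases "t = of_int k + 1")
    case True
    then show ?thesis using that C by (auto simp: stretch_at_def stretch_def)
  next
    case False
    then show ?thesis using that C by (auto simp: stretch_at_def stretch_def)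
  qed
  then show ?case by blast
qed auto

text \<open>On each interval between consecutive natural numbers the slope is a power of two that is at least one. The values at
  natural numbers are then natural numbers as well.\<close>

definition expanding :: "nat \<Rightarrow> (real \<Rightarrow> real) \<Rightarrow> bool"
  where "expanding m w \<longleftrightarrow> (\<forall>t\<le>0. w t = t) \<and>
    (\<forall>i::nat. \<exists>k::nat. \<forall>t\<in>{of_nat i..of_nat i + 1}. w t = w (of_nat i) + 2 ^ k * (t - of_nat i)) \<and>
    (\<forall>t\<ge>of_nat m. w t = w (of_nat m) + (t - of_nat m))"

lemma expanding_le: "expanding m w \<Longrightarrow> t \<le> 0 \<Longrightarrow> w t = t"
  and expanding_gt: "expanding m w \<Longrightarrow> real m \<le> t \<Longrightarrow> w t = w (real m) + (t - real m)"
  unfolding expanding_def by blast+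

lemma expandingE:
  assumes "expanding m w"
  obtains k :: nat where "\<forall>t. real i \<le> t \<longrightarrow> t \<le> real i + 1 \<longrightarrow> w t = w (real i) + 2 ^ k * (t - real i)"
proof -
  have "\<forall>i::nat. \<exists>k::nat. \<forall>t\<in>{real i..real i + 1}. w t = w (real i) + 2 ^ k * (t - real i)"
    using assms unfolding expanding_def by (elim conjE)
  then obtain k :: nat where "\<forall>t\<in>{real i..real i + 1}. w t = w (real i) + 2 ^ k * (t - real i)"
    by (elim allE[of _ i] exE)
  then show ?thesis unfolding Ball_def atLeastAtMost_iff by (intro that[of k]) iprover
qed

lemma expanding_ge: "expanding m w \<Longrightarrow> of_nat i \<le> w (of_nat i)"
proof (induction i)
  case 0
  then show ?case using expanding_le[of m w 0] by simp
next
  case (Suc i)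
  obtain k :: nat where k: "\<forall>t. real i \<le> t \<longrightarrow> t \<le> real i + 1 \<longrightarrow> w t = w (real i) + 2 ^ k * (t - real i)"
    by (rule expandingE[OF Suc.prems])
  have "w (of_nat i + 1) = w (of_nat i) + 2 ^ k * ((of_nat i + 1) - of_nat i)" by (rule k[rule_format]) auto
  moreover have "(1::real) \<le> 2 ^ k" by simp
  moreover have "real i \<le> w (real i)" using Suc by simp
  ultimately show ?case unfolding of_nat_Suc by (simp only: add.commute[of 1] add_diff_cancel_left' mult_1_right)
qed

lemma expanding_trivial:
  assumes "expanding m w" "\<And>i t. real i \<le> t \<Longrightarrow> t \<le> real i + 1 \<Longrightarrow> w t = w (real i) + (t - real i)"
  shows "w = id"
proof
  fix t
  have n: "w (real n) = real n" for n
  proof (induction n)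
    case 0
    then show ?case using expanding_le[OF assms(1), of 0] by simp
  next
    case (Suc n)
    then show ?case using assms(2)[of n "real n + 1"] by (simp add: algebra_simps)
  qed
  show "w t = id t"
  proof (cases "t \<le> 0")
    case True
    then show ?thesis using expanding_le[OF assms(1)] by simp
  next
    case False
    then show ?thesis using assms(2)[of "nat \<lfloor>t\<rfloor>" t] n[of "nat \<lfloor>t\<rfloor>"]
      by (simp add: of_nat_nat)
  qed
qed

text \<open>Splitting off a stretch at an interval of slope \<open>2^k\<close>, \<open>k > 0\<close>, replaces that interval by two intervals of slope
  \<open>2^(k - 1)\<close>. The total displacement drops by one.\<close>

lemma expanding_step:
  assumes w: "expanding m w" and ik: "k \<ge> 1" "\<And>t. real i \<le> t \<Longrightarrow> t \<le> real i + 1 \<Longrightarrow> w t = w (real i) + 2 ^ k * (t - real i)"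
  shows "expanding (Suc m) (w \<circ> inv (stretch_at (int i)))"
    and "(w \<circ> inv (stretch_at (int i))) (real (Suc m)) = w (real m)"
proof -
  let ?v = "w \<circ> inv (stretch_at (int i))"
  have im: "i < m"
  proof (rule ccontr)
    assume "\<not> i < m"
    then have "w (real i + 1) = w (real m) + (real i + 1 - real m)" "w (real i) = w (real m) + (real i - real m)"
      using expanding_gt[OF w, of "real i + 1"] expanding_gt[OF w, of "real i"] by auto
    then have "2 ^ k = (1::real)" using ik(2)[of "real i + 1"] by simp
    moreover have "(2::real) ^ 1 \<le> 2 ^ k" using ik(1) by (intro power_increasing) auto
    ultimately show False by simp
  qed
  have v1: "?v t = w t" if "t \<le> real i" for t using that by (simp add: inv_stretch_at)
  have v2: "?v t = w (real i) + 2 ^ (k - 1) * (t - real i)" if "real i \<le> t" "t \<le> real i + 2" for t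
  proof -
    have "?v t = w ((t + real i) / 2)" using that by (auto simp: inv_stretch_at)
    also have "\<dots> = w (real i) + 2 ^ k * ((t + real i) / 2 - real i)" using that by (intro ik) auto
    also have "\<dots> = w (real i) + 2 ^ (k - 1) * (t - real i)"
      using ik(1) by (cases k) (auto simp: field_simps)
    finally show ?thesis .
  qed
  have v3: "?v t = w (t - 1)" if "t \<ge> real i + 2" for t
  proof (cases "t = real i + 2")
    case True
    then have "(t + real i) / 2 = t - 1" by (simp add: field_simps)
    moreover have "?v t = w ((t + real i) / 2)" using True by (simp add: inv_stretch_at)
    ultimately show ?thesis by (simp only:)
  qed (use that in \<open>auto simp: inv_stretch_at\<close>)
  show "?v (real (Suc m)) = w (real m)"
    using v3[of "real (Suc m)"] im by (cases "i + 1 \<le> m") auto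
  show "expanding (Suc m) ?v"
    unfolding expanding_def
  proof (intro conjI allI impI)
    fix t :: real assume "t \<le> 0"
    then show "?v t = t" using v1[of t] expanding_le[OF w] by simp
  next
    fix t assume "real (Suc m) \<le> t"
    then show "?v t = ?v (real (Suc m)) + (t - real (Suc m))"
      using v3[of t] \<open>?v (real (Suc m)) = w (real m)\<close> expanding_gt[OF w, of "t - 1"] im by auto
  next
    fix j :: nat
    consider "j < i" | "j = i" | "j = i + 1" | "j \<ge> i + 2" by linarith
    then show "\<exists>l::nat. \<forall>t\<in>{real j..real j + 1}. ?v t = ?v (real j) + 2 ^ l * (t - real j)"
    proof cases
      case 1
      obtain l :: nat where l: "\<forall>t. real j \<le> t \<longrightarrow> t \<le> real j + 1 \<longrightarrow> w t = w (real j) + 2 ^ l * (t - real j)"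
        by (rule expandingE[OF w])
      show ?thesis
      proof (intro exI[of _ l] ballI)
        fix t assume "t \<in> {real j..real j + 1}"
        then show "?v t = ?v (real j) + 2 ^ l * (t - real j)"
          using 1 v1[of t] v1[of "real j"] l[rule_format, of t] by auto
      qed
    next
      case 2
      then show ?thesis using v2 by (intro exI[of _ "k - 1"]) auto
    next
      case 3
      show ?thesis
      proof (intro exI[of _ "k - 1"] ballI)
        fix t assume "t \<in> {real j..real j + 1}"
        then show "?v t = ?v (real j) + 2 ^ (k - 1) * (t - real j)"
          using 3 v2[of t] v2[of "real j"] by (simp add: algebra_simps del: o_apply)
      qed
    next
      case 4
      have j1: "real (j - 1) = real j - 1" using 4 by (simp add: of_nat_diff)
      obtain l :: nat where l0: "\<forall>t. real (j - 1) \<le> t \<longrightarrow> t \<le> real (j - 1) + 1 \<longrightarrow> w t = w (real (j - 1)) + 2 ^ l * (t - real (j - 1))"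
        by (rule expandingE[OF w])
      have l: "w t = w (real j - 1) + 2 ^ l * (t - (real j - 1))" if "real j - 1 \<le> t" "t \<le> real j" for t
        using l0[rule_format, of t] that by (simp only: j1)
      show ?thesis
      proof (intro exI[of _ l] ballI)
        fix t assume "t \<in> {real j..real j + 1}"
        then show "?v t = ?v (real j) + 2 ^ l * (t - real j)"
          using 4 v3[of t] v3[of "real j"] l[of "t - 1"] by auto
      qed
    qed
  qed
qed

lemma expanding_cases:
  assumes "expanding m w"
  obtains "w = id" | i where "expanding (Suc m) (w \<circ> inv (stretch_at (int i)))" "(w \<circ> inv (stretch_at (int i))) (real (Suc m)) = w (real m)"
proof (cases "\<exists>i k::nat. k \<ge> 1 \<and> (\<forall>t. real i \<le> t \<longrightarrow> t \<le> real i + 1 \<longrightarrow> w t = w (real i) + 2 ^ k * (t - real i))")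
  case True
  then obtain i k :: nat where "k \<ge> 1" "\<And>t. real i \<le> t \<Longrightarrow> t \<le> real i + 1 \<Longrightarrow> w t = w (real i) + 2 ^ k * (t - real i)" by blast
  from expanding_step[OF assms this] show ?thesis by (rule that(2))
next
  case False
  have "w = id"
  proof (rule expanding_trivial[OF assms])
    fix i t assume t: "real i \<le> t" "t \<le> real i + 1"
    obtain k :: nat where k: "\<forall>t. real i \<le> t \<longrightarrow> t \<le> real i + 1 \<longrightarrow> w t = w (real i) + 2 ^ k * (t - real i)"
      by (rule expandingE[OF assms])
    have "\<not> k \<ge> 1"
    proof
      assume "k \<ge> 1"
      then have "k \<ge> 1 \<and> (\<forall>t. real i \<le> t \<longrightarrow> t \<le> real i + 1 \<longrightarrow> w t = w (real i) + 2 ^ k * (t - real i))"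
        using k by (rule conjI)
      from notE[OF False, OF exI, OF exI, OF this] show False .
    qed
    then show "w t = w (real i) + (t - real i)" using k[rule_format, OF t] by (simp add: not_le)
  qed
  then show ?thesis by (rule that(1))
qed

lemma expanding_stretch_word_aux: "expanding m w \<Longrightarrow> w (real m) - real m \<le> real c \<Longrightarrow> \<exists>n. stretch_word n w"
proof (induction c arbitrary: m w)
  case 0
  show ?case
  proof (rule expanding_cases[OF 0(1)])
    assume "w = id"
    then show ?thesis using stretch_word_0 by blast
  next
    fix i assume s: "expanding (Suc m) (w \<circ> inv (stretch_at (int i)))" "(w \<circ> inv (stretch_at (int i))) (real (Suc m)) = w (real m)"
    have "real (Suc m) \<le> w (real m)" using expanding_ge[OF s(1), of "Suc m"] s(2) by simp
    then show ?thesis using 0 by simp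
  qed
next
  case (Suc c)
  show ?case
  proof (rule expanding_cases[OF Suc.prems(1)])
    assume "w = id"
    then show ?thesis using stretch_word_0 by blast
  next
    fix i assume s: "expanding (Suc m) (w \<circ> inv (stretch_at (int i)))" "(w \<circ> inv (stretch_at (int i))) (real (Suc m)) = w (real m)"
    have "\<exists>n. stretch_word n (w \<circ> inv (stretch_at (int i)))"
      by (rule Suc.IH[OF s(1)]) (use s(2) Suc.prems(2) in auto)
    then obtain n where "stretch_word n (w \<circ> inv (stretch_at (int i)))" ..
    then have "stretch_word (Suc n) (w \<circ> inv (stretch_at (int i)) \<circ> stretch_at (int i))" by (rule stretch_word_Suc)
    moreover have "w \<circ> inv (stretch_at (int i)) \<circ> stretch_at (int i) = w" by (auto simp: fun_eq_iff)
    ultimately show ?thesis by metis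
  qed
qed

text \<open>Induction on the displacement: as long as some slope exceeds one, a stretch can be split off, and
  without displacement the map is the identity.\<close>

lemma expanding_stretch_word: "expanding m w \<Longrightarrow> \<exists>n. stretch_word n w"
  using expanding_stretch_word_aux[of m w "nat \<lceil>w (real m) - real m\<rceil>"] by (meson of_nat_ceiling)

text \<open>Multiplication by \<open>2^K\<close> on \<open>[0, m]\<close>, continued by the identity and a translation.\<close>

definition dilate :: "nat \<Rightarrow> nat \<Rightarrow> real \<Rightarrow> real"
  where "dilate K m t = (if t \<le> 0 then t else if t \<le> real m then 2 ^ K * t else t + (2 ^ K - 1) * real m)"

lemma dilate_expanding: "expanding m (dilate K m)"
  unfolding expanding_def
proof (intro conjI allI impI)
  fix i :: nat
  show "\<exists>k::nat. \<forall>t\<in>{real i..real i + 1}. dilate K m t = dilate K m (real i) + 2 ^ k * (t - real i)"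
  proof (cases "i < m")
    case True
    then have "real i + 1 \<le> real m" by linarith
    then show ?thesis by (intro exI[of _ K]) (auto simp: dilate_def algebra_simps)
  next
    case False
    then show ?thesis by (intro exI[of _ 0]) (auto simp: dilate_def algebra_simps)
  qed
qed (auto simp: dilate_def algebra_simps)

text \<open>For large \<open>K\<close> the map is affine on the standard intervals of length \<open>2^(-K)\<close>. After dilating the source by
  \<open>2^K\<close> and the target by a power \<open>2^J\<close> that makes all slopes at least one, it becomes an expanding map \<open>w\<close>,
  so \<open>dilate J m \<circ> g = w \<circ> dilate K m\<close> with a word on either side. The two words have the same length because \<open>g\<close>
  does not move points near plus infinity.\<close>

lemma compactly_supported_quotient:
  assumes g: "g \<in> plh" and supp: "\<And>t. t \<le> 0 \<or> t \<ge> real m \<Longrightarrow> g t = t"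
  obtains n x y where "stretch_word n x" "stretch_word n y" "y \<circ> g = x"
proof -
  obtain K where K: "\<And>i::int. 0 \<le> i \<Longrightarrow> of_int i / 2 ^ K < real m \<Longrightarrow> daff {of_int i / 2 ^ K..(of_int i + 1) / 2 ^ K} g"
    using reg_uniform[of 0 "real m" g] g by (auto simp: zero_le_divide_iff)
  have "\<exists>s::int. i < 2 ^ K * m \<longrightarrow> (\<exists>b. \<forall>t\<in>{real i / 2 ^ K..(real i + 1) / 2 ^ K}. g t = 2 powi s * t + b)" for i :: nat
  proof (cases "i < 2 ^ K * m")
    case True
    then have "real i < real (2 ^ K * m)" by (simp only: of_nat_less_iff)
    then have "real i / 2 ^ K < real m" by (simp add: field_simps)
    then show ?thesis using K[of "int i"] by (auto simp: daff_def)
  qed auto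
  then obtain s :: "nat \<Rightarrow> int" where s:
    "\<And>i. i < 2 ^ K * m \<Longrightarrow> \<exists>b. \<forall>t\<in>{real i / 2 ^ K..(real i + 1) / 2 ^ K}. g t = 2 powi s i * t + b" by metis
  define J :: nat where "J = K + (\<Sum>i<2 ^ K * m. nat (- s i))"
  have J: "int J + s i - int K \<ge> 0" if "i < 2 ^ K * m" for i
  proof -
    have "nat (- s i) \<le> (\<Sum>i<2 ^ K * m. nat (- s i))" using that by (intro member_le_sum) auto
    then show ?thesis unfolding J_def by linarith
  qed
  obtain a b where ab: "stretch_word a (dilate J m)" "stretch_word b (dilate K m)" using expanding_stretch_word[OF dilate_expanding] by metis
  have dr: "dilate J m \<in> rhomeo" "dilate K m \<in> rhomeo" using stretch_word_plh[OF ab(1)] stretch_word_plh[OF ab(2)] by auto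
  have g0: "0 \<le> g t" "g t \<le> real m" if "0 \<le> t" "t \<le> real m" for t
    using rhomeo_le[OF plh_rhomeo[OF g], of 0 t] rhomeo_le[OF plh_rhomeo[OF g], of t "real m"] supp that by auto
  define w where "w = dilate J m \<circ> g \<circ> inv (dilate K m)"
  have ik: "inv (dilate K m) t = (if t \<le> 0 then t else if t \<le> 2 ^ K * real m then t / 2 ^ K else t - (2 ^ K - 1) * real m)" for t
    by (subst rhomeo_inv_eq[OF dr(2)]) (auto simp: dilate_def field_simps)
  have w1: "w t = t" if "t \<le> 0" for t using that supp by (simp add: w_def ik dilate_def)
  have w2: "w t = 2 ^ J * g (t / 2 ^ K)" if "0 \<le> t" "t \<le> 2 ^ K * real m" for t
    using that g0[of "t / 2 ^ K"] supp[of 0] by (auto simp: w_def ik dilate_def field_simps)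
  have w3: "w t = t - (2 ^ K - 1) * real m + (2 ^ J - 1) * real m" if "t \<ge> 2 ^ K * real m" for t
  proof (cases "t = 2 ^ K * real m")
    case True
    then show ?thesis using w2[of t] supp[of "real m"] by (simp add: algebra_simps)
  next
    case False
    have "(2 ^ K - 1) * real m \<ge> 0" by simp
    then have *: "t > 0" "t - (2 ^ K - 1) * real m > real m" using that False by (auto simp: algebra_simps)
    then have "w t = dilate J m (g (t - (2 ^ K - 1) * real m))" using that False by (simp add: w_def ik)
    also have "g (t - (2 ^ K - 1) * real m) = t - (2 ^ K - 1) * real m" using * by (intro supp) auto
    also have "dilate J m \<dots> = \<dots> + (2 ^ J - 1) * real m"
      using * of_nat_0_le_iff[of m] unfolding dilate_def by auto
    finally show ?thesis .
  qed
  have "expanding (2 ^ K * m) w"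
    unfolding expanding_def
  proof (intro conjI allI impI)
    fix i :: nat
    show "\<exists>k::nat. \<forall>t\<in>{real i..real i + 1}. w t = w (real i) + 2 ^ k * (t - real i)"
    proof (cases "i < 2 ^ K * m")
      case True
      then have "real i + 1 \<le> real (2 ^ K * m)" by linarith
      then have im: "real i + 1 \<le> 2 ^ K * real m" by simp
      obtain b where b: "\<forall>t\<in>{real i / 2 ^ K..(real i + 1) / 2 ^ K}. g t = 2 powi s i * t + b" using s[OF True] by auto
      obtain k :: nat where "int k = int J + s i - int K" using J[OF True] zero_le_imp_eq_int by metis
      then have "(2::real) powi int k = 2 powi int J * 2 powi s i * 2 powi (- int K)"
        by (simp only: powi_add2[symmetric]) simp
      then have k: "(2::real) ^ k = 2 ^ J * 2 powi s i / 2 ^ K" by (simp add: power_int_minus divide_simps)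
      show ?thesis
      proof (intro exI[of _ k] ballI)
        fix t assume t: "t \<in> {real i..real i + 1}"
        have "g (t / 2 ^ K) = 2 powi s i * (t / 2 ^ K) + b" "g (real i / 2 ^ K) = 2 powi s i * (real i / 2 ^ K) + b"
          using b t by (auto simp: divide_right_mono)
        then show "w t = w (real i) + 2 ^ k * (t - real i)"
          using t im w2[of t] w2[of "real i"] unfolding k by (simp add: diff_divide_distrib algebra_simps)
      qed
    next
      case False
      then have "real (2 ^ K * m) \<le> real i" by (simp only: of_nat_le_iff not_less)
      then show ?thesis using w3 by (intro exI[of _ 0]) auto
    qed
  qed (use w1 w3 in auto)
  then obtain n where n: "stretch_word n w" using expanding_stretch_word by blast
  have eq: "dilate J m \<circ> g = w \<circ> dilate K m" unfolding w_def using dr by (auto simp: fun_eq_iff)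
  have x: "stretch_word (n + b) (w \<circ> dilate K m)" using stretch_word_comp[OF ab(2) n] .
  obtain C1 C2 where C: "\<forall>t\<ge>C1. dilate J m t = t + of_nat a" "\<forall>t\<ge>C2. (w \<circ> dilate K m) t = t + of_nat (n + b)"
    using stretch_word_displacement[OF ab(1)] stretch_word_displacement[OF x] by auto
  define t where "t = max (real m) (max C1 C2)"
  have "dilate J m (g t) = t + of_nat a" using C(1) supp[of t] by (simp add: t_def)
  moreover have "(w \<circ> dilate K m) t = t + of_nat (n + b)" using C(2) by (simp add: t_def del: comp_apply)
  ultimately have "a = n + b" using fun_cong[OF eq, of t] by simp
  then show ?thesis using that[OF x _ eq] ab by simp
qed

section \<open>Commutators generate the compactly supported maps\<close>

text \<open>Modulo \<open>N\<close> the element \<open>stretch\<close> commutes with \<open>tau\<close>, so all its translates agree, and any two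
  words of the same length agree. The previous lemma finishes the proof, after a translation
  that moves the support to the right of \<open>0\<close>.\<close>

lemma normal_contains_compactly_supported:
  assumes N: "fun_group N" "N \<subseteq> rhomeo"
    and nt: "\<And>n. n \<in> N \<Longrightarrow> tau \<circ> n \<circ> inv tau \<in> N" "\<And>n. n \<in> N \<Longrightarrow> inv tau \<circ> n \<circ> tau \<in> N"
    and nl: "\<And>n. n \<in> N \<Longrightarrow> stretch \<circ> n \<circ> inv stretch \<in> N" "\<And>n. n \<in> N \<Longrightarrow> inv stretch \<circ> n \<circ> stretch \<in> N"
    and comm: "tau \<circ> stretch \<circ> inv tau \<circ> inv stretch \<in> N"
    and g: "g \<in> plh" "\<And>t. \<bar>t\<bar> \<ge> c \<Longrightarrow> g t = t"
  shows "g \<in> N"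
proof -
  define tr where "tr k = (\<lambda>t::real. t + of_int k)" for k :: int
  have tr: "(tr k \<circ> n \<circ> tr (- k) \<in> N)" if "n \<in> N" for k n
  proof -
    have *: "tr (int j) \<circ> n \<circ> tr (- int j) \<in> N \<and> tr (- int j) \<circ> n \<circ> tr (int j) \<in> N" for j
    proof (induction j)
      case 0
      then show ?case using that by (simp add: tr_def comp_def)
    next
      case (Suc j)
      have "tau \<circ> (tr (int j) \<circ> n \<circ> tr (- int j)) \<circ> inv tau = tr (int (Suc j)) \<circ> n \<circ> tr (- int (Suc j))"
        "inv tau \<circ> (tr (- int j) \<circ> n \<circ> tr (int j)) \<circ> tau = tr (- int (Suc j)) \<circ> n \<circ> tr (int (Suc j))"
        unfolding inv_tau by (auto simp: tr_def fun_eq_iff tau_def algebra_simps)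
      then show ?case using nt Suc by metis
    qed
    show ?thesis using *[of "nat \<bar>k\<bar>"] by (cases "k \<ge> 0") auto
  qed
  have stretch_at_tr: "stretch_at k = tr k \<circ> stretch \<circ> tr (- k)" for k by (simp add: tr_def stretch_at_comp)
  have inv_stretch_at_tr: "inv (stretch_at k) = tr k \<circ> inv stretch \<circ> tr (- k)" for k
    by (rule inv_equality) (auto simp: stretch_at_def tr_def)
  have nk: "stretch_at k \<circ> n \<circ> inv (stretch_at k) \<in> N" if "n \<in> N" for k n
  proof -
    have "tr k \<circ> (stretch \<circ> (tr (- k) \<circ> n \<circ> tr (- (- k))) \<circ> inv stretch) \<circ> tr (- k) \<in> N"
      using that by (intro tr nl)
    then show ?thesis unfolding inv_stretch_at_tr by (simp add: stretch_at_tr comp_assoc)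
  qed
  have nk': "inv (stretch_at k) \<circ> n \<circ> stretch_at k \<in> N" if "n \<in> N" for k n
  proof -
    have "tr k \<circ> (inv stretch \<circ> (tr (- k) \<circ> n \<circ> tr (- (- k))) \<circ> stretch) \<circ> tr (- k) \<in> N"
      using that by (intro tr nl)
    then show ?thesis unfolding inv_stretch_at_tr by (simp add: stretch_at_tr comp_assoc)
  qed
  have nP: "stretch_word n x \<Longrightarrow> h \<in> N \<Longrightarrow> x \<circ> h \<circ> inv x \<in> N" for n x h
  proof (induction arbitrary: h rule: stretch_word.induct)
    case stretch_word_0
    then show ?case by (simp add: inv_id)
  next
    case (stretch_word_Suc n x k)
    have "x \<circ> (stretch_at k \<circ> h \<circ> inv (stretch_at k)) \<circ> inv x \<in> N" by (intro stretch_word_Suc.IH nk stretch_word_Suc.prems)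
    then show ?case
      by (simp only: rhomeo_inv_o[OF plh_rhomeo[OF stretch_word_plh[OF stretch_word_Suc(1)]] plh_rhomeo[OF stretch_at_plh]] comp_assoc)
  qed
  have nP': "stretch_word n x \<Longrightarrow> h \<in> N \<Longrightarrow> inv x \<circ> h \<circ> x \<in> N" for n x h
  proof (induction arbitrary: h rule: stretch_word.induct)
    case stretch_word_0
    then show ?case by (simp add: inv_id)
  next
    case (stretch_word_Suc n x k)
    have "inv (stretch_at k) \<circ> (inv x \<circ> h \<circ> x) \<circ> stretch_at k \<in> N" by (intro stretch_word_Suc.IH nk' stretch_word_Suc.prems)
    then show ?case
      by (simp only: rhomeo_inv_o[OF plh_rhomeo[OF stretch_word_plh[OF stretch_word_Suc(1)]] plh_rhomeo[OF stretch_at_plh]] comp_assoc)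
  qed
  have one: "stretch_at (k + 1) \<circ> inv (stretch_at k) \<in> N" for k
  proof -
    have "tr k \<circ> (tau \<circ> stretch \<circ> inv tau \<circ> inv stretch) \<circ> tr (- k) \<in> N" by (intro tr comm)
    also have "tr k \<circ> (tau \<circ> stretch \<circ> inv tau \<circ> inv stretch) \<circ> tr (- k) = stretch_at (k + 1) \<circ> inv (stretch_at k)"
      unfolding inv_stretch_at_tr inv_tau by (auto simp: fun_eq_iff tr_def stretch_at_def tau_def algebra_simps)
    finally show ?thesis .
  qed
  have up: "stretch_at (k + int j) \<circ> inv (stretch_at k) \<in> N" for k j
  proof (induction j)
    case 0
    have "stretch_at k \<circ> inv (stretch_at k) \<in> N" unfolding rhomeo_inv_comp(2)[OF plh_rhomeo[OF stretch_at_plh]] using N(1) by (rule fun_groupD)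
    then show ?case by (simp only: of_nat_0 add_0_right)
  next
    case (Suc j)
    have "(stretch_at (k + int j + 1) \<circ> inv (stretch_at (k + int j))) \<circ> (stretch_at (k + int j) \<circ> inv (stretch_at k)) \<in> N"
      by (intro fun_groupD[OF N(1)] one Suc)
    moreover have "(stretch_at (k + int j + 1) \<circ> inv (stretch_at (k + int j))) \<circ> (stretch_at (k + int j) \<circ> inv (stretch_at k))
        = stretch_at (k + int (Suc j)) \<circ> inv (stretch_at k)" by (auto simp: fun_eq_iff ac_simps)
    ultimately show ?case by metis
  qed
  have kl: "stretch_at k \<circ> inv (stretch_at l) \<in> N" for k l
  proof (cases "l \<le> k")
    case True
    then show ?thesis using up[of l "nat (k - l)"] by simp
  next
    case False
    then have "stretch_at l \<circ> inv (stretch_at k) \<in> N" using up[of k "nat (l - k)"] by simp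
    then have "inv (stretch_at l \<circ> inv (stretch_at k)) \<in> N" by (rule fun_groupD(3)[OF N(1)])
    then show ?thesis by (simp add: rhomeo_inv_o)
  qed
  have quot: "stretch_word n x \<Longrightarrow> stretch_word n y \<Longrightarrow> x \<circ> inv y \<in> N" for n x y
  proof (induction arbitrary: y rule: stretch_word.induct)
    case stretch_word_0
    then have "y = id" by (cases rule: stretch_word.cases) auto
    then have "id \<circ> inv y = id" by (simp only: inv_id comp_id)
    then show ?case using fun_groupD(1)[OF N(1)] by (simp only:)
  next
    case (stretch_word_Suc n x k)
    obtain y' l where y: "y = y' \<circ> stretch_at l" "stretch_word n y'" using stretch_word_Suc.prems by (cases rule: stretch_word.cases) auto
    have "(x \<circ> (stretch_at k \<circ> inv (stretch_at l)) \<circ> inv x) \<circ> (x \<circ> inv y') \<in> N"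
      by (intro fun_groupD[OF N(1)] nP[OF stretch_word_Suc(1)] kl stretch_word_Suc.IH y)
    moreover have "(x \<circ> (stretch_at k \<circ> inv (stretch_at l)) \<circ> inv x) \<circ> (x \<circ> inv y') = x \<circ> stretch_at k \<circ> inv y"
      using stretch_word_plh[OF stretch_word_Suc(1)] stretch_word_plh[OF y(2)] by (simp add: y rhomeo_inv_o fun_eq_iff)
    ultimately show ?case by metis
  qed
  define d where "d = \<lceil>\<bar>c\<bar>\<rceil>"
  have d: "of_int d \<ge> c" "d \<ge> 0" by (auto simp: d_def) linarith+
  define g' where "g' = tr d \<circ> g \<circ> tr (- d)"
  have trp: "tr k \<in> plh" for k unfolding tr_def by simp
  have g'p: "g' \<in> plh" unfolding g'_def using g trp by (intro plh_comp)
  have g's: "g' t = t" if "t \<le> 0 \<or> t \<ge> real (nat (2 * d))" for t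
  proof -
    have "\<bar>t - of_int d\<bar> \<ge> c" using that d by auto
    then show ?thesis using g(2)[of "t - of_int d"] by (simp add: g'_def tr_def)
  qed
  obtain n x y where xy: "stretch_word n x" "stretch_word n y" "y \<circ> g' = x" using compactly_supported_quotient[OF g'p g's] by blast
  have yr: "y \<in> rhomeo" using stretch_word_plh[OF xy(2)] by simp
  have "inv y \<circ> (x \<circ> inv y) \<circ> y \<in> N" by (intro nP'[OF xy(2)] quot[OF xy(1,2)])
  moreover have "inv y \<circ> (x \<circ> inv y) \<circ> y = g'" using yr by (auto simp: xy(3)[symmetric] fun_eq_iff)
  ultimately have "g' \<in> N" by simp
  then have "tr (- d) \<circ> g' \<circ> tr (- (- d)) \<in> N" by (rule tr)
  moreover have "tr (- d) \<circ> g' \<circ> tr (- (- d)) = g" by (auto simp: g'_def tr_def fun_eq_iff)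
  ultimately show ?thesis by simp
qed

section \<open>Self-similar germs\<close>

text \<open>\<open>f\<close> intertwines the doubling maps at \<open>x\<close> and at \<open>f x\<close>; this is the lifted form of the second axiom of TA.\<close>

definition dbl :: "(real \<Rightarrow> real) \<Rightarrow> real \<Rightarrow> bool"
  where "dbl f x \<longleftrightarrow> (\<exists>e>0. \<forall>t. \<bar>t\<bar> < e \<longrightarrow> f (x + 2 * t) - f x = 2 * (f (x + t) - f x))"

text \<open>The local condition for lifts of elements of TA. Commuting with doubling can be required at every dyadic point,
  because a regular germ has it anyway.\<close>

definition loc :: "(real \<Rightarrow> real) \<Rightarrow> real \<Rightarrow> bool"
  where "loc f x \<longleftrightarrow> (\<exists>e>0. \<forall>y. 0 < \<bar>y - x\<bar> \<and> \<bar>y - x\<bar> < e \<longrightarrow> reg f y) \<and>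
    (if x \<in> dyadics then dbl f x else reg f x)"

lemma dbl_sides:
  assumes "e > 0" "d > 0" "\<And>t. 0 \<le> t \<Longrightarrow> t < e \<Longrightarrow> f (x + 2 * t) - f x = 2 * (f (x + t) - f x)"
    "\<And>t. 0 \<le> t \<Longrightarrow> t < d \<Longrightarrow> f (x - 2 * t) - f x = 2 * (f (x - t) - f x)"
  shows "dbl f x"
  unfolding dbl_def
proof (rule exI[of _ "min e d"], intro conjI allI impI)
  fix t assume "\<bar>t\<bar> < min e d"
  then show "f (x + 2 * t) - f x = 2 * (f (x + t) - f x)"
    using assms(3)[of t] assms(4)[of "- t"] by (cases "t \<ge> 0") auto
qed (use assms in auto)

lemma reg_dbl:
  assumes "reg f x" shows "dbl f x"
proof -
  obtain e where e: "e > 0" "daff {x - e..x} f" "daff {x..x + e} f" using assms by (auto simp: reg_def)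
  obtain n b where nb: "\<And>t. t \<in> {x..x + e} \<Longrightarrow> f t = 2 powi n * t + b" using e(3) by (auto simp: daff_def)
  obtain m c where mc: "\<And>t. t \<in> {x - e..x} \<Longrightarrow> f t = 2 powi m * t + c" using e(2) by (auto simp: daff_def)
  show ?thesis
  proof (rule dbl_sides[of "e / 2" "e / 2"])
    fix t assume t: "0 \<le> t" "t < e / 2"
    show "f (x + 2 * t) - f x = 2 * (f (x + t) - f x)"
      using nb[of x] nb[of "x + t"] nb[of "x + 2 * t"] t by (simp add: algebra_simps)
    show "f (x - 2 * t) - f x = 2 * (f (x - t) - f x)"
      using mc[of x] mc[of "x - t"] mc[of "x - 2 * t"] t by (simp add: algebra_simps)
  qed (use e in auto)
qed

lemma reg_loc: "reg f x \<Longrightarrow> loc f x"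
  unfolding loc_def using reg_dbl[of f x] reg_punctured[of f x] by metis

text \<open>Lifts to the line of the elements of TA acting on the circle of length \<open>M\<close>.\<close>

definition lifts_TA :: "real \<Rightarrow> (real \<Rightarrow> real) set"
  where "lifts_TA M = {f \<in> rhomeo. (\<forall>x. loc f x) \<and> (\<forall>x. f (x + M) = f x + M)}"

lemma lifts_T_subset_lifts_TA: "lifts_T M \<subseteq> lifts_TA M"
  unfolding lifts_T_def lifts_TA_def using reg_loc by (auto dest: plh_reg plh_rhomeo)

section \<open>The model homeomorphism of the line with the unit interval\<close>

text \<open>The piecewise affine interpolation of \<open>2^x\<close> at the integers. Like the exponential function it turns the translation by
  one into doubling, but it is regular.\<close>

definition dexp :: "real \<Rightarrow> real"
  where "dexp x = 2 powi \<lfloor>x\<rfloor> * (1 + (x - of_int \<lfloor>x\<rfloor>))"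

lemma dexp_eq:
  assumes "of_int k \<le> x" "x \<le> of_int k + 1"
  shows "dexp x = 2 powi k * (1 + (x - of_int k))"
proof (cases "x = of_int k + 1")
  case True
  then have "\<lfloor>x\<rfloor> = k + 1" by simp
  then show ?thesis using True by (simp add: dexp_def powi_add2)
next
  case False
  then have "\<lfloor>x\<rfloor> = k" using assms by (intro floor_unique) auto
  then show ?thesis by (simp add: dexp_def)
qed

lemma dexp_add: "dexp (x + of_int j) = 2 powi j * dexp x"
  by (simp add: dexp_def powi_add2)

lemma dexp_pos: "dexp x > 0"
  unfolding dexp_def by (intro mult_pos_pos powi_pos) linarith

lemma dexp_0: "dexp 0 = 1"
  by (simp add: dexp_def)

lemma dexp_less: "x < y \<Longrightarrow> dexp x < dexp y"
proof -
  assume xy: "x < y"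
  have x: "dexp x = 2 powi \<lfloor>x\<rfloor> * (1 + (x - of_int \<lfloor>x\<rfloor>))" by (simp add: dexp_def)
  show ?thesis
  proof (cases "\<lfloor>x\<rfloor> = \<lfloor>y\<rfloor>")
    case True
    then show ?thesis using xy unfolding dexp_def by simp
  next
    case False
    then have f: "\<lfloor>x\<rfloor> + 1 \<le> \<lfloor>y\<rfloor>" using xy floor_mono[of x y] by linarith
    have "dexp x < 2 powi \<lfloor>x\<rfloor> * 2" unfolding x by (intro mult_strict_left_mono powi_pos) linarith
    also have "\<dots> = 2 powi (\<lfloor>x\<rfloor> + 1)" by (simp add: powi_add2)
    also have "\<dots> \<le> 2 powi \<lfloor>y\<rfloor>" using f by (intro power_int_increasing) auto
    also have "\<dots> \<le> dexp y" unfolding dexp_def by simp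
    finally show ?thesis .
  qed
qed

lemma dexp_surj: "y > 0 \<Longrightarrow> \<exists>x. dexp x = y"
proof -
  assume y: "y > 0"
  define k where "k = \<lfloor>log 2 y\<rfloor>"
  have "real_of_int k \<le> log 2 y" "log 2 y < real_of_int (k + 1)" unfolding k_def by linarith+
  then have "2 powr real_of_int k \<le> y" "y < 2 powr real_of_int (k + 1)"
    using y le_log_iff[of 2 y] log_less_iff[of 2 y] by auto
  moreover have "(2::real) powr real_of_int k = 2 powi k" for k by (rule powr_real_of_int') auto
  ultimately have k: "2 powi k \<le> y" "y < 2 powi (k + 1)" by (simp_all only:)
  then have k2: "1 \<le> y / 2 powi k" "y / 2 powi k < 2" by (auto simp: powi_add2 field_simps)
  have "dexp (of_int k + (y / 2 powi k - 1)) = 2 powi k * (1 + (of_int k + (y / 2 powi k - 1) - of_int k))"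
    using k2 by (intro dexp_eq) auto
  then show ?thesis by (intro exI[of _ "of_int k + (y / 2 powi k - 1)"]) simp
qed

lemma daff_dexp: "daff {of_int k..of_int k + 1} dexp"
  unfolding daff_def
proof (intro exI[of _ k] bexI[of _ "2 powi k * (1 - of_int k)"] ballI)
  fix t assume "t \<in> {real_of_int k..real_of_int k + 1}"
  then show "dexp t = 2 powi k * t + 2 powi k * (1 - of_int k)" using dexp_eq[of k t] by (simp add: algebra_simps)
qed auto

lemma reg_dexp: "reg dexp x"
proof (cases "x = of_int \<lfloor>x\<rfloor>")
  case True
  have "daff {x - 1..x} dexp" using daff_dexp[of "\<lfloor>x\<rfloor> - 1"] True by simp
  moreover have "daff {x..x + 1} dexp" using daff_dexp[of "\<lfloor>x\<rfloor>"] True by simp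
  moreover have "x \<in> dyadics" by (subst True) simp
  ultimately show ?thesis by (intro regI_sides[of 1 x dexp 1]) auto
next
  case False
  then have "of_int \<lfloor>x\<rfloor> < x" "x < of_int \<lfloor>x\<rfloor> + 1" using of_int_floor_le[of x] by linarith+
  then show ?thesis
    by (intro regI_open[of "min (x - of_int \<lfloor>x\<rfloor>) (of_int \<lfloor>x\<rfloor> + 1 - x)"] daff_Icc_mono[OF daff_dexp[of "\<lfloor>x\<rfloor>"]]) auto
qed

text \<open>A regular homeomorphism of the line onto \<open>(0, 1)\<close>, symmetric about the origin, that turns the translation
  by one into doubling near \<open>0\<close> and into its mirror image near \<open>1\<close>.\<close>

definition psi :: "real \<Rightarrow> real"
  where "psi x = (if x \<le> 0 then dexp x / 2 else 1 - dexp (- x) / 2)"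

lemma psi_uminus: "psi (- x) = 1 - psi x"
  by (cases "x = 0") (auto simp: psi_def dexp_0)

lemma psi_01: "0 < psi x" "psi x < 1"
proof -
  have pos: "psi x > 0" for x
  proof (cases "x \<le> 0")
    case False
    then have "dexp (- x) < 1" using dexp_less[of "- x" 0] dexp_0 by simp
    then show ?thesis using False by (simp add: psi_def)
  qed (auto simp: psi_def dexp_pos)
  show "0 < psi x" "psi x < 1" using pos[of x] pos[of "- x"] psi_uminus[of x] by auto
qed

lemma psi_less: "x < y \<Longrightarrow> psi x < psi y"
proof -
  assume xy: "x < y"
  consider "y \<le> 0" | "x \<le> 0" "y > 0" | "x > 0" by linarith
  then show ?thesis
  proof cases
    case 1
    then show ?thesis using xy dexp_less[OF xy] by (simp add: psi_def)
  next
    case 2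
    then have "dexp x \<le> 1" "dexp (- y) < 1" using dexp_less[of "- y" 0] dexp_less[of x 0] dexp_0 by (cases "x = 0"; auto)+
    then show ?thesis using 2 by (simp add: psi_def)
  next
    case 3
    then show ?thesis using xy dexp_less[of "- y" "- x"] by (simp add: psi_def)
  qed
qed

lemma psi_strict_mono: "strict_mono psi"
  by (rule strict_monoI) (rule psi_less)

lemma psi_le_iff [simp]: "psi x \<le> psi y \<longleftrightarrow> x \<le> y"
  and psi_less_iff [simp]: "psi x < psi y \<longleftrightarrow> x < y"
  and psi_eq_iff [simp]: "psi x = psi y \<longleftrightarrow> x = y"
  using psi_strict_mono by (auto simp: strict_mono_less_eq strict_mono_less strict_mono_eq)

lemma psi_surj: "0 < y \<Longrightarrow> y < 1 \<Longrightarrow> \<exists>x. psi x = y"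
proof -
  have half: "\<exists>x. psi x = y" if "0 < y" "y \<le> 1/2" for y :: real
  proof -
    obtain x where x: "dexp x = 2 * y" using dexp_surj[of "2 * y"] \<open>0 < y\<close> by auto
    then have "x \<le> 0" using dexp_less[of 0 x] dexp_0 that by (cases "x \<le> 0") auto
    then show ?thesis using x by (intro exI[of _ x]) (simp add: psi_def)
  qed
  assume y: "0 < y" "y < 1"
  show ?thesis
  proof (cases "y \<le> 1/2")
    case False
    then obtain x where "psi x = 1 - y" using half[of "1 - y"] y by auto
    then show ?thesis using psi_uminus[of x] by (intro exI[of _ "- x"]) simp
  qed (use half y in auto)
qed

definition ipsi :: "real \<Rightarrow> real" where "ipsi = inv psi"

lemma ipsi_psi [simp]: "ipsi (psi x) = x"
  unfolding ipsi_def by (rule inv_f_f) (simp add: inj_on_def)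

lemma psi_ipsi [simp]: "0 < y \<Longrightarrow> y < 1 \<Longrightarrow> psi (ipsi y) = y"
  using psi_surj by (auto simp: ipsi_def intro: f_inv_into_f)

lemma reg_psi: "reg psi x"
proof -
  have 1: "reg (\<lambda>x. dexp x / 2) x" for x
    using reg_comp[OF reg_dexp reg_affine[of 0 "-1"], of x] by (simp add: comp_def power_int_minus field_simps)
  have "reg (refl_fun (\<lambda>x. dexp x / 2)) x" by (rule reg_refl[OF 1])
  then have 2: "reg (\<lambda>x. 1 - dexp (- x) / 2) x"
    using reg_comp[OF _ reg_add[of 1], of "refl_fun (\<lambda>x. dexp x / 2)" x] by (simp add: comp_def refl_fun_def)
  have "reg (glue 0 (\<lambda>x. dexp x / 2) (\<lambda>x. 1 - dexp (- x) / 2)) x"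
    using 1 2 by (intro reg_glue) (auto simp: dexp_0)
  then show ?thesis by (rule reg_cong[of _ _ 1]) (auto simp: psi_def glue_def)
qed

lemma reg_ipsi: "0 < y \<Longrightarrow> y < 1 \<Longrightarrow> reg ipsi y"
  using reg_inv[OF reg_psi, of ipsi "ipsi y"] by simp

lemma psi_shift: "x \<le> 0 \<Longrightarrow> x + of_int j \<le> 0 \<Longrightarrow> psi (x + of_int j) = 2 powi j * psi x"
  by (simp add: psi_def dexp_add)

text \<open>Conjugation by \<open>psi\<close>, completed by the identity outside the interval.\<close>

definition Psi :: "(real \<Rightarrow> real) \<Rightarrow> real \<Rightarrow> real"
  where "Psi h t = (if 0 < t \<and> t < 1 then psi (h (ipsi t)) else t)"

lemma Psi_psi [simp]: "Psi h (psi x) = psi (h x)"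
  using psi_01[of x] by (simp add: Psi_def)

lemma Psi_out [simp]: "t \<le> 0 \<or> t \<ge> 1 \<Longrightarrow> Psi h t = t"
  by (auto simp: Psi_def)

lemma Psi_01: "0 \<le> t \<Longrightarrow> t < 1 \<Longrightarrow> 0 \<le> Psi h t \<and> Psi h t < 1"
  using psi_01 by (auto simp: Psi_def less_imp_le)

lemma psi_cases:
  obtains "t \<le> 0 \<or> t \<ge> 1" | x where "t = psi x"
  by (metis not_le psi_surj)

lemma Psi_comp: "Psi (f \<circ> g) = Psi f \<circ> Psi g"
proof
  fix t show "Psi (f \<circ> g) t = (Psi f \<circ> Psi g) t"
    by (rule psi_cases[of t]) auto
qed

lemma Psi_id: "Psi id = id"
proof
  fix t show "Psi id t = id t" by (rule psi_cases[of t]) auto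
qed

lemma Psi_rhomeo:
  assumes "h \<in> rhomeo" shows "Psi h \<in> rhomeo"
proof -
  have "strict_mono (Psi h)"
  proof (rule strict_monoI)
    fix s t :: real assume "s < t"
    show "Psi h s < Psi h t"
    proof (rule psi_cases[of s]; rule psi_cases[of t])
      fix x y assume "s = psi x" "t = psi y"
      then show ?thesis using \<open>s < t\<close> rhomeo_less[OF assms] by simp
    next
      fix x assume "s \<le> 0 \<or> 1 \<le> s" "t = psi x"
      then show ?thesis using \<open>s < t\<close> psi_01[of x] psi_01[of "h x"] by auto
    next
      fix x assume "s = psi x" "t \<le> 0 \<or> 1 \<le> t" 
      then show ?thesis using \<open>s < t\<close> psi_01[of x] psi_01[of "h x"] by auto
    qed (use \<open>s < t\<close> in auto)
  qed
  moreover have "Psi h \<circ> Psi (inv h) = id" using assms by (simp only: Psi_comp[symmetric] rhomeo_inv_comp Psi_id)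
  then have "surj (Psi h)" by (metis comp_apply id_apply surj_def)
  ultimately show ?thesis by (simp add: rhomeo_def)
qed

lemma reg_Psi:
  assumes "\<And>x. reg h x" "t \<noteq> 0" "t \<noteq> 1"
  shows "reg (Psi h) t"
proof -
  consider "t < 0" | "0 < t" "t < 1" | "t > 1" using assms by linarith
  then show ?thesis
  proof cases
    case 1
    show ?thesis by (rule reg_cong_open[of id t "t - 1" 0, OF reg_id(2)]) (use 1 in auto)
  next
    case 2
    have "reg (psi \<circ> (h \<circ> ipsi)) t" using 2 assms by (intro reg_comp reg_ipsi reg_psi) auto
    then show ?thesis by (rule reg_cong_open[of _ _ 0 1]) (use 2 in \<open>auto simp: Psi_def\<close>)
  next
    case 3
    show ?thesis by (rule reg_cong_open[of id t 1 "t + 1", OF reg_id(2)]) (use 3 in auto)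
  qed
qed

lemma Psi_refl: "Psi (refl_fun h) t = 1 - Psi h (1 - t)"
proof (rule psi_cases[of t])
  fix x assume "t = psi x"
  then have "1 - t = psi (- x)" by (simp add: psi_uminus)
  then have "Psi h (1 - t) = psi (h (- x))" by (simp only: Psi_psi)
  then show ?thesis using \<open>t = psi x\<close> by (simp add: refl_fun_def psi_uminus)
qed auto

text \<open>Only the behaviour near minus infinity matters here; the other end is obtained by reflection.\<close>

definition left_equi :: "(real \<Rightarrow> real) \<Rightarrow> bool"
  where "left_equi h \<longleftrightarrow> (\<exists>C. \<forall>x\<le>C. h (x - 1) = h x - 1)"

definition equi_ends :: "(real \<Rightarrow> real) set"
  where "equi_ends = {h \<in> plh. left_equi h \<and> left_equi (refl_fun h)}"

text \<open>Near minus infinity both \<open>h\<close> and the translation by one are visible through \<open>psi\<close>: commuting with the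
  translation becomes commuting with doubling at \<open>0\<close>.\<close>

lemma dbl_Psi_0:
  assumes "h \<in> rhomeo" "left_equi h"
  shows "\<exists>e>0. \<forall>t. 0 \<le> t \<longrightarrow> t < e \<longrightarrow> Psi h (2 * t) = 2 * Psi h t"
proof -
  obtain C where C: "\<And>x. x \<le> C \<Longrightarrow> h (x - 1) = h x - 1" using assms(2) by (auto simp: left_equi_def)
  \<comment> \<open>below this bound \<open>x + 1\<close> and \<open>h x + 1\<close> stay in the range where \<open>psi\<close> doubles\<close>
  define c where "c = min (- 1) (min (C - 1) (inv h (- 1)))"
  have "Psi h (2 * t) = 2 * Psi h t" if "0 \<le> t" "t < psi c" for t
  proof (rule psi_cases[of t])
    fix x assume x: "t = psi x"
    then have xc: "x < c" using that by simp
    then have x': "x \<le> -1" "x + 1 \<le> C" "h x \<le> -1"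
      using rhomeo_le[OF assms(1), of x "inv h (-1)"] assms(1) by (auto simp: c_def)
    have "h (x + 1) = h x + 1" using C[of "x + 1"] x' by simp
    then show ?thesis using psi_shift[of x 1] psi_shift[of "h x" 1] x x' Psi_psi[of h "x + 1"] by simp
  qed (use that psi_01[of c] in auto)
  then show ?thesis using psi_01(1)[of c] by blast
qed

lemma loc_Psi:
  assumes h: "h \<in> equi_ends" shows "loc (Psi h) t"
proof -
  have r: "reg (Psi h) t" if "t \<noteq> 0" "t \<noteq> 1" for t
    using reg_Psi[OF _ that] h by (auto simp: equi_ends_def)
  have hr: "h \<in> rhomeo" using h by (auto simp: equi_ends_def)
  obtain e where e: "e > 0" "\<And>t. 0 \<le> t \<Longrightarrow> t < e \<Longrightarrow> Psi h (2 * t) = 2 * Psi h t"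
    using dbl_Psi_0[OF hr] h by (auto simp: equi_ends_def)
  obtain d where d: "d > 0" "\<And>t. 0 \<le> t \<Longrightarrow> t < d \<Longrightarrow> Psi (refl_fun h) (2 * t) = 2 * Psi (refl_fun h) t"
    using dbl_Psi_0[OF refl_rhomeo[OF hr]] h by (auto simp: equi_ends_def)
  have "dbl (Psi h) 0"
    by (rule dbl_sides[OF e(1) zero_less_one]) (use e(2) in auto)
  moreover have "dbl (Psi h) 1"
  proof (rule dbl_sides[OF zero_less_one d(1)])
    fix t assume "0 \<le> t" "t < d"
    then show "Psi h (1 - 2 * t) - Psi h 1 = 2 * (Psi h (1 - t) - Psi h 1)"
      using d(2)[of t] by (simp add: Psi_refl)
  qed auto
  moreover have *: "\<exists>e>0. \<forall>y. 0 < \<bar>y - t\<bar> \<and> \<bar>y - t\<bar> < e \<longrightarrow> reg (Psi h) y" if "t = 0 \<or> t = 1"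
    using that by (intro exI[of _ 1]) (auto intro!: r)
  ultimately show ?thesis
  proof (cases "t = 0 \<or> t = 1")
    case True
    then have "t \<in> dyadics" "dbl (Psi h) t" using \<open>dbl (Psi h) 0\<close> \<open>dbl (Psi h) 1\<close> by auto
    then show ?thesis using * [OF True] by (simp only: loc_def if_True simp_thms)
  next
    case False
    then show ?thesis by (intro reg_loc r) auto
  qed
qed

lemma equi_ends_refl: "h \<in> equi_ends \<Longrightarrow> refl_fun h \<in> equi_ends"
  by (auto simp: equi_ends_def refl_plh)

lemma equi_ends_plh: "h \<in> equi_ends \<Longrightarrow> h \<in> plh"
  by (simp add: equi_ends_def)

lemma left_equi_comp:
  assumes "left_equi f" "left_equi g" "g \<in> rhomeo" shows "left_equi (f \<circ> g)"
proof -
  obtain C D where C: "\<And>x. x \<le> C \<Longrightarrow> f (x - 1) = f x - 1" and D: "\<And>x. x \<le> D \<Longrightarrow> g (x - 1) = g x - 1"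
    using assms by (auto simp: left_equi_def)
  have "(f \<circ> g) (x - 1) = (f \<circ> g) x - 1" if "x \<le> min D (inv g C)" for x
    using that C[of "g x"] D[of x] rhomeo_le[OF assms(3), of x "inv g C"] assms(3) by auto
  then show ?thesis unfolding left_equi_def by blast
qed

lemma left_equi_inv:
  assumes "left_equi f" "f \<in> rhomeo" shows "left_equi (inv f)"
proof -
  obtain C where C: "\<And>x. x \<le> C \<Longrightarrow> f (x - 1) = f x - 1" using assms by (auto simp: left_equi_def)
  have "inv f (y - 1) = inv f y - 1" if "y \<le> f C" for y
  proof -
    have "inv f y \<le> C" using rhomeo_le[OF assms(2), of "inv f y" C] that assms(2) by simp
    then have "f (inv f y - 1) = y - 1" using C[of "inv f y"] assms(2) by simp
    then show ?thesis using rhomeo_inv_eq[OF assms(2), of "y - 1" "inv f y - 1"] by simp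
  qed
  then show ?thesis unfolding left_equi_def by blast
qed

lemma fun_group_equi_ends: "fun_group equi_ends"
  unfolding fun_group_def
proof (intro conjI ballI)
  show "id \<in> equi_ends" by (auto simp: equi_ends_def left_equi_def refl_fun_def)
  show "f \<circ> g \<in> equi_ends" if "f \<in> equi_ends" "g \<in> equi_ends" for f g
  proof -
    have "g \<in> rhomeo" using that by (simp add: equi_ends_def)
    then have "left_equi (f \<circ> g)" "left_equi (refl_fun f \<circ> refl_fun g)" "f \<circ> g \<in> plh"
      using that refl_rhomeo by (auto simp: equi_ends_def intro!: left_equi_comp plh_comp)
    then show ?thesis unfolding equi_ends_def mem_Collect_eq refl_comp by blast
  qed
  show "inv f \<in> equi_ends" if "f \<in> equi_ends" for f
    using that refl_rhomeo[of f] left_equi_inv[of f] left_equi_inv[of "refl_fun f"] refl_inv[of f]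
    unfolding equi_ends_def by auto
qed

section \<open>Maps that are integer translations near both ends\<close>

definition left_trans :: "(real \<Rightarrow> real) \<Rightarrow> bool"
  where "left_trans k \<longleftrightarrow> (\<exists>j::int. \<exists>C. \<forall>x\<le>C. k x = x + of_int j)"

definition trans_ends :: "(real \<Rightarrow> real) set"
  where "trans_ends = {k \<in> plh. left_trans k \<and> left_trans (refl_fun k)}"

lemma left_trans_left_equi: "left_trans k \<Longrightarrow> left_equi k"
  unfolding left_trans_def left_equi_def
proof (elim exE)
  fix j C assume "\<forall>x\<le>C. k x = x + real_of_int j"
  then have "k (x - 1) = k x - 1" if "x \<le> C" for x using that by auto
  then show "\<exists>C. \<forall>x\<le>C. k (x - 1) = k x - 1" by blast
qed

lemma trans_ends_subset_equi_ends: "trans_ends \<subseteq> equi_ends"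
  by (auto simp: trans_ends_def equi_ends_def left_trans_left_equi)

lemma left_trans_comp: "left_trans f \<Longrightarrow> left_trans g \<Longrightarrow> left_trans (f \<circ> g)"
proof -
  assume "left_trans f" "left_trans g"
  then obtain i C j D where C: "\<And>x. x \<le> C \<Longrightarrow> f x = x + of_int i" and D: "\<And>x. x \<le> D \<Longrightarrow> g x = x + of_int j"
    unfolding left_trans_def by blast
  have "(f \<circ> g) x = x + of_int (i + j)" if "x \<le> min D (C - of_int j)" for x
    using that C[of "x + of_int j"] D[of x] by auto
  then show ?thesis unfolding left_trans_def by blast
qed

lemma left_trans_inv: "left_trans f \<Longrightarrow> f \<in> rhomeo \<Longrightarrow> left_trans (inv f)"
proof -
  assume f: "left_trans f" "f \<in> rhomeo"
  then obtain i C where C: "\<And>x. x \<le> C \<Longrightarrow> f x = x + of_int i"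
    unfolding left_trans_def by blast
  have "inv f y = y + of_int (- i)" if "y \<le> C + of_int i" for y
    using that C[of "y - of_int i"] rhomeo_inv_eq[OF f(2), of y "y - of_int i"] by auto
  then show ?thesis unfolding left_trans_def by blast
qed

lemma left_trans_id: "(\<And>x. x \<le> C \<Longrightarrow> k x = x) \<Longrightarrow> left_trans k"
  unfolding left_trans_def by (intro exI[of _ "0::int"] exI[of _ C]) auto

lemma fun_group_trans_ends: "fun_group trans_ends"
  unfolding fun_group_def
proof (intro conjI ballI)
  show "id \<in> trans_ends" by (auto simp: trans_ends_def refl_fun_def intro: left_trans_id)
  show "f \<circ> g \<in> trans_ends" if "f \<in> trans_ends" "g \<in> trans_ends" for f g
    using that plh_comp[of f g] left_trans_comp[of f g] left_trans_comp[of "refl_fun f" "refl_fun g"]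
    unfolding trans_ends_def mem_Collect_eq refl_comp by blast
  show "inv f \<in> trans_ends" if "f \<in> trans_ends" for f
    using that refl_rhomeo[of f] left_trans_inv[of f] left_trans_inv[of "refl_fun f"] refl_inv[of f]
    unfolding trans_ends_def by auto
qed

lemma trans_ends_refl: "k \<in> trans_ends \<Longrightarrow> refl_fun k \<in> trans_ends"
  by (auto simp: trans_ends_def refl_plh)

lemma tau_trans_ends: "tau \<in> trans_ends"
proof -
  have "left_trans tau" unfolding left_trans_def by (intro exI[of _ "1::int"] exI[of _ 0]) (auto simp: tau_def)
  moreover have "left_trans (refl_fun tau)" unfolding left_trans_def
    by (intro exI[of _ "-1::int"] exI[of _ 0]) (auto simp: tau_def refl_fun_def)
  ultimately show ?thesis by (simp add: trans_ends_def)
qed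

lemma stretch_trans_ends: "stretch \<in> trans_ends"
proof -
  have "left_trans stretch" by (rule left_trans_id[of 0]) (auto simp: stretch_def)
  moreover have "left_trans (refl_fun stretch)" unfolding left_trans_def
    by (intro exI[of _ "-1::int"] exI[of _ "-1"]) (auto simp: stretch_def refl_fun_def)
  ultimately show ?thesis by (simp add: trans_ends_def)
qed

lemma trans_ends_compactly_supported:
  assumes "k \<in> plh" "\<And>t. \<bar>t\<bar> \<ge> c \<Longrightarrow> k t = t" shows "k \<in> trans_ends"
proof -
  have "left_trans k" "left_trans (refl_fun k)"
    by (rule left_trans_id[of "- \<bar>c\<bar>"]; use assms(2) in \<open>auto simp: refl_fun_def\<close>)+
  then show ?thesis using assms by (simp add: trans_ends_def)
qed

text \<open>An integral translation by \<open>j\<close> becomes multiplication by \<open>2^j\<close>, so no singularity arises at the end of the interval.\<close>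

lemma Psi_left_trans:
  assumes "left_trans k"
  shows "\<exists>e>0. \<exists>j::int. \<forall>t. 0 \<le> t \<longrightarrow> t \<le> e \<longrightarrow> Psi k t = 2 powi j * t"
proof -
  obtain j C where C: "\<And>x. x \<le> C \<Longrightarrow> k x = x + of_int j" using assms unfolding left_trans_def by blast
  define c where "c = min C (min 0 (- of_int j))"
  have "Psi k t = 2 powi j * t" if "0 \<le> t" "t \<le> psi c" for t
  proof (rule psi_cases[of t])
    fix x assume x: "t = psi x"
    then have "x \<le> c" using that by simp
    then show ?thesis using psi_shift[of x j] C[of x] x by (auto simp: c_def)
  qed (use that psi_01[of c] in auto)
  then show ?thesis using psi_01(1)[of c] by blast
qed

lemma Psi_plh:
  assumes k: "k \<in> trans_ends" shows "Psi k \<in> plh"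
proof (rule plhI)
  have kp: "k \<in> plh" using k by (simp add: trans_ends_def)
  then show "Psi k \<in> rhomeo" by (simp add: Psi_rhomeo)
  fix t :: real
  obtain e j where e: "e > 0" "\<And>t. 0 \<le> t \<Longrightarrow> t \<le> e \<Longrightarrow> Psi k t = 2 powi j * t"
    using Psi_left_trans[of k] k unfolding trans_ends_def by blast
  obtain d i where d: "d > 0" "\<And>t. 0 \<le> t \<Longrightarrow> t \<le> d \<Longrightarrow> Psi (refl_fun k) t = 2 powi i * t"
    using Psi_left_trans[of "refl_fun k"] k unfolding trans_ends_def by blast
  consider "t = 0" | "t = 1" | "t \<noteq> 0" "t \<noteq> 1" by blast
  then show "reg (Psi k) t"
  proof cases
    case 1
    have "daff {0 - 1..0} (Psi k)" unfolding daff_def by (intro exI[of _ "0::int"] bexI[of _ 0]) auto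
    moreover have "daff {0..0 + e} (Psi k)" unfolding daff_def
      by (intro exI[of _ j] bexI[of _ 0]) (use e in auto)
    ultimately show ?thesis using 1 e(1) by (intro regI_sides[of 1 _ _ e]) auto
  next
    case 2
    have "daff {1..1 + 1} (Psi k)" unfolding daff_def by (intro exI[of _ "0::int"] bexI[of _ 0]) auto
    moreover have "daff {1 - d..1} (Psi k)" unfolding daff_def
    proof (intro exI[of _ i] bexI[of _ "1 - 2 powi i"] ballI)
      fix t assume "t \<in> {1 - d..1}"
      then have "1 - Psi k t = 2 powi i * (1 - t)" using d(2)[of "1 - t"] by (simp add: Psi_refl)
      then show "Psi k t = 2 powi i * t + (1 - 2 powi i)" by (simp add: algebra_simps)
    qed auto
    ultimately show ?thesis using 2 d(1) by (intro regI_sides[of d _ _ 1]) auto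
  next
    case 3
    then show ?thesis using reg_Psi[of k t] kp by auto
  qed
qed

section \<open>Block maps\<close>

text \<open>Acts on \<open>[q, q + 1]\<close> by the translate of \<open>Psi (\<eta> q)\<close>. The assignment is a homomorphism in \<open>\<eta>\<close>, so identities
  between block maps can be checked one block at a time.\<close>

definition blocks :: "(int \<Rightarrow> real \<Rightarrow> real) \<Rightarrow> real \<Rightarrow> real"
  where "blocks \<eta> t = Psi (\<eta> \<lfloor>t\<rfloor>) (t - of_int \<lfloor>t\<rfloor>) + of_int \<lfloor>t\<rfloor>"

lemma blocks_eq:
  assumes "of_int q \<le> t" "t \<le> of_int q + 1"
  shows "blocks \<eta> t = Psi (\<eta> q) (t - of_int q) + of_int q"
proof (cases "t = of_int q + 1")
  case True
  then have "\<lfloor>t\<rfloor> = q + 1" by simp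
  then show ?thesis using True by (simp add: blocks_def)
next
  case False
  then have "\<lfloor>t\<rfloor> = q" using assms by (intro floor_unique) auto
  then show ?thesis by (simp add: blocks_def)
qed

lemma floor_blocks [simp]: "\<lfloor>blocks \<eta> t\<rfloor> = \<lfloor>t\<rfloor>"
proof -
  have "0 \<le> t - of_int \<lfloor>t\<rfloor>" "t - of_int \<lfloor>t\<rfloor> < 1" by linarith+
  then have "0 \<le> Psi (\<eta> \<lfloor>t\<rfloor>) (t - of_int \<lfloor>t\<rfloor>)" "Psi (\<eta> \<lfloor>t\<rfloor>) (t - of_int \<lfloor>t\<rfloor>) < 1"
    using Psi_01 by blast+
  then show ?thesis by (intro floor_unique) (auto simp: blocks_def)
qed

lemma blocks_comp: "blocks \<eta> \<circ> blocks \<theta> = blocks (\<lambda>q. \<eta> q \<circ> \<theta> q)"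
proof
  fix t
  have "blocks \<eta> (blocks \<theta> t) = Psi (\<eta> \<lfloor>t\<rfloor>) (Psi (\<theta> \<lfloor>t\<rfloor>) (t - of_int \<lfloor>t\<rfloor>)) + of_int \<lfloor>t\<rfloor>"
    unfolding blocks_def[of \<eta>] floor_blocks by (simp add: blocks_def)
  also have "\<dots> = Psi (\<eta> \<lfloor>t\<rfloor> \<circ> \<theta> \<lfloor>t\<rfloor>) (t - of_int \<lfloor>t\<rfloor>) + of_int \<lfloor>t\<rfloor>"
    by (subst Psi_comp) simp
  also have "\<dots> = blocks (\<lambda>q. \<eta> q \<circ> \<theta> q) t" by (rule blocks_def[symmetric])
  finally show "(blocks \<eta> \<circ> blocks \<theta>) t = blocks (\<lambda>q. \<eta> q \<circ> \<theta> q) t" by simp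
qed

lemma blocks_id: "blocks (\<lambda>q. id) = id"
  by (auto simp: blocks_def Psi_id)

lemma blocks_rhomeo:
  assumes "\<And>q. \<eta> q \<in> rhomeo" shows "blocks \<eta> \<in> rhomeo"
proof -
  have "strict_mono (blocks \<eta>)"
  proof (rule strict_monoI)
    fix s t :: real assume st: "s < t"
    show "blocks \<eta> s < blocks \<eta> t"
    proof (cases "\<lfloor>s\<rfloor> = \<lfloor>t\<rfloor>")
      case True
      then show ?thesis using st rhomeo_less[OF Psi_rhomeo[OF assms]] by (simp add: blocks_def)
    next
      case False
      then have "\<lfloor>s\<rfloor> < \<lfloor>t\<rfloor>" using floor_mono[of s t] st by linarith
      then have "\<lfloor>blocks \<eta> s\<rfloor> < \<lfloor>blocks \<eta> t\<rfloor>" by simp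
      then show ?thesis by linarith
    qed
  qed
  moreover have "blocks \<eta> \<circ> blocks (\<lambda>q. inv (\<eta> q)) = id"
    unfolding blocks_comp by (simp only: rhomeo_inv_comp[OF assms] blocks_id)
  then have "surj (blocks \<eta>)" by (metis comp_apply id_apply surj_def)
  ultimately show ?thesis by (simp add: rhomeo_def)
qed

lemma blocks_inv:
  assumes "\<And>q. \<eta> q \<in> rhomeo" shows "inv (blocks \<eta>) = blocks (\<lambda>q. inv (\<eta> q))"
proof (rule inv_equality)
  have "blocks (\<lambda>q. inv (\<eta> q)) \<circ> blocks \<eta> = id"
    unfolding blocks_comp by (simp only: rhomeo_inv_comp[OF assms] blocks_id)
  then show "blocks (\<lambda>q. inv (\<eta> q)) (blocks \<eta> x) = x" for x by (metis comp_apply id_apply)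
  have "blocks \<eta> \<circ> blocks (\<lambda>q. inv (\<eta> q)) = id"
    unfolding blocks_comp by (simp only: rhomeo_inv_comp[OF assms] blocks_id)
  then show "blocks \<eta> (blocks (\<lambda>q. inv (\<eta> q)) y) = y" for y by (metis comp_apply id_apply)
qed

lemma blocks_add: "blocks \<eta> (t + of_int j) = blocks (\<lambda>q. \<eta> (q + j)) t + of_int j"
  by (simp add: blocks_def)

lemma reg_blocks:
  assumes "\<And>q x. reg (\<eta> q) x" "t \<notin> \<int>"
  shows "reg (blocks \<eta>) t"
proof -
  let ?q = "\<lfloor>t\<rfloor>"
  have t: "of_int ?q < t" "t < of_int ?q + 1"
  proof -
    have "t \<noteq> of_int ?q" using assms(2) Ints_of_int[of ?q] by metis
    then show "of_int ?q < t" "t < of_int ?q + 1" using floor_correct[of t] by linarith+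
  qed
  have "reg (\<lambda>s. Psi (\<eta> ?q) (s + of_int (- ?q)) + of_int ?q) t"
  proof (rule reg_shift)
    show "reg (Psi (\<eta> ?q)) (t + of_int (- ?q))"
    proof (rule reg_Psi)
      show "t + of_int (- ?q) \<noteq> 0" "t + of_int (- ?q) \<noteq> 1" using t by linarith+
    qed (rule assms)
  qed auto
  then show ?thesis
    by (rule reg_cong_open[of _ _ "of_int ?q" "of_int ?q + 1"]) (use t in \<open>auto simp: blocks_eq[of ?q]\<close>)
qed

text \<open>At an integer the two adjacent blocks contribute the two one-sided germs. Doubling at a fixed point
  preserves the sides, so commuting with it can be checked on each side.\<close>

lemma loc_blocks:
  assumes "\<And>q. \<eta> q \<in> equi_ends"
  shows "loc (blocks \<eta>) t"
proof (cases "t \<in> \<int>")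
  case False
  have "reg (blocks \<eta>) t" by (rule reg_blocks[OF _ False]) (use assms equi_ends_plh in auto)
  then show ?thesis by (rule reg_loc)
next
  case True
  then obtain q where q: "t = of_int q" by (auto elim: Ints_cases)
  have "reg (blocks \<eta>) y" if "0 < \<bar>y - t\<bar>" "\<bar>y - t\<bar> < 1" for y
  proof (rule reg_blocks)
    show "y \<notin> \<int>"
    proof
      assume "y \<in> \<int>"
      then obtain p where "y = of_int p" by (auto elim: Ints_cases)
      then have "\<bar>y - t\<bar> = of_int \<bar>p - q\<bar>" using q by simp
      then show False using that by simp
    qed
  qed (use assms equi_ends_plh in auto)
  moreover have "dbl (blocks \<eta>) t"
  proof -
    have "dbl (Psi (\<eta> q)) 0" "dbl (Psi (\<eta> (q - 1))) 1"
      using loc_Psi[OF assms, of q 0] loc_Psi[OF assms, of "q - 1" 1] by (auto simp: loc_def)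
    then obtain e d where e: "e > 0" "\<And>t. \<bar>t\<bar> < e \<Longrightarrow> Psi (\<eta> q) (0 + 2 * t) - Psi (\<eta> q) 0 = 2 * (Psi (\<eta> q) (0 + t) - Psi (\<eta> q) 0)"
      and d: "d > 0" "\<And>t. \<bar>t\<bar> < d \<Longrightarrow> Psi (\<eta> (q - 1)) (1 + 2 * t) - Psi (\<eta> (q - 1)) 1 = 2 * (Psi (\<eta> (q - 1)) (1 + t) - Psi (\<eta> (q - 1)) 1)"
      unfolding dbl_def by blast
    show ?thesis
    proof (rule dbl_sides[of "min e (1/2)" "min d (1/2)"])
      fix s :: real assume "0 \<le> s" "s < min e (1/2)"
      then show "blocks \<eta> (t + 2 * s) - blocks \<eta> t = 2 * (blocks \<eta> (t + s) - blocks \<eta> t)"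
        using e(2)[of s] by (simp add: q blocks_eq[of q])
    next
      fix s :: real assume "0 \<le> s" "s < min d (1/2)"
      then show "blocks \<eta> (t - 2 * s) - blocks \<eta> t = 2 * (blocks \<eta> (t - s) - blocks \<eta> t)"
        using d(2)[of "- s"] by (simp add: q blocks_eq[of "q - 1"] algebra_simps)
    qed (use e d in auto)
  qed
  ultimately show ?thesis unfolding loc_def using q by (auto intro!: exI[of _ 1])
qed

lemma blocks_plh:
  assumes "\<And>q. \<eta> q \<in> trans_ends"
  shows "blocks \<eta> \<in> plh"
proof (rule plhI)
  show "blocks \<eta> \<in> rhomeo" by (rule blocks_rhomeo) (use assms in \<open>auto simp: trans_ends_def\<close>)
  fix t :: real
  define q where "q = \<lfloor>t\<rfloor>"
  have t: "of_int q \<le> t" "t < of_int q + 1" unfolding q_def by linarith+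
  define u where "u = (\<lambda>p s. Psi (\<eta> p) (s + of_int (- p)) + of_int p)"
  have u: "reg (u p) s" for p s unfolding u_def
    by (rule reg_shift) (use Psi_plh[OF assms] in auto)
  have "reg (glue (of_int q) (u (q - 1)) (u q)) t"
    by (rule reg_glue[OF _ _ u u]) (auto simp: u_def)
  then show "reg (blocks \<eta>) t"
  proof (rule reg_cong_open[of _ _ "of_int q - 1" "of_int q + 1"])
    fix s :: real assume s: "of_int q - 1 < s" "s < of_int q + 1"
    show "glue (of_int q) (u (q - 1)) (u q) s = blocks \<eta> s"
    proof (cases "s \<le> of_int q")
      case True
      then show ?thesis using s blocks_eq[of "q - 1" s \<eta>] by (simp add: u_def)
    next
      case False
      then show ?thesis using s blocks_eq[of q s \<eta>] by (simp add: u_def)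
    qed
  qed (use t in auto)
qed

lemma blocks_lifts_T:
  assumes "\<And>q. \<eta> q \<in> trans_ends" "\<And>q. \<eta> (q + m) = \<eta> q"
  shows "blocks \<eta> \<in> lifts_T (of_int m)"
  using blocks_plh[OF assms(1)] blocks_add[of \<eta> _ m] assms(2) by (simp add: lifts_T_def)

lemma blocks_lifts_TA:
  assumes "\<And>q. \<eta> q \<in> equi_ends" "\<And>q. \<eta> (q + m) = \<eta> q"
  shows "blocks \<eta> \<in> lifts_TA (of_int m)"
proof -
  have "blocks \<eta> \<in> rhomeo" by (rule blocks_rhomeo) (rule plh_rhomeo[OF equi_ends_plh[OF assms(1)]])
  moreover have "loc (blocks \<eta>) x" for x using loc_blocks[of \<eta>] assms(1) by blast
  moreover have "blocks \<eta> (x + of_int m) = blocks \<eta> x + of_int m" for x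
    using blocks_add[of \<eta> x m] assms(2) by simp
  ultimately show ?thesis unfolding lifts_TA_def by blast
qed

text \<open>The inverse of \<open>Psi\<close>: conjugate back by \<open>psi\<close>.\<close>

lemma Psi_surjective:
  assumes k: "k \<in> rhomeo" "k 0 = 0" "k 1 = 1" "\<And>t. 0 < t \<Longrightarrow> t < 1 \<Longrightarrow> reg k t"
  obtains x where "x \<in> plh" "\<And>t. psi (x t) = k (psi t)" "\<And>t. 0 \<le> t \<Longrightarrow> t \<le> 1 \<Longrightarrow> Psi x t = k t"
proof -
  have k01: "0 < k t \<and> k t < 1 \<longleftrightarrow> 0 < t \<and> t < 1" for t
    using rhomeo_less[OF k(1), of 0 t] rhomeo_less[OF k(1), of t 1] k(2,3) by simp
  define x where "x = ipsi \<circ> (k \<circ> psi)"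
  have px: "psi (x t) = k (psi t)" for t using k01[of "psi t"] psi_01[of t] by (simp add: x_def)
  have "strict_mono x"
  proof (rule strict_monoI)
    fix s t :: real assume "s < t"
    then have "psi (x s) < psi (x t)" unfolding px using rhomeo_less[OF k(1)] by simp
    then show "x s < x t" by simp
  qed
  moreover have "surj x" unfolding surj_def
  proof
    fix y
    have "0 < inv k (psi y)" "inv k (psi y) < 1" using k01[of "inv k (psi y)"] k(1) psi_01[of y] by auto
    then obtain z where "psi z = inv k (psi y)" using psi_surj by blast
    then have "psi (x z) = psi y" unfolding px using k(1) by simp
    then show "\<exists>z. y = x z" by auto
  qed
  moreover have "reg x t" for t unfolding x_def
    using k01[of "psi t"] psi_01[of t] by (intro reg_comp reg_psi k(4) reg_ipsi) auto
  ultimately have "x \<in> plh" by (intro plhI) (auto simp: rhomeo_def)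
  moreover have "Psi x t = k t" if "0 \<le> t" "t \<le> 1" for t
  proof (rule psi_cases[of t])
    assume "t \<le> 0 \<or> 1 \<le> t"
    then show ?thesis using that k(2,3) by (cases "t = 0") auto
  qed (simp add: px)
  ultimately show ?thesis using that px by blast
qed

text \<open>Maps with compact support in \<open>(0, 1)\<close> correspond under \<open>Psi\<close> to maps with compact support on the line.\<close>

lemma Tsupp_block:
  assumes g: "g \<in> Tsupp M 0 1" and M: "M \<ge> 1"
  obtains k c where "k \<in> plh" "\<And>t. \<bar>t\<bar> \<ge> c \<Longrightarrow> k t = t" "\<And>t. 0 \<le> t \<Longrightarrow> t \<le> 1 \<Longrightarrow> Psi k t = g t"
    "\<And>t. 1 \<le> t \<Longrightarrow> t \<le> M \<Longrightarrow> g t = t"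
proof -
  obtain a b where ab: "g \<in> lifts_T M" "0 < a" "a \<le> b" "b < 1" "\<And>t. b \<le> t \<Longrightarrow> t \<le> a + M \<Longrightarrow> g t = t"
    by (rule TsuppE[OF g], rule that)
  have gp: "g \<in> plh" "g \<in> rhomeo" using lifts_T_plh[OF ab(1)] by auto
  have g0: "g t = t" if "0 \<le> t" "t \<le> a" for t
    using lifts_T_add[OF ab(1), of t] ab(5)[of "t + M"] that ab M by simp
  have g1: "g 0 = 0" "g 1 = 1" using g0[of 0] ab(5)[of 1] ab M by auto
  obtain k where k: "k \<in> plh" "\<And>t. psi (k t) = g (psi t)" "\<And>t. 0 \<le> t \<Longrightarrow> t \<le> 1 \<Longrightarrow> Psi k t = g t"
    using Psi_surjective[OF gp(2) g1 plh_reg[OF gp(1)]] by blast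
  have fixed: "k t = t" if "\<bar>t\<bar> \<ge> max (max (ipsi b) (- ipsi a)) 0" for t
  proof -
    have "t \<ge> ipsi b \<or> t \<le> ipsi a" using that by auto
    then have "psi t \<ge> b \<or> psi t \<le> a"
      using psi_le_iff[of "ipsi b" t] psi_le_iff[of t "ipsi a"] ab by (auto simp del: psi_le_iff)
    then have "g (psi t) = psi t" using ab(5)[of "psi t"] g0[of "psi t"] psi_01[of t] M ab by auto
    then show ?thesis using k(2)[of t] by simp
  qed
  have "g t = t" if "1 \<le> t" "t \<le> M" for t using ab(5)[of t] ab that by auto
  with k(1) fixed k(3) show ?thesis by (rule that)
qed

lemma Tsupp_shift:
  assumes g: "g \<in> Tsupp M a b" and c: "c \<in> dyadics"
  shows "(\<lambda>t. t + - c) \<circ> g \<circ> (\<lambda>t. t + c) \<in> Tsupp M (a - c) (b - c)"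
proof -
  obtain a' b' where ab: "g \<in> lifts_T M" "a < a'" "a' \<le> b'" "b' < b" "\<And>t. b' \<le> t \<Longrightarrow> t \<le> a' + M \<Longrightarrow> g t = t"
    by (rule TsuppE[OF g], rule that)
  have "(\<lambda>t. t + - c) \<circ> g \<circ> (\<lambda>t. t + c) \<in> plh" using c lifts_T_plh[OF ab(1)] by (intro plh_comp plh_add) auto
  moreover have "g (x + M + c) = g (x + c) + M" for x using lifts_T_add[OF ab(1), of "x + c"] by (simp add: ac_simps)
  ultimately have "(\<lambda>t. t + - c) \<circ> g \<circ> (\<lambda>t. t + c) \<in> lifts_T M" by (simp add: lifts_T_def)
  then show ?thesis by (rule TsuppI[where a' = "a' - c" and b' = "b' - c"]) (use ab in auto)
qed

text \<open>Brings the hypothesis of \<open>lifts_T_generated\<close> down to a single interval and invariance under the half translation.\<close>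

lemma Tsupp_half_shifts:
  assumes G: "\<And>g. g \<in> G \<Longrightarrow> (\<lambda>t. t + 1/2) \<circ> g \<circ> (\<lambda>t. t + - (1/2)) \<in> G"
    "\<And>g. g \<in> G \<Longrightarrow> (\<lambda>t. t + - (1/2)) \<circ> g \<circ> (\<lambda>t. t + 1/2) \<in> G"
    and Tsupp: "Tsupp M 0 1 \<subseteq> G"
  shows "Tsupp M (of_int j / 2) (of_int j / 2 + 1) \<subseteq> G"
proof
  fix g assume g: "g \<in> Tsupp M (of_int j / 2) (of_int j / 2 + 1)"
  define tr where "tr k = (\<lambda>t::real. t + of_int k / 2)" for k :: int
  have *: "tr (int n) \<circ> f \<circ> tr (- int n) \<in> G \<and> tr (- int n) \<circ> f \<circ> tr (int n) \<in> G" if "f \<in> G" for f n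
  proof (induction n)
    case 0
    then show ?case using that by (simp add: tr_def comp_def)
  next
    case (Suc n)
    have "(\<lambda>t. t + 1/2) \<circ> (tr (int n) \<circ> f \<circ> tr (- int n)) \<circ> (\<lambda>t. t + - (1/2)) = tr (int (Suc n)) \<circ> f \<circ> tr (- int (Suc n))"
      "(\<lambda>t. t + - (1/2)) \<circ> (tr (- int n) \<circ> f \<circ> tr (int n)) \<circ> (\<lambda>t. t + 1/2) = tr (- int (Suc n)) \<circ> f \<circ> tr (int (Suc n))"
      by (auto simp: tr_def fun_eq_iff add_divide_distrib diff_divide_distrib algebra_simps)
    then show ?case using G Suc by metis
  qed
  have "(\<lambda>t. t + - (of_int j / 2)) \<circ> g \<circ> (\<lambda>t. t + of_int j / 2) \<in> Tsupp M 0 1"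
    using Tsupp_shift[OF g, of "of_int j / 2"] by simp
  then have f: "tr (- j) \<circ> g \<circ> tr j \<in> G" using Tsupp by (auto simp: tr_def)
  have "tr j \<circ> (tr (- j) \<circ> g \<circ> tr j) \<circ> tr (- j) \<in> G"
    using *[OF f, of "nat \<bar>j\<bar>"] by (cases "j \<ge> 0") auto
  moreover have "tr j \<circ> (tr (- j) \<circ> g \<circ> tr j) \<circ> tr (- j) = g" by (auto simp: tr_def fun_eq_iff)
  ultimately show "g \<in> G" by simp
qed

section \<open>All one-sided germs\<close>

text \<open>The periodic repetition of \<open>Psi k\<close> on the negative half line, and the identity on the other one.\<close>

definition left_repeat :: "(real \<Rightarrow> real) \<Rightarrow> real \<Rightarrow> real"
  where "left_repeat k = blocks (\<lambda>q. if q < 0 then k else id)"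

text \<open>The translation by \<open>1/2\<close> near minus infinity and the identity on the positive half line. Its conjugate under \<open>psi\<close> has as its right germ at
  \<open>0\<close> a square root of doubling.\<close>

definition left_half_shift :: "real \<Rightarrow> real"
  where "left_half_shift = glue (-1) (\<lambda>t. t + 1/2) (glue 0 (\<lambda>t. t / 2) id)"

lemma id_trans_ends: "id \<in> trans_ends"
  by (rule fun_groupD(1)[OF fun_group_trans_ends])

lemma left_repeat_comp: "left_repeat (f \<circ> g) = left_repeat f \<circ> left_repeat g"
  unfolding left_repeat_def blocks_comp by (rule arg_cong[of _ _ blocks]) auto

lemma left_repeat_inv:
  assumes "f \<in> rhomeo" shows "left_repeat (inv f) = inv (left_repeat f)"
proof -
  have "inv (left_repeat f) = blocks (\<lambda>q. inv (if q < 0 then f else id))"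
    unfolding left_repeat_def by (rule blocks_inv) (use assms in auto)
  also have "\<dots> = left_repeat (inv f)" unfolding left_repeat_def by (rule arg_cong[of _ _ blocks]) (auto simp: inv_id)
  finally show ?thesis ..
qed

lemma left_repeat_id: "left_repeat id = id"
  unfolding left_repeat_def by (simp add: blocks_id)

lemma left_repeat_neg: "x \<le> 0 \<Longrightarrow> left_repeat k x = blocks (\<lambda>q. k) x"
proof (cases "x = 0")
  case False
  moreover assume "x \<le> 0"
  ultimately have "\<lfloor>x\<rfloor> < 0" by simp
  then show ?thesis by (simp add: left_repeat_def blocks_def)
qed (simp add: left_repeat_def blocks_def)

lemma left_repeat_pos: "x \<ge> 0 \<Longrightarrow> left_repeat k x = x"
  by (simp add: left_repeat_def blocks_def Psi_id)

lemma left_repeat_equi_ends: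
  assumes "k \<in> trans_ends" shows "left_repeat k \<in> equi_ends"
proof -
  have "left_repeat k \<in> plh" unfolding left_repeat_def by (rule blocks_plh) (use assms id_trans_ends in auto)
  moreover have "left_repeat k (x - 1) = left_repeat k x - 1" if "x \<le> 0" for x
    using blocks_add[of "\<lambda>q. k" "x - 1" 1] that by (simp add: left_repeat_neg)
  then have "left_equi (left_repeat k)" unfolding left_equi_def by blast
  moreover have "left_equi (refl_fun (left_repeat k))" unfolding left_equi_def
    by (intro exI[of _ 0]) (auto simp: refl_fun_def left_repeat_pos)
  ultimately show ?thesis by (simp add: equi_ends_def)
qed

lemma left_half_shift_le: "x \<le> -1 \<Longrightarrow> left_half_shift x = x + 1/2"
  and left_half_shift_ge: "x \<ge> 0 \<Longrightarrow> left_half_shift x = x"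
  by (auto simp: left_half_shift_def glue_def)

lemma left_half_shift_equi_ends: "left_half_shift \<in> equi_ends"
proof -
  have h: "1/2 \<in> dyadics" using dyadics_divide_2[of 1] by simp
  have "(\<lambda>t. t / 2) \<in> plh" using plh_affine[of 0 "-1"] by (simp add: power_int_minus field_simps)
  then have "left_half_shift \<in> plh" unfolding left_half_shift_def using plh_add[OF h]
    by (intro glue_plh) auto
  moreover have "left_equi left_half_shift" unfolding left_equi_def
    by (intro exI[of _ "-1"]) (auto simp: left_half_shift_le)
  moreover have "left_equi (refl_fun left_half_shift)" unfolding left_equi_def
    by (intro exI[of _ 0]) (auto simp: refl_fun_def left_half_shift_ge)
  ultimately show ?thesis by (simp add: equi_ends_def)
qed

text \<open>The periodic maps that agree near minus infinity with an element of \<open>N\<close> that is trivial near plus infinity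
  form a group \<open>R\<close>. It contains the unit translation by the hypothesis on \<open>s\<close>. Applied to the group of all \<open>k\<close> with
  \<open>left_repeat k\<close> in \<open>N\<close>, \<open>normal_contains_compactly_supported\<close> shows that \<open>R\<close> contains all maps supported in the
  unit interval, and conjugation by \<open>left_half_shift\<close> acts on \<open>R\<close> as conjugation by the translation by \<open>1/2\<close>. So \<open>lifts_T_generated\<close>
  with \<open>M = 1\<close> gives all of \<open>lifts_T 1\<close>.\<close>

lemma all_left_germs:
  assumes N: "fun_group N" "N \<subseteq> rhomeo"
    and s: "s \<in> N" "\<exists>C. \<forall>x\<le>C. s x = x + 1" "\<exists>C. \<forall>x\<ge>C. s x = x"
    and nt: "\<And>n. n \<in> N \<Longrightarrow> left_repeat tau \<circ> n \<circ> inv (left_repeat tau) \<in> N" "\<And>n. n \<in> N \<Longrightarrow> inv (left_repeat tau) \<circ> n \<circ> left_repeat tau \<in> N"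
    and nl: "\<And>n. n \<in> N \<Longrightarrow> left_repeat stretch \<circ> n \<circ> inv (left_repeat stretch) \<in> N" "\<And>n. n \<in> N \<Longrightarrow> inv (left_repeat stretch) \<circ> n \<circ> left_repeat stretch \<in> N"
    and nz: "\<And>n. n \<in> N \<Longrightarrow> left_half_shift \<circ> n \<circ> inv left_half_shift \<in> N" "\<And>n. n \<in> N \<Longrightarrow> inv left_half_shift \<circ> n \<circ> left_half_shift \<in> N"
    and comm: "left_repeat tau \<circ> left_repeat stretch \<circ> inv (left_repeat tau) \<circ> inv (left_repeat stretch) \<in> N"
    and g: "g \<in> lifts_T 1"
  shows "\<exists>h\<in>N. (\<exists>C. \<forall>x\<le>C. h x = g x) \<and> (\<exists>C. \<forall>x\<ge>C. h x = x)"
proof -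
  define R where "R = {g \<in> lifts_T 1. \<exists>h\<in>N. (\<exists>C. \<forall>x\<le>C. h x = g x) \<and> (\<exists>C. \<forall>x\<ge>C. h x = x)}"
  have RI: "g \<in> R" if "g \<in> lifts_T 1" "h \<in> N" "\<And>x. x \<le> C \<Longrightarrow> h x = g x" "\<And>x. x \<ge> D \<Longrightarrow> h x = x" for g h C D
    using that unfolding R_def by blast
  have RE: "\<exists>h C D. g \<in> lifts_T 1 \<and> h \<in> N \<and> (\<forall>x\<le>C. h x = g x) \<and> (\<forall>x\<ge>D. h x = x)" if "g \<in> R" for g
    using that unfolding R_def by blast
  have Tr: "g \<in> rhomeo" if "g \<in> lifts_T 1" for g using lifts_T_plh[OF that] by simp
  have "fun_group R" unfolding fun_group_def
  proof (intro conjI ballI)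
    show "id \<in> R" by (rule RI[of id id 0 0]) (use fun_groupD(1)[OF fun_group_lifts_T] fun_groupD(1)[OF N(1)] in auto)
    fix f assume "f \<in> R"
    then obtain h C D where f: "f \<in> lifts_T 1" "h \<in> N" "\<And>x. x \<le> C \<Longrightarrow> h x = f x" "\<And>x. x \<ge> D \<Longrightarrow> h x = x"
      using RE by blast
    have hr: "h \<in> rhomeo" using f N by auto
    show "inv f \<in> R"
    proof (rule RI[of "inv f" "inv h" "f C" D])
      show "inv h x = inv f x" if "x \<le> f C" for x
      proof -
        have "inv f x \<le> C" using that rhomeo_le[OF Tr[OF f(1)], of "inv f x" C] Tr[OF f(1)] by simp
        then show ?thesis using f(3)[of "inv f x"] rhomeo_inv_eq[OF hr] Tr[OF f(1)] by simp
      qed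
      show "inv h x = x" if "x \<ge> D" for x using f(4)[OF that] rhomeo_inv_eq[OF hr] by simp
    qed (use f fun_groupD(3)[OF fun_group_lifts_T] fun_groupD(3)[OF N(1)] in auto)
    fix f2 assume "f2 \<in> R"
    then obtain h2 C2 D2 where f2: "f2 \<in> lifts_T 1" "h2 \<in> N" "\<And>x. x \<le> C2 \<Longrightarrow> h2 x = f2 x" "\<And>x. x \<ge> D2 \<Longrightarrow> h2 x = x"
      using RE by blast
    show "f \<circ> f2 \<in> R"
    proof (rule RI[of "f \<circ> f2" "h \<circ> h2" "min C2 (inv f2 C)" "max D D2"])
      show "(h \<circ> h2) x = (f \<circ> f2) x" if "x \<le> min C2 (inv f2 C)" for x
      proof -
        have "f2 x \<le> C" using that rhomeo_le[OF Tr[OF f2(1)], of x "inv f2 C"] Tr[OF f2(1)] by simp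
        then show ?thesis using f(3)[of "f2 x"] f2(3)[of x] that by simp
      qed
      show "(h \<circ> h2) x = x" if "x \<ge> max D D2" for x using that f(4)[of x] f2(4)[of x] by simp
      show "f \<circ> f2 \<in> lifts_T 1" using f f2 by (intro fun_groupD[OF fun_group_lifts_T])
      show "h \<circ> h2 \<in> N" using f f2 by (intro fun_groupD[OF N(1)])
    qed
  qed
  moreover have "(\<lambda>t. t + 1) \<in> R"
  proof -
    obtain C D where "\<And>x. x \<le> C \<Longrightarrow> s x = x + 1" "\<And>x. x \<ge> D \<Longrightarrow> s x = x" using s by blast
    moreover have "(\<lambda>t. t + 1) \<in> lifts_T 1" by (simp add: lifts_T_def)
    ultimately show ?thesis using s(1) by (intro RI[of "\<lambda>t. t + 1" s C D]) auto
  qed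
  moreover have "Tsupp 1 (of_int j / 2) (of_int j / 2 + 1) \<subseteq> R" for j
  proof (rule Tsupp_half_shifts)
    define N2 where "N2 = {k \<in> trans_ends. left_repeat k \<in> N}"
    have FRr: "k \<in> rhomeo" if "k \<in> trans_ends" for k using that by (auto simp: trans_ends_def)
    have N2: "fun_group N2" unfolding fun_group_def N2_def
      using fun_groupD[OF fun_group_trans_ends] fun_groupD[OF N(1)] by (auto simp: left_repeat_comp left_repeat_inv FRr left_repeat_id)
    have N2r: "N2 \<subseteq> rhomeo" using FRr by (auto simp: N2_def)
    have conj: "p \<circ> n \<circ> inv p \<in> N2" "inv p \<circ> n \<circ> p \<in> N2"
      if "n \<in> N2" "p \<in> trans_ends" "\<And>n. n \<in> N \<Longrightarrow> left_repeat p \<circ> n \<circ> inv (left_repeat p) \<in> N" "\<And>n. n \<in> N \<Longrightarrow> inv (left_repeat p) \<circ> n \<circ> left_repeat p \<in> N" for n p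
    proof -
      have "p \<circ> n \<circ> inv p \<in> trans_ends" "inv p \<circ> n \<circ> p \<in> trans_ends" using that fun_group_trans_ends by (auto simp: N2_def intro!: fun_groupD)
      then show "p \<circ> n \<circ> inv p \<in> N2" "inv p \<circ> n \<circ> p \<in> N2"
        using that by (auto simp: N2_def left_repeat_comp left_repeat_inv FRr)
    qed
    have c2: "tau \<circ> stretch \<circ> inv tau \<circ> inv stretch \<in> N2"
    proof -
      have "tau \<circ> stretch \<circ> inv tau \<circ> inv stretch \<in> trans_ends" using tau_trans_ends stretch_trans_ends fun_group_trans_ends by (intro fun_groupD)
      then show ?thesis using comm by (simp add: N2_def left_repeat_comp left_repeat_inv FRr tau_trans_ends stretch_trans_ends)
    qed
    show "Tsupp 1 0 1 \<subseteq> R"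
    proof
      fix f assume f: "f \<in> Tsupp 1 0 1"
      obtain k c where k: "k \<in> plh" "\<And>t. \<bar>t\<bar> \<ge> c \<Longrightarrow> k t = t" "\<And>t. 0 \<le> t \<Longrightarrow> t \<le> 1 \<Longrightarrow> Psi k t = f t"
        using Tsupp_block[OF f] by (metis order_refl)
      have kFR: "k \<in> trans_ends" by (rule trans_ends_compactly_supported[OF k(1,2)])
      have "k \<in> N2"
        by (rule normal_contains_compactly_supported[OF N2 N2r _ _ _ _ c2 k(1) k(2)])
          (use conj[OF _ tau_trans_ends nt] conj[OF _ stretch_trans_ends nl] in auto)
      then have kN: "left_repeat k \<in> N" by (simp add: N2_def)
      have "blocks (\<lambda>q. k) \<in> lifts_T 1" using blocks_lifts_T[of "\<lambda>q. k" 1] kFR by simp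
      then have "f = blocks (\<lambda>q. k)"
        by (intro lifts_T_ext[OF Tsupp_lifts_T[OF f], where a = 0]) (auto simp: blocks_eq[of 0] k(3))
      then show "f \<in> R" using Tsupp_lifts_T[OF f] kN left_repeat_neg left_repeat_pos by (intro RI[of f "left_repeat k" 0 0]) auto
    qed
    have half: "1/2 \<in> dyadics" using dyadics_divide_2[of 1] by simp
    have Zr: "left_half_shift \<in> rhomeo" using equi_ends_plh[OF left_half_shift_equi_ends] by simp
    have iZ: "inv left_half_shift x = x - 1/2" if "x \<le> -1" for x using rhomeo_inv_eq[OF Zr] left_half_shift_le[of "x - 1/2"] that by simp
    have iZ0: "inv left_half_shift x = x" if "x \<ge> 0" for x using rhomeo_inv_eq[OF Zr] left_half_shift_ge[of x] that by simp
    fix f assume "f \<in> R"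
    then obtain h C D where f: "f \<in> lifts_T 1" "h \<in> N" "\<And>x. x \<le> C \<Longrightarrow> h x = f x" "\<And>x. x \<ge> D \<Longrightarrow> h x = x"
      using RE by blast
    have fr: "f \<in> rhomeo" by (rule Tr[OF f(1)])
    have tT: "(\<lambda>t. t + 1/2) \<in> lifts_T 1" "(\<lambda>t. t + - (1/2)) \<in> lifts_T 1"
      using plh_add[OF half] plh_add[OF dyadics_minus[OF half]] by (auto simp: lifts_T_def)
    show "(\<lambda>t. t + 1/2) \<circ> f \<circ> (\<lambda>t. t + - (1/2)) \<in> R"
    proof (rule RI[of _ "left_half_shift \<circ> h \<circ> inv left_half_shift" "min (-1) (min (C + 1/2) (inv f (-1) + 1/2))" "max 0 D"])
      show "(\<lambda>t. t + 1/2) \<circ> f \<circ> (\<lambda>t. t + - (1/2)) \<in> lifts_T 1" using tT f(1) by (intro fun_groupD[OF fun_group_lifts_T])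
      fix x assume x: "x \<le> min (-1) (min (C + 1/2) (inv f (-1) + 1/2))"
      then have "f (x - 1/2) \<le> -1" using rhomeo_le[OF fr, of "x - 1/2" "inv f (-1)"] fr by simp
      then show "(left_half_shift \<circ> h \<circ> inv left_half_shift) x = ((\<lambda>t. t + 1/2) \<circ> f \<circ> (\<lambda>t. t + - (1/2))) x"
        using x iZ[of x] f(3)[of "x - 1/2"] left_half_shift_le by simp
    qed (use nz f(2) f(4) iZ0 left_half_shift_ge in auto)
    show "(\<lambda>t. t + - (1/2)) \<circ> f \<circ> (\<lambda>t. t + 1/2) \<in> R"
    proof (rule RI[of _ "inv left_half_shift \<circ> h \<circ> left_half_shift" "min (-1) (min (C - 1/2) (inv f (-1) - 1/2))" "max 0 D"])
      show "(\<lambda>t. t + - (1/2)) \<circ> f \<circ> (\<lambda>t. t + 1/2) \<in> lifts_T 1" using tT f(1) by (intro fun_groupD[OF fun_group_lifts_T])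
      fix x assume x: "x \<le> min (-1) (min (C - 1/2) (inv f (-1) - 1/2))"
      then have "f (x + 1/2) \<le> -1" using rhomeo_le[OF fr, of "x + 1/2" "inv f (-1)"] fr by simp
      then show "(inv left_half_shift \<circ> h \<circ> left_half_shift) x = ((\<lambda>t. t + - (1/2)) \<circ> f \<circ> (\<lambda>t. t + 1/2)) x"
        using x iZ f(3)[of "x + 1/2"] left_half_shift_le[of x] by simp
    qed (use nz f(2) f(4) iZ0 left_half_shift_ge in auto)
  qed
  ultimately have "lifts_T 1 \<subseteq> R" by (intro lifts_T_generated[of 1]) auto
  then show ?thesis using g by (auto simp: R_def)
qed

section \<open>The group of lifts\<close>

text \<open>At a singular point \<open>x\<close>, commuting with doubling gives \<open>f x = 2 f (x + t) - f (x + 2 t)\<close>, and for small dyadic \<open>t\<close>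
  both values on the right are dyadic, because \<open>f\<close> is regular there.\<close>

lemma loc_dyadic:
  assumes "loc f x" shows "f x \<in> dyadics \<longleftrightarrow> x \<in> dyadics"
proof (cases "x \<in> dyadics")
  case False
  then have "reg f x" using assms by (simp add: loc_def)
  then show ?thesis by (rule reg_dyadic)
next
  case True
  obtain e where e: "e > 0" "\<And>y. 0 < \<bar>y - x\<bar> \<Longrightarrow> \<bar>y - x\<bar> < e \<Longrightarrow> reg f y"
    using assms by (auto simp: loc_def)
  obtain d where d: "d > 0" "\<And>t. \<bar>t\<bar> < d \<Longrightarrow> f (x + 2 * t) - f x = 2 * (f (x + t) - f x)"
    using assms True by (auto simp: loc_def dbl_def)
  obtain t where t: "t \<in> dyadics" "0 < t" "t < min (e / 2) d"
    using dyadics_dense[of 0 "min (e / 2) d"] e d by auto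
  have "reg f (x + t)" "reg f (x + 2 * t)" using t by (auto intro!: e(2))
  moreover have "x + t \<in> dyadics" "x + 2 * t \<in> dyadics" using True t by auto
  ultimately have "f (x + t) \<in> dyadics" "f (x + 2 * t) \<in> dyadics" using reg_dyadic by blast+
  then have "2 * f (x + t) - f (x + 2 * t) \<in> dyadics" by auto
  moreover have "f x = 2 * f (x + t) - f (x + 2 * t)" using d(2)[of t] t by auto
  ultimately show ?thesis using True by simp
qed

lemma loc_comp:
  assumes g: "g \<in> rhomeo" "loc g x" and f: "loc f (g x)"
  shows "loc (f \<circ> g) x"
proof -
  obtain e where e: "e > 0" "\<And>y. 0 < \<bar>y - x\<bar> \<Longrightarrow> \<bar>y - x\<bar> < e \<Longrightarrow> reg g y"
    using g by (auto simp: loc_def)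
  obtain d where d: "d > 0" "\<And>y. 0 < \<bar>y - g x\<bar> \<Longrightarrow> \<bar>y - g x\<bar> < d \<Longrightarrow> reg f y"
    using f by (auto simp: loc_def)
  obtain r where r: "0 < r" "r < e" "\<And>t. \<bar>t - x\<bar> \<le> r \<Longrightarrow> g x - d < g t \<and> g t < g x + d"
    using rhomeo_near[OF g(1), of "g x - d" x "g x + d" e] d(1) e(1) by auto
  have "reg (f \<circ> g) y" if "0 < \<bar>y - x\<bar>" "\<bar>y - x\<bar> < r" for y
  proof (rule reg_comp)
    show "reg g y" using that r by (intro e(2)) auto
    have "g y \<noteq> g x" using rhomeo_eq[OF g(1), of y x] that by auto
    then show "reg f (g y)" using r(3)[of y] that by (intro d(2)) auto
  qed
  moreover have "if x \<in> dyadics then dbl (f \<circ> g) x else reg (f \<circ> g) x"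
  proof (cases "x \<in> dyadics")
    case False
    then show ?thesis using g f loc_dyadic[OF g(2)] reg_comp[of g x f] by (simp add: loc_def)
  next
    case True
    then have "dbl g x" "dbl f (g x)" using g f loc_dyadic[OF g(2)] by (auto simp: loc_def)
    then obtain a b where a: "a > 0" "\<And>t. \<bar>t\<bar> < a \<Longrightarrow> g (x + 2 * t) - g x = 2 * (g (x + t) - g x)"
      and b: "b > 0" "\<And>t. \<bar>t\<bar> < b \<Longrightarrow> f (g x + 2 * t) - f (g x) = 2 * (f (g x + t) - f (g x))"
      unfolding dbl_def by blast
    obtain s where s: "0 < s" "s < a" "\<And>t. \<bar>t - x\<bar> \<le> s \<Longrightarrow> g x - b < g t \<and> g t < g x + b"
      using rhomeo_near[OF g(1), of "g x - b" x "g x + b" a] a(1) b(1) by auto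
    have "(f \<circ> g) (x + 2 * t) - (f \<circ> g) x = 2 * ((f \<circ> g) (x + t) - (f \<circ> g) x)" if "\<bar>t\<bar> < s" for t
    proof -
      have "\<bar>g (x + t) - g x\<bar> < b" using s(3)[of "x + t"] that by auto
      moreover have "g (x + 2 * t) = g x + 2 * (g (x + t) - g x)" using a(2)[of t] that s by simp
      ultimately show ?thesis using b(2)[of "g (x + t) - g x"] by simp
    qed
    then show ?thesis using True s(1) unfolding dbl_def by auto
  qed
  ultimately show ?thesis unfolding loc_def using r(1) by blast
qed

lemma loc_inv:
  assumes f: "f \<in> rhomeo" "loc f x"
  shows "loc (inv f) (f x)"
proof -
  obtain e where e: "e > 0" "\<And>y. 0 < \<bar>y - x\<bar> \<Longrightarrow> \<bar>y - x\<bar> < e \<Longrightarrow> reg f y"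
    using f by (auto simp: loc_def)
  have if': "inv f \<in> rhomeo" using f by simp
  obtain r where r: "0 < r" "r < 1" "\<And>t. \<bar>t - f x\<bar> \<le> r \<Longrightarrow> x - e < inv f t \<and> inv f t < x + e"
    using rhomeo_near[OF if', of "x - e" "f x" "x + e" 1] f(1) e(1) by auto
  have "reg (inv f) y" if "0 < \<bar>y - f x\<bar>" "\<bar>y - f x\<bar> < r" for y
  proof (rule reg_inv_rhomeo[OF f(1)])
    have "inv f y \<noteq> x" using that f(1) by auto
    then show "reg f (inv f y)" using r(3)[of y] that by (intro e(2)) auto
  qed
  moreover have "if f x \<in> dyadics then dbl (inv f) (f x) else reg (inv f) (f x)"
  proof (cases "x \<in> dyadics")
    case False
    then show ?thesis using f loc_dyadic[OF f(2)] reg_inv_rhomeo[OF f(1), of "f x"] by (simp add: loc_def)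
  next
    case True
    then have "dbl f x" using f by (auto simp: loc_def)
    then obtain a where a: "a > 0" "\<And>t. \<bar>t\<bar> < a \<Longrightarrow> f (x + 2 * t) - f x = 2 * (f (x + t) - f x)"
      unfolding dbl_def by blast
    obtain s where s: "0 < s" "s < 1" "\<And>t. \<bar>t - f x\<bar> \<le> s \<Longrightarrow> x - a < inv f t \<and> inv f t < x + a"
      using rhomeo_near[OF if', of "x - a" "f x" "x + a" 1] f(1) a(1) by auto
    have "inv f (f x + 2 * t) - inv f (f x) = 2 * (inv f (f x + t) - inv f (f x))" if "\<bar>t\<bar> < s" for t
    proof -
      define u where "u = inv f (f x + t) - x"
      have fu: "f (x + u) = f x + t" using f(1) by (simp add: u_def)
      have "\<bar>u\<bar> < a" using s(3)[of "f x + t"] that by (auto simp: u_def)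
      then have "f (x + 2 * u) = f x + 2 * t" using a(2)[of u] fu by simp
      then have "inv f (f x + 2 * t) = x + 2 * u" using f(1) by (metis rhomeo_inv_f)
      then show ?thesis using f(1) by (simp add: u_def)
    qed
    then show ?thesis using True loc_dyadic[OF f(2)] s(1) unfolding dbl_def by auto
  qed
  ultimately show ?thesis unfolding loc_def using r(1) by blast
qed

lemma lifts_TA_rhomeo: "f \<in> lifts_TA M \<Longrightarrow> f \<in> rhomeo"
  and lifts_TA_loc: "f \<in> lifts_TA M \<Longrightarrow> loc f x"
  and lifts_TA_add: "f \<in> lifts_TA M \<Longrightarrow> f (x + M) = f x + M"
  unfolding lifts_TA_def by blast+

lemma lifts_TA_I: "f \<in> rhomeo \<Longrightarrow> (\<And>x. loc f x) \<Longrightarrow> (\<And>x. f (x + M) = f x + M) \<Longrightarrow> f \<in> lifts_TA M"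
  unfolding lifts_TA_def by blast

lemma fun_group_lifts_TA: "fun_group (lifts_TA M)"
  unfolding fun_group_def
proof (intro conjI ballI)
  show "id \<in> lifts_TA M" using lifts_T_subset_lifts_TA fun_groupD(1)[OF fun_group_lifts_T] by blast
  show "f \<circ> g \<in> lifts_TA M" if "f \<in> lifts_TA M" "g \<in> lifts_TA M" for f g
  proof -
    have "loc (f \<circ> g) x" for x using that by (intro loc_comp lifts_TA_rhomeo lifts_TA_loc)
    moreover have "(f \<circ> g) (x + M) = (f \<circ> g) x + M" for x using lifts_TA_add[OF that(1)] lifts_TA_add[OF that(2)] by simp
    ultimately show ?thesis using rhomeo_comp[OF lifts_TA_rhomeo[OF that(1)] lifts_TA_rhomeo[OF that(2)]] by (intro lifts_TA_I)
  qed
  show "inv f \<in> lifts_TA M" if "f \<in> lifts_TA M" for f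
  proof -
    have r: "f \<in> rhomeo" by (rule lifts_TA_rhomeo[OF that])
    have "loc (inv f) x" for x using loc_inv[OF r lifts_TA_loc[OF that], of "inv f x"] r by simp
    moreover have "inv f (x + M) = inv f x + M" for x by (rule periodic_inv[OF r lifts_TA_add[OF that]])
    ultimately show ?thesis using rhomeo_inv[OF r] by (intro lifts_TA_I)
  qed
qed

text \<open>The local condition makes singular points isolated; compactness does the rest.\<close>

lemma finite_singular:
  assumes "\<And>x. loc f x" "a \<le> b"
  shows "finite {x \<in> {a..b}. \<not> reg f x}"
  using assms(2)
proof (induction rule: Bolzano)
  case (trans a b c)
  have "{x \<in> {a..c}. \<not> reg f x} \<subseteq> {x \<in> {a..b}. \<not> reg f x} \<union> {x \<in> {b..c}. \<not> reg f x}" by auto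
  then show ?case using trans finite_subset by blast
next
  case (local x)
  obtain e where e: "e > 0" "\<And>y. 0 < \<bar>y - x\<bar> \<Longrightarrow> \<bar>y - x\<bar> < e \<Longrightarrow> reg f y"
    using assms(1)[of x] by (auto simp: loc_def)
  have "finite {y \<in> {a..b}. \<not> reg f y}" if "a \<le> x" "x \<le> b" "b - a < e" for a b
  proof (rule finite_subset[of _ "{x}"])
    show "{y \<in> {a..b}. \<not> reg f y} \<subseteq> {x}"
    proof
      fix y assume y: "y \<in> {y \<in> {a..b}. \<not> reg f y}"
      show "y \<in> {x}"
      proof (rule ccontr)
        assume "y \<notin> {x}"
        then have "reg f y" using y that by (intro e(2)) auto
        then show False using y by simp
      qed
    qed
  qed simp
  then show ?case using e(1) by blast
qed

section \<open>Isolating the pieces of a block map\<close>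

text \<open>The \<open>i\<close>-th piece is placed at the blocks congruent to \<open>2^i\<close>. The modulus \<open>2^(n+1)\<close> exceeds every sum of two of
  these positions, so congruences between such sums are equalities.\<close>

definition layout :: "nat \<Rightarrow> (nat \<Rightarrow> real \<Rightarrow> real) \<Rightarrow> int \<Rightarrow> real \<Rightarrow> real"
  where "layout n h q = (if \<exists>i<n. q mod 2 ^ (n + 1) = 2 ^ i then h (THE i. i < n \<and> q mod 2 ^ (n + 1) = 2 ^ i) else id)"

lemma layout_pos: "i < n \<Longrightarrow> q mod 2 ^ (n + 1) = 2 ^ i \<Longrightarrow> layout n h q = h i"
proof -
  assume i: "i < n" "q mod 2 ^ (n + 1) = 2 ^ i"
  then have "(THE i. i < n \<and> q mod 2 ^ (n + 1) = 2 ^ i) = i" by (intro the_equality) auto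
  then show ?thesis using i by (auto simp: layout_def)
qed

lemma layout_cases:
  obtains i where "i < n" "q mod 2 ^ (n + 1) = 2 ^ i" "layout n h q = h i" | "layout n h q = id"
proof (cases "\<exists>i<n. q mod 2 ^ (n + 1) = 2 ^ i")
  case True
  then show ?thesis using that(1) layout_pos[of _ n q h] by metis
next
  case False
  then have "layout n h q = id" unfolding layout_def by (rule if_not_P)
  then show ?thesis by (rule that(2))
qed

lemma layout_equi_ends: "(\<And>i. i < n \<Longrightarrow> h i \<in> equi_ends) \<Longrightarrow> layout n h q \<in> equi_ends"
  using fun_groupD(1)[OF fun_group_equi_ends] by (cases rule: layout_cases[of n q h]) auto

lemma sum_of_two_powers:
  assumes "(2::int) ^ a + 2 ^ b = 2 ^ c + 2 ^ d"
  shows "a = c \<and> b = d \<or> a = d \<and> b = c"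
proof -
  have *: "a = c \<and> b = d" if eq: "(2::int) ^ a + 2 ^ b = 2 ^ c + 2 ^ d" and "a \<le> b" "c \<le> d" for a b c d :: nat
  proof -
    have "(2::int) ^ a \<le> 2 ^ b" "(2::int) ^ c \<le> 2 ^ d" using that by (auto intro: power_increasing)
    moreover have "(0::int) < 2 ^ a" "(0::int) < 2 ^ c" by auto
    ultimately have "(2::int) ^ b < 2 ^ (d + 1)" "(2::int) ^ d < 2 ^ (b + 1)"
      using eq unfolding power_add power_one_right by linarith+
    then have "b < d + 1" "d < b + 1" by (simp_all only: power_strict_increasing_iff one_less_numeral_iff semiring_norm)
    then have "b = d" by simp
    then show ?thesis using eq by simp
  qed
  have e: "(2::int) ^ b + 2 ^ a = 2 ^ c + 2 ^ d" "(2::int) ^ a + 2 ^ b = 2 ^ d + 2 ^ c" "(2::int) ^ b + 2 ^ a = 2 ^ d + 2 ^ c"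
    using assms by linarith+
  show ?thesis
    using *[OF assms] *[OF e(1)] *[OF e(2)] *[OF e(3)] by (meson nat_le_linear)
qed

text \<open>If the translates by \<open>2^i\<close> and \<open>2^j\<close> both have a piece at block \<open>q\<close>, say the \<open>l\<close>-th and the \<open>m\<close>-th one, then
  \<open>2^l + 2^j = 2^m + 2^i\<close>. As \<open>i \<noteq> j\<close>, this forces \<open>l = i\<close>, and then \<open>q\<close> is divisible by the modulus.\<close>

lemma layout_overlap:
  assumes ij: "i < n" "j < n" "i \<noteq> j"
    and l: "l < n" "(q + 2 ^ i) mod 2 ^ (n + 1) = (2::int) ^ l"
    and m: "m < n" "(q + 2 ^ j) mod 2 ^ (n + 1) = (2::int) ^ m"
  shows "2 ^ (n + 1) dvd q"
proof -
  let ?M = "(2::int) ^ (n + 1)"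
  have le: "(2::int) ^ k * 2 \<le> 2 ^ n" if "k < n" for k
  proof -
    have "(2::int) ^ (k + 1) \<le> 2 ^ n" using that by (intro power_increasing) auto
    then show ?thesis by simp
  qed
  have pos: "(0::int) < 2 ^ k" for k by simp
  have "(2 ^ l + 2 ^ j) mod ?M = (q + 2 ^ i + 2 ^ j) mod ?M" unfolding l(2)[symmetric] by (simp add: mod_add_left_eq)
  also have "\<dots> = (q + 2 ^ j + 2 ^ i) mod ?M" by (simp add: ac_simps)
  also have "\<dots> = (2 ^ m + 2 ^ i) mod ?M" unfolding m(2)[symmetric] by (simp add: mod_add_left_eq)
  finally have eq: "(2 ^ l + 2 ^ j) mod ?M = (2 ^ m + 2 ^ i) mod ?M" .
  have "?M = 2 ^ n + 2 ^ n" by simp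
  then have "0 \<le> (2::int) ^ l + 2 ^ j" "2 ^ l + 2 ^ j < ?M" "0 \<le> (2::int) ^ m + 2 ^ i" "2 ^ m + 2 ^ i < ?M"
    using le[OF l(1)] le[OF m(1)] le[OF ij(1)] le[OF ij(2)] pos[of l] pos[of m] pos[of i] pos[of j] by linarith+
  then have "(2::int) ^ l + 2 ^ j = 2 ^ m + 2 ^ i" using eq by simp
  then have "l = i" using sum_of_two_powers[of l j m i] ij by auto
  then have "(q + 2 ^ i) mod ?M = 2 ^ i mod ?M" using l(2) by (metis mod_mod_trivial)
  then have "(q + 2 ^ i - 2 ^ i) mod ?M = (2 ^ i - 2 ^ i) mod ?M" by (rule mod_diff_cong) simp
  then show ?thesis by (simp add: mod_eq_0_iff_dvd)
qed

text \<open>The copy of \<open>x\<close> in block \<open>0\<close> of the circle of length \<open>2^(n+1)\<close>.\<close>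

definition single_block :: "nat \<Rightarrow> (real \<Rightarrow> real) \<Rightarrow> real \<Rightarrow> real"
  where "single_block n x = blocks (\<lambda>q. if 2 ^ (n + 1) dvd q then x else id)"

lemma single_block_comp: "single_block n (x \<circ> y) = single_block n x \<circ> single_block n y"
  unfolding single_block_def blocks_comp by (rule arg_cong[of _ _ blocks]) auto

lemma single_block_id: "single_block n id = id"
  unfolding single_block_def by (simp add: blocks_id)

lemma single_block_inv:
  assumes "x \<in> rhomeo" shows "single_block n (inv x) = inv (single_block n x)"
proof -
  have "inv (single_block n x) = blocks (\<lambda>q. inv (if 2 ^ (n + 1) dvd q then x else id))"
    unfolding single_block_def by (rule blocks_inv) (use assms in auto)
  also have "\<dots> = single_block n (inv x)" unfolding single_block_def by (rule arg_cong[of _ _ blocks]) (auto simp: inv_id)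
  finally show ?thesis ..
qed

lemma single_block_eq: "0 \<le> t \<Longrightarrow> t \<le> 1 \<Longrightarrow> single_block n x t = Psi x t"
  by (simp add: single_block_def blocks_eq[of 0])

lemma single_block_out:
  assumes "1 \<le> t" "t \<le> 2 ^ (n + 1)" shows "single_block n x t = t"
proof (cases "t = 2 ^ (n + 1)")
  case True
  then have "single_block n x t = single_block n x (of_int (2 ^ (n + 1)))" by simp
  also have "\<dots> = of_int (2 ^ (n + 1))" unfolding single_block_def blocks_def by simp
  finally show ?thesis using True by simp
next
  case False
  have "\<not> (2::int) ^ (n + 1) dvd \<lfloor>t\<rfloor>"
  proof
    assume "(2::int) ^ (n + 1) dvd \<lfloor>t\<rfloor>"
    moreover have "\<lfloor>t\<rfloor> > 0" using assms by simp
    ultimately have "2 ^ (n + 1) \<le> \<lfloor>t\<rfloor>" by (rule zdvd_imp_le)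
    then have "real_of_int (2 ^ (n + 1)) \<le> t" by (simp only: le_floor_iff)
    then show False using assms False by simp
  qed
  then show ?thesis by (simp add: single_block_def blocks_def Psi_id)
qed

lemma single_block_lifts_TA: "x \<in> equi_ends \<Longrightarrow> single_block n x \<in> lifts_TA (2 ^ (n + 1))"
  using blocks_lifts_TA[of "\<lambda>q. if 2 ^ (n + 1) dvd q then x else id" "2 ^ (n + 1)"] fun_groupD(1)[OF fun_group_equi_ends] unfolding single_block_def by simp

lemma blocks_conj:
  "(\<lambda>t. t + of_int (- k)) \<circ> blocks \<eta> \<circ> (\<lambda>t. t + of_int k) = blocks (\<lambda>q. \<eta> (q + k))"
  by (auto simp: fun_eq_iff blocks_add)

lemma equi_ends_rhomeo: "h \<in> equi_ends \<Longrightarrow> h \<in> rhomeo"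
  using equi_ends_plh by auto

text \<open>\<open>G\<close> stands for the set of lifts whose induced circle maps belong to the group generated by the two generators.\<close>

locale generated_lifts =
  fixes n :: nat and h :: "nat \<Rightarrow> real \<Rightarrow> real" and G :: "(real \<Rightarrow> real) set"
  assumes h: "\<And>i. i < n \<Longrightarrow> h i \<in> equi_ends"
    and G: "fun_group G" "(\<lambda>t. t + 1/2) \<in> G" "blocks (layout n h) \<in> G"
begin

definition N :: "(real \<Rightarrow> real) set" where "N = {x \<in> equi_ends. single_block n x \<in> G}"

lemma int_translation: "(\<lambda>t. t + of_int k) \<in> G"
proof -
  have "(\<lambda>t. t + 1/2 * of_int (2 * k)) \<in> G" by (rule fun_group_translation[OF G(1,2)])
  then show ?thesis by simp
qed

lemma shifted: "blocks (\<lambda>q. layout n h (q + k)) \<in> G"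
  unfolding blocks_conj[symmetric] by (intro fun_groupD[OF G(1)] int_translation G(3))

lemma layout_rhomeo: "layout n h q \<in> rhomeo"
  by (rule equi_ends_rhomeo[OF layout_equi_ends[OF h]])

lemma N_rhomeo: "N \<subseteq> rhomeo"
  by (auto simp: N_def equi_ends_rhomeo)

lemma fun_group_N: "fun_group N"
  unfolding fun_group_def
proof (intro conjI ballI)
  show "id \<in> N" using fun_groupD(1)[OF fun_group_equi_ends] fun_groupD(1)[OF G(1)] unfolding N_def mem_Collect_eq single_block_id by blast
  show "f \<circ> g \<in> N" if "f \<in> N" "g \<in> N" for f g
    using that fun_groupD(2)[OF fun_group_equi_ends] fun_groupD(2)[OF G(1)] unfolding N_def mem_Collect_eq single_block_comp by blast
  show "inv f \<in> N" if "f \<in> N" for f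
    using that fun_groupD(3)[OF fun_group_equi_ends] fun_groupD(3)[OF G(1)] single_block_inv[of f] equi_ends_rhomeo unfolding N_def mem_Collect_eq by auto
qed

lemma layout_at: "i < n \<Longrightarrow> 2 ^ (n + 1) dvd q \<Longrightarrow> layout n h (q + 2 ^ i) = h i"
proof -
  assume i: "i < n" "(2::int) ^ (n + 1) dvd q"
  have "(2::int) ^ i < 2 ^ (n + 1)" using i by (intro power_strict_increasing) auto
  then have "(q + 2 ^ i) mod 2 ^ (n + 1) = 2 ^ i" using i(2) by (auto simp: mod_pos_pos_trivial elim!: dvdE)
  then show ?thesis by (rule layout_pos[OF i(1)])
qed

text \<open>On block \<open>0\<close> the shifted generator acts by the \<open>i\<close>-th piece, and \<open>single_block n x\<close> is trivial on all other blocks.\<close>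

lemma N_conj:
  assumes "i < n" "x \<in> N"
  shows "h i \<circ> x \<circ> inv (h i) \<in> N" "inv (h i) \<circ> x \<circ> h i \<in> N"
proof -
  let ?A = "blocks (\<lambda>q. layout n h (q + 2 ^ i))"
  have x: "x \<in> equi_ends" "single_block n x \<in> G" using assms by (auto simp: N_def)
  have iA: "inv ?A = blocks (\<lambda>q. inv (layout n h (q + 2 ^ i)))" by (rule blocks_inv) (rule layout_rhomeo)
  have l: "layout n h q \<circ> id \<circ> inv (layout n h q) = id" "inv (layout n h q) \<circ> id \<circ> layout n h q = id" for q
    using rhomeo_inv_comp[OF layout_rhomeo[of q]] by (simp_all only: comp_id id_comp)
  have c: "layout n h (q + 2 ^ i) \<circ> (if 2 ^ (n + 1) dvd q then x else id) \<circ> inv (layout n h (q + 2 ^ i))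
      = (if 2 ^ (n + 1) dvd q then h i \<circ> x \<circ> inv (h i) else id)"
    "inv (layout n h (q + 2 ^ i)) \<circ> (if 2 ^ (n + 1) dvd q then x else id) \<circ> layout n h (q + 2 ^ i)
      = (if 2 ^ (n + 1) dvd q then inv (h i) \<circ> x \<circ> h i else id)" for q
    by (cases "2 ^ (n + 1) dvd q"; simp only: layout_at[OF assms(1)] l if_True if_False)+
  have "?A \<circ> single_block n x \<circ> inv ?A = single_block n (h i \<circ> x \<circ> inv (h i))"
    unfolding iA single_block_def blocks_comp c by (rule refl)
  moreover have "inv ?A \<circ> single_block n x \<circ> ?A = single_block n (inv (h i) \<circ> x \<circ> h i)"
    unfolding iA single_block_def blocks_comp c by (rule refl)
  moreover have "?A \<circ> single_block n x \<circ> inv ?A \<in> G" "inv ?A \<circ> single_block n x \<circ> ?A \<in> G"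
    by (intro fun_groupD(2,3)[OF G(1)] shifted x(2))+
  moreover have "h i \<circ> x \<circ> inv (h i) \<in> equi_ends" "inv (h i) \<circ> x \<circ> h i \<in> equi_ends"
    by (intro fun_groupD(2,3)[OF fun_group_equi_ends] h assms(1) x(1))+
  ultimately show "h i \<circ> x \<circ> inv (h i) \<in> N" "inv (h i) \<circ> x \<circ> h i \<in> N" by (simp_all only: N_def mem_Collect_eq)
qed

text \<open>By \<open>layout_overlap\<close> one of the two shifted generators is trivial on every block other than \<open>0\<close>.\<close>

lemma N_comm:
  assumes ij: "i < n" "j < n" "i \<noteq> j"
  shows "h i \<circ> h j \<circ> inv (h i) \<circ> inv (h j) \<in> N"
proof -
  let ?A = "\<lambda>i. blocks (\<lambda>q. layout n h (q + 2 ^ i))"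
  have iA: "inv (?A i) = blocks (\<lambda>q. inv (layout n h (q + 2 ^ i)))" for i by (rule blocks_inv) (rule layout_rhomeo)
  have "layout n h (q + 2 ^ i) \<circ> layout n h (q + 2 ^ j) \<circ> inv (layout n h (q + 2 ^ i)) \<circ> inv (layout n h (q + 2 ^ j))
    = (if 2 ^ (n + 1) dvd q then h i \<circ> h j \<circ> inv (h i) \<circ> inv (h j) else id)" for q
  proof (cases "2 ^ (n + 1) dvd q")
    case True
    then show ?thesis using layout_at ij by simp
  next
    case False
    have "layout n h (q + 2 ^ i) = id \<or> layout n h (q + 2 ^ j) = id"
      using layout_overlap[OF ij] False layout_cases[of n "q + 2 ^ i" h] layout_cases[of n "q + 2 ^ j" h] by metis
    then show ?thesis using False rhomeo_inv_comp[OF layout_rhomeo[of "q + 2 ^ i"]] rhomeo_inv_comp[OF layout_rhomeo[of "q + 2 ^ j"]]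
      by (elim disjE) (simp_all only: inv_id comp_id id_comp if_False)
  qed
  then have "?A i \<circ> ?A j \<circ> inv (?A i) \<circ> inv (?A j) = single_block n (h i \<circ> h j \<circ> inv (h i) \<circ> inv (h j))"
    unfolding iA single_block_def blocks_comp by (simp only:)
  moreover have "?A i \<circ> ?A j \<circ> inv (?A i) \<circ> inv (?A j) \<in> G"
    by (intro fun_groupD(2,3)[OF G(1)] shifted)
  moreover have "h i \<circ> h j \<circ> inv (h i) \<circ> inv (h j) \<in> equi_ends"
    by (intro fun_groupD(2,3)[OF fun_group_equi_ends] h ij(1,2))
  ultimately show ?thesis by (simp only: N_def mem_Collect_eq)
qed

abbreviation M :: real where "M \<equiv> 2 ^ (n + 1)"

lemma single_block_lifts_T: "x \<in> trans_ends \<Longrightarrow> single_block n x \<in> lifts_T M"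
  using blocks_lifts_T[of "\<lambda>q. if 2 ^ (n + 1) dvd q then x else id" "2 ^ (n + 1)"] id_trans_ends unfolding single_block_def by simp

lemma lifts_T_subset:
  assumes t: "i < n" "j < n" "i \<noteq> j" "h i = tau" "h j = stretch"
  shows "lifts_T M \<subseteq> G"
proof -
  have M1: "M \<ge> 1" by (rule one_le_power) simp
  have Fc: "k \<in> N" if "k \<in> plh" "\<And>t. \<bar>t\<bar> \<ge> c \<Longrightarrow> k t = t" for k c
    by (rule normal_contains_compactly_supported[OF fun_group_N N_rhomeo _ _ _ _ _ that])
      (use N_conj[OF t(1), unfolded t] N_conj[OF t(2), unfolded t] N_comm[OF t(1-3), unfolded t] in \<open>simp_all only:\<close>)
  have "Tsupp M 0 1 \<subseteq> G"
  proof
    fix g assume g: "g \<in> Tsupp M 0 1"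
    obtain k c where k: "k \<in> plh" "\<And>t. \<bar>t\<bar> \<ge> c \<Longrightarrow> k t = t" "\<And>t. 0 \<le> t \<Longrightarrow> t \<le> 1 \<Longrightarrow> Psi k t = g t"
      "\<And>t. 1 \<le> t \<Longrightarrow> t \<le> M \<Longrightarrow> g t = t" using Tsupp_block[OF g M1] by metis
    have kFR: "k \<in> trans_ends" by (rule trans_ends_compactly_supported[OF k(1,2)])
    have kN: "k \<in> N" by (rule Fc[OF k(1,2)])
    have "g = single_block n k"
    proof (rule lifts_T_ext[OF Tsupp_lifts_T[OF g] single_block_lifts_T[OF kFR], where a = 0])
      fix t :: real assume t: "0 \<le> t" "t < 0 + M"
      show "g t = single_block n k t"
      proof (cases "t < 1")
        case True
        then show ?thesis using t k(3)[of t] by (simp add: single_block_eq)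
      next
        case False
        then have "single_block n k t = t" using t by (intro single_block_out) auto
        then show ?thesis using k(4)[of t] t False by simp
      qed
    qed (use M1 in linarith)
    then show "g \<in> G" using kN by (simp add: N_def)
  qed
  moreover have m: "(\<lambda>t. t + - (1/2)) \<in> G" using fun_group_translation[OF G(1,2), of "-1"] by simp
  ultimately have "Tsupp M (of_int j / 2) (of_int j / 2 + 1) \<subseteq> G" for j
    by (intro Tsupp_half_shifts fun_groupD(2)[OF G(1)] G(2) m)
  moreover have "(\<lambda>t. t + M) \<in> G" using int_translation[of "2 ^ (n + 1)"] by simp
  ultimately show ?thesis by (intro lifts_T_generated[of "2 ^ (n + 1)" M G]) (use G M1 in auto)
qed

end

section \<open>Removing singular germs\<close>

lemma left_equi_iterate:
  assumes "\<And>x. x \<le> C \<Longrightarrow> h (x - 1) = h x - 1" "x \<le> C"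
  shows "h (x - real j) = h x - real j"
proof (induction j)
  case (Suc j)
  have "h (x - real j - 1) = h (x - real j) - 1" using assms(2) by (intro assms(1)) simp
  then show ?case using Suc by (simp add: algebra_simps)
qed simp

lemma left_periodic_extension:
  assumes h: "h \<in> equi_ends"
  obtains g C where "g \<in> lifts_T 1" "\<And>x. x \<le> C \<Longrightarrow> g x = h x"
proof -
  obtain C where C: "\<And>x. x \<le> C \<Longrightarrow> h (x - 1) = h x - 1" using h by (auto simp: equi_ends_def left_equi_def)
  \<comment> \<open>a base point that is dyadic and lies a full period below the bound \<open>C\<close>\<close>
  define a :: real where "a = of_int (\<lfloor>C\<rfloor> - 1)"
  have a: "a + 1 \<le> C" "a \<in> dyadics" unfolding a_def by (simp, simp)
  have h1: "h (a + 1) = h a + 1" using C[of "a + 1"] a by simp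
  have "per 1 a h \<in> lifts_T 1" by (rule per_lifts_T) (use equi_ends_plh[OF h] a h1 in auto)
  moreover have "per 1 a h x = h x" if x: "x \<le> a" for x
  proof -
    obtain k where k: "a + 1 * of_int k \<le> x" "x < a + 1 * (of_int k + 1)" using floor_period[of 1 a x] by auto
    have p: "per 1 a h x = h (x - of_int k) + of_int k" using per_eq[OF zero_less_one k] by simp
    have "of_int k \<le> (0::real)" using k x by simp
    then have "k \<le> 0" by simp
    then obtain j where j: "k = - int j" by (rule nonpos_int_cases)
    have "h (x + real j - real j) = h (x + real j) - real j"
      by (rule left_equi_iterate[of C h]) (use C k a j in auto)
    then show ?thesis using p unfolding j by simp
  qed
  ultimately show ?thesis by (rule that)
qed

text \<open>The right germ at \<open>0\<close> of a lift that fixes \<open>0\<close>, seen through \<open>psi\<close>. The lift is cut off to the identity by an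
  interpolation that ends before \<open>1\<close>, so that \<open>0\<close> is the only singular point that is kept.\<close>

lemma left_model:
  assumes F: "F \<in> lifts_TA M" "F 0 = 0"
  obtains k e where "k \<in> equi_ends" "e > 0" "\<And>t. 0 \<le> t \<Longrightarrow> t \<le> e \<Longrightarrow> Psi k t = F t"
proof -
  have Fr: "F \<in> rhomeo" by (rule lifts_TA_rhomeo[OF F(1)])
  obtain e where e: "e > 0" "\<And>y. 0 < \<bar>y - 0\<bar> \<Longrightarrow> \<bar>y - 0\<bar> < e \<Longrightarrow> reg F y"
    using lifts_TA_loc[OF F(1), of 0] unfolding loc_def by blast
  have "dbl F 0" using lifts_TA_loc[OF F(1), of 0] by (simp add: loc_def)
  then obtain d where d: "d > 0" "\<And>t. \<bar>t\<bar> < d \<Longrightarrow> F (0 + 2 * t) - F 0 = 2 * (F (0 + t) - F 0)"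
    unfolding dbl_def by blast
  obtain r where r: "0 < r" "r < min e (1/2)" "\<And>t. \<bar>t - 0\<bar> \<le> r \<Longrightarrow> - 1 < F t \<and> F t < 1/2"
    using rhomeo_near[OF Fr, of "-1" 0 "1/2" "min e (1/2)"] e F(2) by auto
  obtain p where p: "p \<in> dyadics" "0 < p" "p < r" using dyadics_dense[OF r(1)] by auto
  have Tsupp: "0 < F p" "F p < 1/2" using rhomeo_less[OF Fr, of 0 p] F(2) p r(3)[of p] by auto
  have regF: "reg F t" if "0 < t" "t \<le> p" for t using that p r e by (intro e(2)) auto
  obtain u c' d' where u: "u \<in> plh" "\<And>x. p \<le> x \<Longrightarrow> x \<le> p \<Longrightarrow> u x = F x"
    "c' \<in> dyadics" "d' \<in> dyadics" "0 < c'" "c' < p" "p < d'" "d' < 1" "\<And>x. x \<le> c' \<or> x \<ge> d' \<Longrightarrow> u x = x"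
    by (rule plh_extend[of F p p 0 1]) (use Fr regF p Tsupp(1) order.strict_trans[OF Tsupp(2), of 1] r in auto)
  define k where "k = glue 0 id (glue p F u)"
  have Fu: "F p = u p" using u(2)[of p] by simp
  have kr: "k \<in> rhomeo" unfolding k_def
    using Fr u(1) Fu p F(2) by (intro glue_rhomeo) auto
  have k0: "k t = t" if "t \<le> 0" for t using that by (simp add: k_def)
  have k1: "k t = t" if "t \<ge> d'" for t using that u(5-9) p by (simp add: k_def)
  have kF: "k t = F t" if "0 \<le> t" "t \<le> p" for t using that F(2) by (cases "t = 0") (auto simp: k_def)
  have kreg: "reg k t" if "t \<noteq> 0" for t
  proof -
    have g: "reg (glue p F u) t" if "t > 0" using p(1) Fu regF that u(1) by (intro reg_glue) auto
    show ?thesis unfolding k_def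
      by (rule reg_glue) (use g \<open>t \<noteq> 0\<close> p F(2) in auto)
  qed
  obtain x where xp: "x \<in> plh" and px: "\<And>t. psi (x t) = k (psi t)"
    and Px: "\<And>t. 0 \<le> t \<Longrightarrow> t \<le> 1 \<Longrightarrow> Psi x t = k t"
    using Psi_surjective[OF kr k0[of 0] k1[of 1] kreg] u by auto
  have "left_equi x"
  proof -
    obtain c where c: "psi c < min (min d p) (1/2)" "c \<le> 0"
    proof -
      have m: "0 < min (min d p) (1/2)" "min (min d p) (1/2) \<le> 1/2" using d p by auto
      have "0 < min (min d p) (1/2) / 2" "min (min d p) (1/2) / 2 < 1" using m by linarith+
      then obtain c where "psi c = min (min d p) (1/2) / 2" using psi_surj by blast
      then have "psi c < min (min d p) (1/2)" using m by linarith
      moreover have "psi c < psi 0" using calculation by (simp add: psi_def dexp_0)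
      then have "c \<le> 0" by simp
      ultimately show ?thesis by (rule that)
    qed
    have "x (t - 1) = x t - 1" if t: "t \<le> c" for t
    proof -
      have pt0: "0 < psi t" "psi t \<le> psi c" using psi_01 t by auto
      then have pt: "0 < psi t" "psi t < d" "psi t < p" "psi t < 1/2" using c(1) by linarith+
      have half: "psi (t - 1) = psi t / 2" using psi_shift[of "t - 1" 1] t c by simp
      have F2: "F (psi t) = 2 * F (psi t / 2)" using d(2)[of "psi t / 2"] F(2) pt by simp
      have "k (psi t) = F (psi t)" "k (psi t / 2) = F (psi t / 2)" using kF pt by auto
      then have e1: "psi (x (t - 1)) = psi (x t) / 2" unfolding px half using F2 by simp
      have "psi (x t) = F (psi t)" unfolding px using kF pt by auto
      also have "\<dots> < 1/2" using r(3)[of "psi t"] pt p by auto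
      finally have "psi (x t) < psi 0" by (simp add: psi_def dexp_0)
      then have "x t \<le> 0" by simp
      then have "psi (x t - 1) = psi (x t) / 2" using psi_shift[of "x t - 1" 1] by simp
      then have "psi (x (t - 1)) = psi (x t - 1)" using e1 by (simp only:)
      then show ?thesis by (simp only: psi_eq_iff)
    qed
    then show ?thesis unfolding left_equi_def by blast
  qed
  moreover have "left_equi (refl_fun x)"
  proof -
    have "x t = t" if "t \<ge> ipsi d'" for t
    proof -
      have "psi t \<ge> d'" using psi_le_iff[of "ipsi d'" t] that u p by (simp del: psi_le_iff)
      then have "psi (x t) = psi t" unfolding px by (rule k1)
      then show ?thesis by simp
    qed
    then have "refl_fun x t = t" if "t \<le> - ipsi d'" for t using that by (simp add: refl_fun_def)
    then show ?thesis unfolding left_equi_def by (intro exI[of _ "- ipsi d'"]) auto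
  qed
  ultimately have "x \<in> equi_ends" using xp by (simp add: equi_ends_def)
  moreover have "Psi x t = F t" if "0 \<le> t" "t \<le> p" for t
    using Px[of t] kF[OF that] that p r by auto
  ultimately show ?thesis using that p by blast
qed

text \<open>Every germ at minus infinity of a unit-periodic map occurs in block \<open>0\<close> of some element of \<open>G\<close>. The mirror image
  of this property, for germs at plus infinity, is expressed by applying it to \<open>refl_fun ` G\<close>.\<close>

definition left_realised :: "nat \<Rightarrow> (real \<Rightarrow> real) set \<Rightarrow> bool"
  where "left_realised n G \<longleftrightarrow> (\<forall>g\<in>lifts_T 1. \<exists>h\<in>equi_ends. single_block n h \<in> G \<and> (\<exists>C. \<forall>x\<le>C. h x = g x) \<and> (\<exists>C. \<forall>x\<ge>C. h x = x))"

text \<open>The germ is modelled on the line, extended periodically, and realised inside \<open>G\<close>. The realising element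
  is regular inside the period because it is trivial near the right end of block \<open>0\<close>.\<close>

lemma left_fix:
  assumes G: "left_realised n G" and F: "F \<in> lifts_TA (2 ^ (n + 1))" "F 0 = 0"
  obtains \<kappa> e where "\<kappa> \<in> G" "\<kappa> \<in> lifts_TA (2 ^ (n + 1))" "e > 0" "\<And>t. 0 \<le> t \<Longrightarrow> t \<le> e \<Longrightarrow> \<kappa> t = F t"
    "\<And>t. 0 < t \<Longrightarrow> t < 2 ^ (n + 1) \<Longrightarrow> reg \<kappa> t" "\<And>t. 1 \<le> t \<Longrightarrow> t \<le> 2 ^ (n + 1) \<Longrightarrow> \<kappa> t = t"
proof -
  obtain k e where k: "k \<in> equi_ends" "e > 0" "\<And>t. 0 \<le> t \<Longrightarrow> t \<le> e \<Longrightarrow> Psi k t = F t" using left_model[OF F] by blast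
  obtain g B where g: "g \<in> lifts_T 1" "\<And>x. x \<le> B \<Longrightarrow> g x = k x" using left_periodic_extension[OF k(1)] by blast
  obtain h C D where h: "h \<in> equi_ends" "single_block n h \<in> G" "\<And>x. x \<le> C \<Longrightarrow> h x = g x" "\<And>x. x \<ge> D \<Longrightarrow> h x = x"
    using G g(1) unfolding left_realised_def by blast
  define c where "c = min B C"
  have kappa: "single_block n h t = F t" if t: "0 \<le> t" "t \<le> min e (psi c)" for t
  proof (rule psi_cases[of t])
    assume "t \<le> 0 \<or> 1 \<le> t"
    then have "t = 0" using t psi_01[of c] by auto
    then show ?thesis using F(2) single_block_eq[of 0 n h] by simp
  next
    fix x assume x: "t = psi x"
    then have "x \<le> c" using t by simp
    then have "h x = k x" using h(3)[of x] g(2)[of x] by (simp add: c_def)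
    moreover have "single_block n h t = Psi h t" using t psi_01[of c] by (intro single_block_eq) auto
    ultimately show ?thesis using k(3)[of t] t x by simp
  qed
  define b where "b = psi D"
  have b: "0 < b" "b < 1" using psi_01 by (auto simp: b_def)
  have id': "single_block n h t = t" if t: "b \<le> t" "t \<le> 2 ^ (n + 1)" for t
  proof (cases "t < 1")
    case True
    then obtain x where x: "t = psi x" using b t psi_surj[of t] by auto
    then have "D \<le> x" using t by (simp add: b_def)
    then show ?thesis using h(4)[of x] single_block_eq[of t n h] True b t x by simp
  qed (use single_block_out t in auto)
  have "reg (single_block n h) t" if t: "0 < t" "t < 2 ^ (n + 1)" for t
  proof (cases "t < 1")
    case True
    have "t \<notin> \<int>" using True t by (auto elim!: Ints_cases)
    then show ?thesis unfolding single_block_def by (intro reg_blocks) (use equi_ends_plh[OF h(1)] in auto)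
  next
    case False
    show ?thesis by (rule reg_cong_open[of id t b "2 ^ (n + 1)", OF reg_id(2)]) (use id' t False b in auto)
  qed
  then show ?thesis
    using that[of "single_block n h" "min e (psi c)"] h(1,2) single_block_lifts_TA[OF h(1), of n] kappa single_block_out k(2) psi_01(1)[of c] by auto
qed

lemma refl_blocks: "refl_fun (blocks \<eta>) = blocks (\<lambda>q. refl_fun (\<eta> (- 1 - q)))"
proof
  fix t :: real
  define q where "q = \<lfloor>t\<rfloor>"
  have q: "of_int q \<le> t" "t \<le> of_int q + 1" unfolding q_def by linarith+
  have "blocks \<eta> (- t) = Psi (\<eta> (- 1 - q)) (- t - of_int (- 1 - q)) + of_int (- 1 - q)"
    by (rule blocks_eq) (use q in auto)
  moreover have "- t - of_int (- 1 - q) = 1 - (t - of_int q)" by simp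
  ultimately have "blocks \<eta> (- t) = Psi (\<eta> (- 1 - q)) (1 - (t - of_int q)) + of_int (- 1 - q)" by (simp only:)
  then show "refl_fun (blocks \<eta>) t = blocks (\<lambda>q. refl_fun (\<eta> (- 1 - q))) t"
    by (simp add: refl_fun_def[of "blocks \<eta>"] blocks_eq[OF q] Psi_refl)
qed

text \<open>Reflection moves block \<open>0\<close> to block \<open>- 1\<close>, which a unit translation undoes.\<close>

lemma refl_single_block:
  "refl_fun (single_block n x) = (\<lambda>t. t + of_int (- 1)) \<circ> single_block n (refl_fun x) \<circ> (\<lambda>t. t + of_int 1)"
  unfolding single_block_def blocks_conj refl_blocks
proof (rule arg_cong[of _ _ blocks], rule ext)
  fix q :: int
  have "(2 ^ (n + 1) dvd - 1 - q) = ((2::int) ^ (n + 1) dvd - (q + 1))" by (simp add: algebra_simps)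
  also have "\<dots> = (2 ^ (n + 1) dvd q + 1)" by (rule dvd_minus_iff)
  finally show "refl_fun (if 2 ^ (n + 1) dvd - 1 - q then x else id) = (if 2 ^ (n + 1) dvd q + 1 then refl_fun x else id)"
    by (simp only: refl_id if_distrib[of refl_fun])
qed

lemma loc_refl:
  assumes "loc f (- x)" shows "loc (refl_fun f) x"
proof -
  obtain e where e: "e > 0" "\<And>y. 0 < \<bar>y - - x\<bar> \<Longrightarrow> \<bar>y - - x\<bar> < e \<Longrightarrow> reg f y"
    using assms unfolding loc_def by blast
  have "reg (refl_fun f) y" if "0 < \<bar>y - x\<bar>" "\<bar>y - x\<bar> < e" for y
    by (rule reg_refl, rule e(2)) (use that in auto)
  moreover have "if x \<in> dyadics then dbl (refl_fun f) x else reg (refl_fun f) x"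
  proof (cases "x \<in> dyadics")
    case True
    then have "dbl f (- x)" using assms by (simp add: loc_def)
    then obtain d where d: "d > 0" "\<And>t. \<bar>t\<bar> < d \<Longrightarrow> f (- x + 2 * t) - f (- x) = 2 * (f (- x + t) - f (- x))"
      unfolding dbl_def by blast
    have "refl_fun f (x + 2 * t) - refl_fun f x = 2 * (refl_fun f (x + t) - refl_fun f x)" if "\<bar>t\<bar> < d" for t
      using d(2)[of "- t"] that by (simp add: refl_fun_def)
    then have "dbl (refl_fun f) x" unfolding dbl_def using d(1) by blast
    then show ?thesis using True by simp
  next
    case False
    then have "- x \<notin> dyadics" using dyadics_minus[of "- x"] by auto
    then show ?thesis using assms False by (simp add: loc_def reg_refl)
  qed
  ultimately show ?thesis unfolding loc_def using e(1) by blast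
qed

lemma lifts_TA_refl: "f \<in> lifts_TA M \<Longrightarrow> refl_fun f \<in> lifts_TA M"
proof (rule lifts_TA_I)
  assume f: "f \<in> lifts_TA M"
  show "refl_fun f \<in> rhomeo" by (rule refl_rhomeo[OF lifts_TA_rhomeo[OF f]])
  show "loc (refl_fun f) x" for x by (rule loc_refl[OF lifts_TA_loc[OF f]])
  show "refl_fun f (x + M) = refl_fun f x + M" for x using lifts_TA_add[OF f, of "- (x + M)"] by (simp add: refl_fun_def)
qed

lemma reg_refl_iff: "reg (refl_fun f) x \<longleftrightarrow> reg f (- x)"
  using reg_refl[of f x] reg_refl[of "refl_fun f" "- x"] by auto

lemma reg_lifts_TA_periodic: "f \<in> lifts_TA M \<Longrightarrow> M \<in> dyadics \<Longrightarrow> reg f (x + M * of_int k) \<longleftrightarrow> reg f x"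
  by (rule reg_periodic[OF lifts_TA_add])

text \<open>First the right germ of \<open>F\<close> at \<open>0\<close> is made trivial by an element \<open>a\<close> of \<open>G\<close>, then the left germ by an element \<open>b\<close> that is trivial on
  \<open>[0, 1]\<close> and hence does not disturb the first correction. Both are regular away from the multiples of \<open>M\<close>.\<close>

lemma fix_at_0:
  assumes G: "fun_group G" "left_realised n G" "left_realised n (refl_fun ` G)"
    and F: "F \<in> lifts_TA M" "F 0 = 0" and M: "M = 2 ^ (n + 1)"
  obtains \<kappa> where "\<kappa> \<in> G" "\<kappa> \<in> lifts_TA M" "\<kappa> 0 = 0" "\<And>t. 0 < t \<Longrightarrow> t < M \<Longrightarrow> reg \<kappa> t" "reg (F \<circ> \<kappa>) 0"
proof -
  have "(2::real) ^ 1 \<le> 2 ^ (n + 1)" by (rule power_increasing) auto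
  then have M2: "M \<ge> 2" using M by simp
  have Md: "M \<in> dyadics" using M by simp
  obtain a e where a: "a \<in> G" "a \<in> lifts_TA M" "e > 0" "\<And>t. 0 \<le> t \<Longrightarrow> t \<le> e \<Longrightarrow> a t = F t"
    "\<And>t. 0 < t \<Longrightarrow> t < M \<Longrightarrow> reg a t" "\<And>t. 1 \<le> t \<Longrightarrow> t \<le> M \<Longrightarrow> a t = t"
    using left_fix[OF G(2), of F] F unfolding M by blast
  have ar: "a \<in> rhomeo" by (rule lifts_TA_rhomeo[OF a(2)])
  have a0: "a 0 = 0" using a(3) a(4)[of 0] F(2) by simp
  define F1 where "F1 = F \<circ> inv a"
  have F1: "F1 \<in> lifts_TA M" unfolding F1_def using F(1) a(2) by (intro fun_groupD(2,3)[OF fun_group_lifts_TA])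
  have ia0: "inv a 0 = 0" using rhomeo_inv_eq[OF ar] a0 by simp
  have F10: "F1 0 = 0" using ia0 F(2) by (simp add: F1_def)
  have F1id: "F1 t = t" if "0 \<le> t" "t \<le> a e" for t
  proof -
    have "0 \<le> inv a t" "inv a t \<le> e"
      using rhomeo_le[OF ar, of 0 "inv a t"] rhomeo_le[OF ar, of "inv a t" e] a0 that ar by auto
    then show ?thesis using a(4)[of "inv a t"] ar by (simp add: F1_def)
  qed
  have ae: "a e > 0" using rhomeo_less[OF ar, of 0 e] a0 a(3) by simp
  have rF1: "refl_fun F1 \<in> lifts_TA M" "refl_fun F1 0 = 0" using lifts_TA_refl[OF F1] F10 by (auto simp: refl_fun_def)
  obtain b' d where b': "b' \<in> refl_fun ` G" "b' \<in> lifts_TA M" "d > 0" "\<And>t. 0 \<le> t \<Longrightarrow> t \<le> d \<Longrightarrow> b' t = refl_fun F1 t"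
    "\<And>t. 0 < t \<Longrightarrow> t < M \<Longrightarrow> reg b' t" "\<And>t. 1 \<le> t \<Longrightarrow> t \<le> M \<Longrightarrow> b' t = t"
    using left_fix[OF G(3), of "refl_fun F1"] rF1 unfolding M by blast
  define b where "b = refl_fun b'"
  have b: "b \<in> G" "b \<in> lifts_TA M" using b'(1) lifts_TA_refl[OF b'(2)] by (auto simp: b_def)
  have br: "b \<in> rhomeo" by (rule lifts_TA_rhomeo[OF b(2)])
  have bF: "b t = F1 t" if "- d \<le> t" "t \<le> 0" for t using b'(4)[of "- t"] that by (simp add: b_def refl_fun_def)
  have bid: "b t = t" if "- M \<le> t" "t \<le> - 1" for t using b'(6)[of "- t"] that by (simp add: b_def refl_fun_def)
  have bid': "b t = t" if "0 \<le> t" "t \<le> 1" for t using lifts_TA_add[OF b(2), of "t - M"] bid[of "t - M"] that M2 by simp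
  have breg: "reg b t" if t: "0 < t" "t < M" for t
  proof -
    have "reg b' (- (t - M))" using t by (intro b'(5)) auto
    then have "reg b (t - M)" by (simp add: b_def reg_refl_iff)
    then show ?thesis using reg_lifts_TA_periodic[OF b(2) Md, of "t - M" 1] by simp
  qed
  have ib: "inv b t = t" if "0 \<le> t" "t \<le> 1" for t using rhomeo_inv_eq[OF br] bid'[OF that] by simp
  have reg_inv': "reg (inv f) t \<and> 0 < inv f t \<and> inv f t < M"
    if f: "f \<in> lifts_TA M" "f 0 = 0" "\<And>t. 0 < t \<Longrightarrow> t < M \<Longrightarrow> reg f t" and t: "0 < t" "t < M" for f t
  proof -
    have fr: "f \<in> rhomeo" by (rule lifts_TA_rhomeo[OF f(1)])
    have fM: "f M = M" using lifts_TA_add[OF f(1), of 0] f(2) by simp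
    have "0 < inv f t" "inv f t < M"
      using rhomeo_less[OF fr, of 0 "inv f t"] rhomeo_less[OF fr, of "inv f t" M] fr f(2) fM t by auto
    then show ?thesis using reg_inv_rhomeo[OF fr f(3)] by auto
  qed
  define \<kappa> where "\<kappa> = inv a \<circ> inv b"
  have "\<kappa> \<in> G" "\<kappa> \<in> lifts_TA M" unfolding \<kappa>_def using a b G(1) by (auto intro!: fun_groupD(2,3) fun_group_lifts_TA simp del: o_apply)
  moreover have "\<kappa> 0 = 0" using ia0 ib[of 0] by (simp add: \<kappa>_def)
  moreover have "reg \<kappa> t" if t: "0 < t" "t < M" for t unfolding \<kappa>_def
    using reg_inv'[OF b(2) _ breg t] reg_inv'[OF a(2) a0 a(5)] bid'[of 0] by (intro reg_comp) auto
  moreover have "reg (F \<circ> \<kappa>) 0"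
  proof -
    have eq: "F \<circ> \<kappa> = F1 \<circ> inv b" by (auto simp: \<kappa>_def F1_def)
    have 1: "(F \<circ> \<kappa>) t = t" if "0 \<le> t" "t \<le> min (a e) 1" for t
      unfolding eq using that ib F1id by simp
    have bd: "b (- d) < 0" using rhomeo_less[OF br, of "- d" 0] bid'[of 0] b'(3) by simp
    have 2: "(F \<circ> \<kappa>) t = t" if "b (- d) \<le> t" "t \<le> 0" for t
    proof -
      have "- d \<le> inv b t" "inv b t \<le> 0"
        using rhomeo_le[OF br, of "- d" "inv b t"] rhomeo_le[OF br, of "inv b t" 0] br that bid'[of 0] by auto
      then have "F1 (inv b t) = b (inv b t)" using bF by simp
      then show ?thesis unfolding eq using br by simp
    qed
    show ?thesis
    proof (rule reg_cong_open[of id 0 "b (- d)" "min (a e) 1", OF reg_id(2)])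
      fix t assume "b (- d) < t" "t < min (a e) 1"
      then show "id t = (F \<circ> \<kappa>) t" using 1[of t] 2[of t] by (cases "t \<le> 0") auto
    qed (use ae bd in auto)
  qed
  ultimately show ?thesis by (rule that)
qed

lemma lifts_T_translation: "b \<in> dyadics \<Longrightarrow> (\<lambda>t. t + b) \<in> lifts_T M"
  by (simp add: lifts_T_def)

lemma fix_at:
  assumes G: "fun_group G" "lifts_T M \<subseteq> G" "left_realised n G" "left_realised n (refl_fun ` G)"
    and F: "F \<in> lifts_TA M" and p: "p \<in> dyadics" and M: "M = 2 ^ (n + 1)"
  obtains \<kappa> where "\<kappa> \<in> G" "\<kappa> \<in> lifts_TA M" "\<kappa> p = p" "\<And>t. p < t \<Longrightarrow> t < p + M \<Longrightarrow> reg \<kappa> t" "reg (F \<circ> \<kappa>) p"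
proof -
  have q: "F p \<in> dyadics" using loc_dyadic[OF lifts_TA_loc[OF F]] p by simp
  have tr: "(\<lambda>t. t + b) \<in> G" "(\<lambda>t. t + b) \<in> lifts_TA M" if "b \<in> dyadics" for b
    using lifts_T_translation[OF that, of M] G(2) lifts_T_subset_lifts_TA by auto
  define F0 where "F0 = (\<lambda>t. t + - F p) \<circ> F \<circ> (\<lambda>t. t + p)"
  have F0: "F0 \<in> lifts_TA M" unfolding F0_def by (intro fun_groupD(2)[OF fun_group_lifts_TA] tr F p dyadics_minus q)
  have F00: "F0 0 = 0" by (simp add: F0_def)
  obtain \<kappa> where k: "\<kappa> \<in> G" "\<kappa> \<in> lifts_TA M" "\<kappa> 0 = 0" "\<And>t. 0 < t \<Longrightarrow> t < M \<Longrightarrow> reg \<kappa> t" "reg (F0 \<circ> \<kappa>) 0"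
    using fix_at_0[OF G(1,3,4) F0 F00 M] by blast
  define \<mu> where "\<mu> = (\<lambda>t. t + p) \<circ> \<kappa> \<circ> (\<lambda>t. t + - p)"
  have "\<mu> \<in> G" "\<mu> \<in> lifts_TA M" unfolding \<mu>_def
    by (intro fun_groupD(2)[OF G(1)] tr p dyadics_minus k, intro fun_groupD(2)[OF fun_group_lifts_TA] tr p dyadics_minus k)
  moreover have "\<mu> p = p" using k by (simp add: \<mu>_def)
  moreover have "reg \<mu> t" if "p < t" "t < p + M" for t
    using reg_shift[of \<kappa> t "- p" p] k(4)[of "t - p"] that p by (simp add: \<mu>_def comp_def)
  moreover have "reg (F \<circ> \<mu>) p"
  proof -
    have "reg (\<lambda>t. (F0 \<circ> \<kappa>) (t + - p) + F p) p" by (rule reg_shift) (use k(5) p q in \<open>simp_all del: o_apply\<close>)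
    then show ?thesis by (simp add: F0_def \<mu>_def comp_def)
  qed
  ultimately show ?thesis by (rule that)
qed

text \<open>Induction on the size of a finite set \<open>A\<close> that contains all singular points modulo \<open>M\<close>. The map \<open>\<kappa>\<close> of \<open>fix_at\<close> is singular
  only at \<open>a\<close>, where \<open>F \<circ> \<kappa>\<close> becomes regular, so the singular points of \<open>F \<circ> \<kappa>\<close> lie in the preimage of
  the other points of \<open>A\<close>. With no singular points left, the map belongs to \<open>lifts_T M\<close>.\<close>

lemma lifts_TA_generated:
  assumes G: "fun_group G" "lifts_T M \<subseteq> G" "left_realised n G" "left_realised n (refl_fun ` G)" and M: "M = 2 ^ (n + 1)"
  shows "lifts_TA M \<subseteq> G"
proof
  have M0: "M > 0" and Md: "M \<in> dyadics" using M by auto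
  have main: "finite A \<Longrightarrow> F \<in> lifts_TA M \<Longrightarrow> (\<And>x. \<not> reg F x \<Longrightarrow> \<exists>a\<in>A. \<exists>k::int. x = a + M * of_int k) \<Longrightarrow> F \<in> G" for A F
  proof (induction "card A" arbitrary: A F)
    case 0
    then have "A = {}" by simp
    then have "reg F x" for x using 0(4)[of x] by auto
    then have "F \<in> lifts_T M" using 0(3) lifts_TA_rhomeo[OF 0(3)] lifts_TA_add[OF 0(3)] unfolding lifts_T_def by (auto intro!: plhI)
    then show ?case using G(2) by blast
  next
    case (Suc m)
    then obtain a where a: "a \<in> A" by (metis card.empty equals0I nat.distinct(1))
    have cA: "card (A - {a}) = m" using Suc a by simp
    show ?case
    proof (cases "reg F a")
      case True
      show ?thesis
      proof (rule Suc.hyps(1)[of "A - {a}"])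
        fix x assume x: "\<not> reg F x"
        then obtain b k where bk: "b \<in> A" "x = b + M * of_int k" using Suc.prems(3) by blast
        then have "\<not> reg F b" using x reg_lifts_TA_periodic[OF Suc.prems(2) Md] by simp
        then have "b \<noteq> a" using True by auto
        then show "\<exists>a\<in>A - {a}. \<exists>k::int. x = a + M * of_int k" using bk by blast
      qed (use Suc cA in auto)
    next
      case False
      then have ad: "a \<in> dyadics" using lifts_TA_loc[OF Suc.prems(2), of a] by (auto simp: loc_def split: if_splits)
      obtain \<kappa> where k: "\<kappa> \<in> G" "\<kappa> \<in> lifts_TA M" "\<kappa> a = a" "\<And>t. a < t \<Longrightarrow> t < a + M \<Longrightarrow> reg \<kappa> t" "reg (F \<circ> \<kappa>) a"
        using fix_at[OF G Suc.prems(2) ad M] by blast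
      have kr: "\<kappa> \<in> rhomeo" by (rule lifts_TA_rhomeo[OF k(2)])
      have F\<kappa>: "F \<circ> \<kappa> \<in> lifts_TA M" by (intro fun_groupD(2)[OF fun_group_lifts_TA] Suc.prems k)
      have per: "\<kappa> (x + M * of_int l) = \<kappa> x + M * of_int l" for x l by (rule periodic_int[of \<kappa>]) (rule lifts_TA_add[OF k(2)])
      have "F \<circ> \<kappa> \<in> G"
      proof (rule Suc.hyps(1)[of "inv \<kappa> ` (A - {a})"])
        show "m = card (inv \<kappa> ` (A - {a}))"
          using cA card_image[of "inv \<kappa>" "A - {a}"] rhomeo_bij[OF rhomeo_inv[OF kr]] by (metis bij_is_inj inj_on_subset subset_UNIV)
        fix x assume x: "\<not> reg (F \<circ> \<kappa>) x"
        have xa: "x \<noteq> a + M * of_int l" for l using x k(5) reg_lifts_TA_periodic[OF F\<kappa> Md] by auto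
        obtain l where l: "a + M * of_int l \<le> x" "x < a + M * (of_int l + 1)" using floor_period[OF M0] .
        have "reg \<kappa> (x - M * of_int l)" using l xa[of l] by (intro k(4)) (auto simp: algebra_simps)
        then have "reg \<kappa> x" using reg_lifts_TA_periodic[OF k(2) Md, of "x - M * of_int l" l] by simp
        then have "\<not> reg F (\<kappa> x)" using x reg_comp by blast
        then obtain b j where b: "b \<in> A" "\<kappa> x = b + M * of_int j" using Suc.prems(3) by blast
        have xb: "x = inv \<kappa> b + M * of_int j"
        proof -
          have "\<kappa> (inv \<kappa> b + M * of_int j) = \<kappa> x" unfolding per b using kr by simp
          then show ?thesis using rhomeo_eq[OF kr] by metis
        qed
        have "inv \<kappa> a = a" using rhomeo_inv_eq[OF kr] k(3) by simp
        then have "b \<noteq> a" using xb xa[of j] by auto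
        then show "\<exists>a\<in>inv \<kappa> ` (A - {a}). \<exists>k::int. x = a + M * of_int k" using b xb by blast
      qed (use Suc F\<kappa> in auto)
      then have "(F \<circ> \<kappa>) \<circ> inv \<kappa> \<in> G" by (rule fun_groupD(2)[OF G(1) _ fun_groupD(3)[OF G(1) k(1)]])
      moreover have "(F \<circ> \<kappa>) \<circ> inv \<kappa> = F" using kr by (auto simp: fun_eq_iff)
      ultimately show ?thesis by simp
    qed
  qed
  fix F assume F: "F \<in> lifts_TA M"
  show "F \<in> G"
  proof (rule main[OF _ F])
    show "finite {x \<in> {0..M}. \<not> reg F x}" by (rule finite_singular[OF lifts_TA_loc[OF F]]) (use M0 in simp)
    fix x assume x: "\<not> reg F x"
    obtain l where l: "0 + M * of_int l \<le> x" "x < 0 + M * (of_int l + 1)" using floor_period[OF M0] .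
    have "\<not> reg F (x - M * of_int l)" using x reg_lifts_TA_periodic[OF F Md, of "x - M * of_int l" l] by simp
    then show "\<exists>a\<in>{x \<in> {0..M}. \<not> reg F x}. \<exists>k::int. x = a + M * of_int k"
      using l by (intro bexI[of _ "x - M * of_int l"] exI[of _ l]) (auto simp: algebra_simps)
  qed
qed

section \<open>The two generators on the level of lifts\<close>

text \<open>The first two pieces give T, the next three all right germs at block ends, and their mirror images all left germs.\<close>

definition pieces :: "nat \<Rightarrow> real \<Rightarrow> real"
  where "pieces = (!) [tau, stretch, left_repeat tau, left_repeat stretch, left_half_shift,
    refl_fun (left_repeat tau), refl_fun (left_repeat stretch), refl_fun left_half_shift]"

lemma pieces_equi_ends: "i < 8 \<Longrightarrow> pieces i \<in> equi_ends"
proof -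
  assume "i < 8"
  then have "pieces i \<in> set [tau, stretch, left_repeat tau, left_repeat stretch, left_half_shift,
    refl_fun (left_repeat tau), refl_fun (left_repeat stretch), refl_fun left_half_shift]"
    unfolding pieces_def by (intro nth_mem) simp
  then show ?thesis using tau_trans_ends stretch_trans_ends trans_ends_subset_equi_ends left_repeat_equi_ends left_half_shift_equi_ends equi_ends_refl by auto
qed

lemma pieces_simps:
  "pieces 0 = tau" "pieces 1 = stretch" "pieces 2 = left_repeat tau" "pieces 3 = left_repeat stretch" "pieces 4 = left_half_shift"
  "pieces 5 = refl_fun (left_repeat tau)" "pieces 6 = refl_fun (left_repeat stretch)" "pieces 7 = refl_fun left_half_shift"
  by (simp_all add: pieces_def)

lemma lifts_generated:
  assumes G: "fun_group G" "(\<lambda>t. t + 1/2) \<in> G" "blocks (layout 8 pieces) \<in> G"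
  shows "lifts_TA (2 ^ 9) \<subseteq> G"
proof -
  interpret generated_lifts 8 pieces G
    using G pieces_equi_ends by unfold_locales
  have TG: "lifts_T (2 ^ (8 + 1)) \<subseteq> G"
    by (rule lifts_T_subset[of 0 1]) (simp_all add: pieces_simps[simplified])
  have FRN: "k \<in> N" if "k \<in> trans_ends" for k using single_block_lifts_T[OF that] TG that trans_ends_subset_equi_ends by (auto simp: N_def)
  \<comment> \<open>the unit translation near minus infinity, trivial near plus infinity\<close>
  define s where "s = inv stretch \<circ> tau"
  have lr: "stretch \<in> rhomeo" by simp
  have s: "s \<in> trans_ends" unfolding s_def using stretch_trans_ends tau_trans_ends by (intro fun_groupD(2,3)[OF fun_group_trans_ends])
  have s1: "s x = x + 1" if "x \<le> -1" for x using that rhomeo_inv_eq[OF lr, of "x + 1" "x + 1"] by (simp add: s_def tau_def stretch_def)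
  have s2: "s x = x" if "x \<ge> 1" for x using that rhomeo_inv_eq[OF lr, of "x + 1" x] by (auto simp: s_def tau_def stretch_def)
  note conj = N_conj[of 2, unfolded pieces_simps] N_conj[of 3, unfolded pieces_simps] N_conj[of 4, unfolded pieces_simps]
  note conj' = N_conj[of 5, unfolded pieces_simps] N_conj[of 6, unfolded pieces_simps] N_conj[of 7, unfolded pieces_simps]
  have left: "\<exists>h\<in>N. (\<exists>C. \<forall>x\<le>C. h x = g x) \<and> (\<exists>C. \<forall>x\<ge>C. h x = x)" if "g \<in> lifts_T 1" for g
  proof (rule all_left_germs[OF fun_group_N N_rhomeo FRN[OF s]])
    show "\<exists>C. \<forall>x\<le>C. s x = x + 1" "\<exists>C. \<forall>x\<ge>C. s x = x" using s1 s2 by blast+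
    show "left_repeat tau \<circ> left_repeat stretch \<circ> inv (left_repeat tau) \<circ> inv (left_repeat stretch) \<in> N"
      using N_comm[of 2 3, unfolded pieces_simps] by simp
  qed (use conj that in auto)
  define N' where "N' = {x. refl_fun x \<in> N}"
  have N'r: "N' \<subseteq> rhomeo" using refl_rhomeo N_rhomeo refl_refl unfolding N'_def by (metis (no_types, lifting) mem_Collect_eq subset_iff)
  have N': "fun_group N'" unfolding fun_group_def
  proof (intro conjI ballI)
    show "id \<in> N'" using fun_groupD(1)[OF fun_group_N] unfolding N'_def mem_Collect_eq refl_id .
    show "f \<circ> g \<in> N'" if "f \<in> N'" "g \<in> N'" for f g
      using that fun_groupD(2)[OF fun_group_N] unfolding N'_def mem_Collect_eq refl_comp by blast
    show "inv f \<in> N'" if "f \<in> N'" for f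
    proof -
      have "f \<in> rhomeo" using that N'r by blast
      then show ?thesis using that fun_groupD(3)[OF fun_group_N] refl_inv[of f] unfolding N'_def mem_Collect_eq by metis
    qed
  qed
  have cr: "p \<circ> x \<circ> inv p \<in> N'" "inv p \<circ> x \<circ> p \<in> N'"
    if "x \<in> N'" "p \<in> equi_ends" "\<And>x. x \<in> N \<Longrightarrow> refl_fun p \<circ> x \<circ> inv (refl_fun p) \<in> N" "\<And>x. x \<in> N \<Longrightarrow> inv (refl_fun p) \<circ> x \<circ> refl_fun p \<in> N" for p x
    using that refl_inv[OF equi_ends_rhomeo[OF that(2)]] unfolding N'_def mem_Collect_eq refl_comp by auto
  have right: "\<exists>h\<in>N'. (\<exists>C. \<forall>x\<le>C. h x = g x) \<and> (\<exists>C. \<forall>x\<ge>C. h x = x)" if "g \<in> lifts_T 1" for g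
  proof (rule all_left_germs[OF N' N'r])
    show "s \<in> N'" using FRN[OF trans_ends_refl[OF s]] by (simp add: N'_def)
    show "\<exists>C. \<forall>x\<le>C. s x = x + 1" "\<exists>C. \<forall>x\<ge>C. s x = x" using s1 s2 by blast+
    have "left_repeat tau \<in> rhomeo" "left_repeat stretch \<in> rhomeo" using left_repeat_equi_ends tau_trans_ends stretch_trans_ends equi_ends_rhomeo by auto
    then show "left_repeat tau \<circ> left_repeat stretch \<circ> inv (left_repeat tau) \<circ> inv (left_repeat stretch) \<in> N'"
      using N_comm[of 5 6, unfolded pieces_simps] unfolding N'_def mem_Collect_eq refl_comp by (simp add: refl_inv)
  qed (use cr[OF _ left_repeat_equi_ends[OF tau_trans_ends]] cr[OF _ left_repeat_equi_ends[OF stretch_trans_ends]] cr[OF _ left_half_shift_equi_ends] conj' that in auto)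
  have "left_realised 8 G" unfolding left_realised_def
  proof
    fix g assume "g \<in> lifts_T 1"
    then obtain h where "h \<in> N" "\<exists>C. \<forall>x\<le>C. h x = g x" "\<exists>C. \<forall>x\<ge>C. h x = x" using left by blast
    then show "\<exists>h\<in>equi_ends. single_block 8 h \<in> G \<and> (\<exists>C. \<forall>x\<le>C. h x = g x) \<and> (\<exists>C. \<forall>x\<ge>C. h x = x)"
      unfolding N_def by blast
  qed
  moreover have "left_realised 8 (refl_fun ` G)" unfolding left_realised_def
  proof
    fix g assume "g \<in> lifts_T 1"
    then obtain h where h: "h \<in> N'" "\<exists>C. \<forall>x\<le>C. h x = g x" "\<exists>C. \<forall>x\<ge>C. h x = x" using right by blast
    then have hE: "refl_fun h \<in> equi_ends" "single_block 8 (refl_fun h) \<in> G" by (auto simp: N'_def N_def)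
    have "refl_fun (single_block 8 h) \<in> G" unfolding refl_single_block by (intro fun_groupD(2)[OF G(1)] int_translation hE)
    then have "single_block 8 h \<in> refl_fun ` G" by (metis image_eqI refl_refl)
    moreover have "h \<in> equi_ends" using equi_ends_refl[OF hE(1)] by simp
    ultimately show "\<exists>h\<in>equi_ends. single_block 8 h \<in> refl_fun ` G \<and> (\<exists>C. \<forall>x\<le>C. h x = g x) \<and> (\<exists>C. \<forall>x\<ge>C. h x = x)"
      using h by blast
  qed
  ultimately have "lifts_TA (2 ^ (8 + 1)) \<subseteq> G" by (intro lifts_TA_generated[OF G(1) TG]) auto
  then show ?thesis by simp
qed

section \<open>Lifts of circle maps\<close>

lemma to_circle_eq: "to_circle x = to_circle y \<longleftrightarrow> x - y \<in> \<int>"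
  by (rule circle.abs_eq_iff)

lemma to_rep [simp]: "to_circle (rep_circle p) = p"
  by (rule Quotient3_abs_rep[OF Quotient3_circle])

lemma to_circle_add_int [simp]: "to_circle (x + of_int k) = to_circle x"
  by (simp add: to_circle_eq)

text \<open>The preimage of the image is the union of the integral translates.\<close>

lemma open_to_circle_image:
  assumes "open S" shows "open (to_circle ` S)"
proof -
  have "to_circle -` (to_circle ` S) = (\<Union>k::int. (\<lambda>x. x + of_int k) -` S)"
  proof (intro equalityI subsetI)
    fix x assume "x \<in> to_circle -` (to_circle ` S)"
    then obtain y where y: "y \<in> S" "to_circle x = to_circle y" by auto
    then obtain k where "x - y = of_int k" by (auto simp: to_circle_eq elim: Ints_cases)
    then have "x + of_int (- k) = y" by simp
    then show "x \<in> (\<Union>k::int. (\<lambda>x. x + of_int k) -` S)" using y by (metis UN_iff UNIV_I vimageI)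
  next
    fix x assume "x \<in> (\<Union>k::int. (\<lambda>x. x + of_int k) -` S)"
    then obtain k where "x + of_int k \<in> S" by auto
    then have "to_circle (x + of_int k) \<in> to_circle ` S" by blast
    then show "x \<in> to_circle -` (to_circle ` S)" by simp
  qed
  moreover have "open ((\<lambda>x. x + of_int k) -` S)" for k
    by (rule open_vimage[OF assms]) (intro continuous_intros)
  ultimately show ?thesis by (auto simp: open_circle_def)
qed

lemma eventually_nhds_to_circle:
  "eventually P (nhds (to_circle x)) \<longleftrightarrow> eventually (\<lambda>t. P (to_circle t)) (nhds x)"
proof
  assume "eventually P (nhds (to_circle x))"
  then obtain S where "open S" "to_circle x \<in> S" "\<forall>q\<in>S. P q" by (auto simp: eventually_nhds)
  then show "eventually (\<lambda>t. P (to_circle t)) (nhds x)"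
    unfolding eventually_nhds by (intro exI[of _ "to_circle -` S"]) (auto simp: open_circle_def)
next
  assume "eventually (\<lambda>t. P (to_circle t)) (nhds x)"
  then obtain S where "open S" "x \<in> S" "\<forall>t\<in>S. P (to_circle t)" by (auto simp: eventually_nhds)
  then show "eventually P (nhds (to_circle x))"
    unfolding eventually_nhds by (intro exI[of _ "to_circle ` S"]) (auto intro: open_to_circle_image)
qed

lemma eventually_nhds_real: "eventually P (nhds (x::real)) \<longleftrightarrow> (\<exists>e>0. \<forall>t. \<bar>t - x\<bar> < e \<longrightarrow> P t)"
  by (simp add: eventually_nhds_metric dist_real_def)

definition circ :: "(real \<Rightarrow> real) \<Rightarrow> circle \<Rightarrow> circle"
  where "circ F p = to_circle (F (rep_circle p))"

lemma circ_to:
  assumes "\<And>x. F (x + 1) = F x + 1" shows "circ F (to_circle t) = to_circle (F t)"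
proof -
  have "to_circle (rep_circle (to_circle t)) = to_circle t" by simp
  then have "rep_circle (to_circle t) - t \<in> \<int>" by (simp only: to_circle_eq)
  then obtain k where "rep_circle (to_circle t) - t = of_int k" by (auto elim: Ints_cases)
  then have "rep_circle (to_circle t) = t + 1 * of_int k" by simp
  then have "F (rep_circle (to_circle t)) = F t + 1 * of_int k" using periodic_int[of F 1 t k, OF assms] by simp
  then show ?thesis by (simp add: circ_def)
qed

lemma circ_lifts_TA: "F \<in> lifts_TA 1 \<Longrightarrow> circ F (to_circle t) = to_circle (F t)"
  by (rule circ_to) (rule lifts_TA_add)

lemma circle_ext: "(\<And>t. f (to_circle t) = g (to_circle t)) \<Longrightarrow> f = g"
  by (rule ext) (metis to_rep)

lemma circ_comp: "F \<in> lifts_TA 1 \<Longrightarrow> G \<in> lifts_TA 1 \<Longrightarrow> circ (F \<circ> G) = circ F \<circ> circ G"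
  by (rule circle_ext) (simp add: circ_lifts_TA fun_groupD(2)[OF fun_group_lifts_TA] del: o_apply, simp add: circ_lifts_TA)

lemma circ_id: "circ id = id"
  by (auto simp: circ_def)

lemma continuous_circ:
  assumes "F \<in> lifts_TA 1" shows "continuous_on UNIV (circ F)"
  unfolding continuous_on_open_vimage[OF open_UNIV]
proof (intro allI impI)
  fix B :: "circle set" assume "open B"
  then have "open (to_circle -` B)" by (simp add: open_circle_def)
  then have "open (F -` (to_circle -` B))" by (rule open_vimage[OF _ rhomeo_continuous[OF lifts_TA_rhomeo[OF assms]]])
  moreover have "to_circle -` (circ F -` B) = F -` (to_circle -` B)"
    by (auto simp: circ_lifts_TA[OF assms])
  ultimately show "open (circ F -` B \<inter> UNIV)" by (simp add: open_circle_def)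
qed

lemma circ_inverse:
  assumes "F \<in> lifts_TA 1" shows "circ (inv F) \<circ> circ F = id" "circ F \<circ> circ (inv F) = id"
proof -
  have i: "inv F \<in> lifts_TA 1" using assms by (rule fun_groupD(3)[OF fun_group_lifts_TA])
  show "circ (inv F) \<circ> circ F = id" "circ F \<circ> circ (inv F) = id"
    using circ_comp[OF i assms] circ_comp[OF assms i] rhomeo_inv_comp[OF lifts_TA_rhomeo[OF assms]] circ_id by simp_all
qed

lemma circ_carrier:
  assumes "F \<in> lifts_TA 1" shows "circ F \<in> carrier homeo_circle"
proof -
  have i: "inv F \<in> lifts_TA 1" using assms by (rule fun_groupD(3)[OF fun_group_lifts_TA])
  have "homeomorphism UNIV UNIV (circ F) (circ (inv F))"
  proof (rule homeomorphismI)
    show "circ (inv F) (circ F x) = x" "circ F (circ (inv F) x) = x" for x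
      using circ_inverse[OF assms] by (metis comp_apply id_apply)+
  qed (use continuous_circ[OF assms] continuous_circ[OF i] in auto)
  then show ?thesis by (auto simp: homeo_circle_def)
qed

lemma lifts_T_1_lifts_TA_1: "F \<in> lifts_T 1 \<Longrightarrow> F \<in> lifts_TA 1"
  using lifts_T_subset_lifts_TA by blast

text \<open>The partition is the uniform one into \<open>2^K\<close> intervals for large \<open>K\<close>.\<close>

lemma circ_thompson_T:
  assumes F: "F \<in> lifts_T 1" shows "circ F \<in> thompson_T"
proof -
  have p: "F \<in> plh" by (rule lifts_T_plh[OF F])
  obtain K :: nat where K: "\<And>i::int. 0 \<le> of_int i / (2::real) ^ K \<Longrightarrow> of_int i / (2::real) ^ K < 1 \<Longrightarrow>
      daff {of_int i / 2 ^ K..(of_int i + 1) / 2 ^ K} F"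
    using reg_uniform[of 0 1 F] p by auto
  define x :: "nat \<Rightarrow> real" where "x i = real i / 2 ^ K" for i
  have "\<exists>n::int. \<exists>b\<in>dyadics. \<forall>t\<in>{x i..x (Suc i)}. circ F (to_circle t) = to_circle (2 powi n * t + b)" if "i < 2 ^ K" for i
  proof -
    have "real i < 2 ^ K" using that by (metis of_nat_less_iff of_nat_numeral of_nat_power)
    then have "daff {x i..x (Suc i)} F" using K[of "int i"] by (simp add: x_def add.commute)
    then show ?thesis unfolding daff_def using circ_lifts_TA[OF lifts_T_1_lifts_TA_1[OF F]] by metis
  qed
  moreover have "x 0 = 0" "x (2 ^ K) = 1" "\<forall>i. x i < x (Suc i)" "\<forall>i. x i \<in> dyadics"
    by (auto simp: x_def divide_strict_right_mono)
  ultimately show ?thesis using circ_carrier[OF lifts_T_1_lifts_TA_1[OF F]] unfolding thompson_T_def by blast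
qed

text \<open>A dyadic translation makes \<open>F x\<close> close to \<open>x\<close>, which leaves room to extend the germ inside one period.\<close>

lemma reg_agrees_lifts_T:
  assumes F: "F \<in> rhomeo" "reg F x"
  obtains G e where "G \<in> lifts_T 1" "e > 0" "\<And>t. \<bar>t - x\<bar> \<le> e \<Longrightarrow> G t = F t"
proof -
  obtain m where m: "m \<in> dyadics" "F x - x - 1/4 < m" "m < F x - x + 1/4"
    using dyadics_dense[of "F x - x - 1/4" "F x - x + 1/4"] by auto
  have md: "- m \<in> dyadics" using m by simp
  define F0 where "F0 = (\<lambda>t. t + - m) \<circ> F"
  have "F0 \<in> rhomeo" unfolding F0_def using plh_add[OF md] F by (intro rhomeo_comp) auto
  moreover have "reg F0 x" unfolding F0_def by (rule reg_comp[OF F(2) reg_add[OF md]])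
  moreover have "x - 1/2 < F0 x" "F0 x < x + 1/2" using m by (auto simp: F0_def)
  ultimately obtain u e where u: "u \<in> Tsupp 1 (x - 1/2) (x + 1/2)" "e > 0" "\<And>t. \<bar>t - x\<bar> \<le> e \<Longrightarrow> u t = F0 t"
    using Tsupp_match[of F0 x "x - 1/2" "x + 1/2" 1] by auto
  have "(\<lambda>t. t + m) \<circ> u \<in> lifts_T 1" by (rule fun_groupD(2)[OF fun_group_lifts_T lifts_T_translation[OF m(1)] Tsupp_lifts_T[OF u(1)]])
  moreover have "((\<lambda>t. t + m) \<circ> u) t = F t" if "\<bar>t - x\<bar> \<le> e" for t using u(3)[OF that] by (simp add: F0_def)
  ultimately show ?thesis using that u(2) by blast
qed

lemma integer_valued_constant:
  assumes "continuous_on S f" "connected S" "\<And>t. t \<in> S \<Longrightarrow> f t \<in> \<int>" "s \<in> S" "t \<in> S"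
  shows "(f t :: real) = f s"
proof -
  have "f constant_on S"
  proof (rule continuous_discrete_range_constant[OF assms(2,1)])
    fix x assume x: "x \<in> S"
    have "1 \<le> norm (f y - f x)" if "y \<in> S" "f y \<noteq> f x" for y
    proof -
      have "f y - f x \<in> \<int>" using assms(3) that x by (intro Ints_diff)
      then show ?thesis using that by (auto intro: Ints_nonzero_abs_ge1)
    qed
    then show "\<exists>e>0. \<forall>y. y \<in> S \<and> f y \<noteq> f x \<longrightarrow> e \<le> norm (f y - f x)" by (intro exI[of _ 1]) auto
  qed
  then show ?thesis using assms(4,5) by (auto simp: constant_on_def)
qed

text \<open>Two lifts of the same circle map differ by a continuous function with integral values.\<close>

lemma daff_lift:
  assumes "continuous_on {u..v} F" "b \<in> dyadics"
    "\<And>t. u \<le> t \<Longrightarrow> t \<le> v \<Longrightarrow> to_circle (F t) = to_circle (2 powi n * t + b)"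
  shows "daff {u..v} F"
proof (cases "u \<le> v")
  case True
  define c where "c = F u - (2 powi n * u + b)"
  have Z: "F t - (2 powi n * t + b) \<in> \<int>" if "t \<in> {u..v}" for t
    using assms(3)[of t] that by (simp add: to_circle_eq)
  have "F t - (2 powi n * t + b) = c" if "t \<in> {u..v}" for t unfolding c_def
    by (rule integer_valued_constant[of "{u..v}" "\<lambda>t. F t - (2 powi n * t + b)"])
      (use Z that True in \<open>auto intro!: continuous_intros assms\<close>)
  then have "\<forall>t\<in>{u..v}. F t = 2 powi n * t + (b + c)" by (auto simp: algebra_simps)
  moreover have "c \<in> \<int>" using Z[of u] True by (simp add: c_def)
  then have "b + c \<in> dyadics" using assms(2) by simp
  ultimately show ?thesis unfolding daff_def by blast
qed (simp add: daff_def exI[of _ 0] bexI[of _ 0])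

lemma partition_cell:
  fixes x :: "nat \<Rightarrow> real"
  assumes "x 0 \<le> t" "t < x N"
  obtains i where "i < N" "x i \<le> t" "t < x (Suc i)"
proof -
  define i where "i = (LEAST i. t < x i)"
  have 1: "t < x i" unfolding i_def by (rule LeastI[of _ N]) (use assms in simp)
  have "i \<noteq> 0"
  proof
    assume "i = 0"
    then show False using 1 assms by simp
  qed
  then obtain j where j: "i = Suc j" by (cases i) auto
  have "\<not> t < x j" using not_less_Least[of j "\<lambda>i. t < x i"] j i_def by simp
  moreover have "i \<le> N" unfolding i_def by (rule Least_le) (use assms in simp)
  ultimately show ?thesis using that[of j] 1 j by auto
qed

lemma partition_cell':
  fixes x :: "nat \<Rightarrow> real"
  assumes "x 0 < t" "t \<le> x N"
  obtains i where "i < N" "x i < t" "t \<le> x (Suc i)"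
proof -
  define i where "i = (LEAST i. t \<le> x i)"
  have 1: "t \<le> x i" unfolding i_def by (rule LeastI[of _ N]) (use assms in simp)
  have "i \<noteq> 0"
  proof
    assume "i = 0"
    then show False using 1 assms by simp
  qed
  then obtain j where j: "i = Suc j" by (cases i) auto
  have "\<not> t \<le> x j" using not_less_Least[of j "\<lambda>i. t \<le> x i"] j i_def by simp
  moreover have "i \<le> N" unfolding i_def by (rule Least_le) (use assms in simp)
  ultimately show ?thesis using that[of j] 1 j by auto
qed

text \<open>Only continuity of \<open>F\<close> near \<open>y\<close> is assumed, so that this applies before \<open>F\<close> is known to be
  increasing. At a partition point the two adjacent cells may belong to different
  periods, because the partition of the circle is cut at \<open>0\<close>.\<close>

lemma agrees_T_reg:
  assumes g: "g \<in> thompson_T" and e: "e > 0"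
    and cont: "continuous_on {y - e<..<y + e} F"
    and eq: "\<And>t. \<bar>t - y\<bar> < e \<Longrightarrow> g (to_circle t) = to_circle (F t)"
  shows "reg F y"
proof -
  obtain N :: nat and x :: "nat \<Rightarrow> real" where x: "x 0 = 0" "x N = 1" "\<And>i. i < N \<Longrightarrow> x i < x (Suc i)" "\<And>i. i \<le> N \<Longrightarrow> x i \<in> dyadics"
    and aff: "\<And>i. i < N \<Longrightarrow> \<exists>n :: int. \<exists>b\<in>dyadics. \<forall>t\<in>{x i..x (Suc i)}. g (to_circle t) = to_circle (2 powi n * t + b)"
    using g unfolding thompson_T_def by blast
  have piece: "daff {u..v} F" if i: "i < N" "x i + of_int k \<le> u" "v \<le> x (Suc i) + of_int k" "y - e < u" "v < y + e" for i k u v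
  proof -
    obtain n b where nb: "b \<in> dyadics" "\<And>t. t \<in> {x i..x (Suc i)} \<Longrightarrow> g (to_circle t) = to_circle (2 powi n * t + b)"
      using aff[OF i(1)] by blast
    show ?thesis
    proof (rule daff_lift[where n = n and b = "b - 2 powi n * of_int k"])
      show "continuous_on {u..v} F" by (rule continuous_on_subset[OF cont]) (use i in auto)
      show "b - 2 powi n * of_int k \<in> dyadics" using nb by simp
      fix t assume t: "u \<le> t" "t \<le> v"
      have "to_circle (F t) = g (to_circle t)" using eq[of t] t i by auto
      also have "to_circle t = to_circle (t - of_int k)" by (simp add: to_circle_eq)
      also have "g \<dots> = to_circle (2 powi n * (t - of_int k) + b)" using t i by (intro nb) auto
      finally show "to_circle (F t) = to_circle (2 powi n * t + (b - 2 powi n * of_int k))" by (simp add: algebra_simps)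
    qed
  qed
  define k where "k = \<lfloor>y\<rfloor>"
  have k: "x 0 \<le> y - of_int k" "y - of_int k < x N" unfolding k_def x by linarith+
  obtain i where i: "i < N" "x i \<le> y - of_int k" "y - of_int k < x (Suc i)" by (rule partition_cell[of x, OF k])
  have right: "daff {y..y + min (e/2) (x (Suc i) + of_int k - y)} F"
    by (rule piece[OF i(1), of k]) (use i e in auto)
  show ?thesis
  proof (cases "y - of_int k = x i")
    case False
    have "daff {y - min (min (e/2) (x (Suc i) + of_int k - y)) (y - x i - of_int k)..y + min (min (e/2) (x (Suc i) + of_int k - y)) (y - x i - of_int k)} F"
      by (rule piece[OF i(1), of k]) (use i e False in auto)
    then show ?thesis by (rule regI_open[rotated]) (use i e False in auto)
  next
    case True
    then have "y = x i + of_int k" by simp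
    then have yd: "y \<in> dyadics" using x(4)[of i] i(1) by simp
    define l where "l = \<lceil>y\<rceil> - 1"
    have l: "x 0 < y - of_int l" "y - of_int l \<le> x N" unfolding l_def x by linarith+
    obtain j where j: "j < N" "x j < y - of_int l" "y - of_int l \<le> x (Suc j)" by (rule partition_cell'[of x, OF l])
    have "daff {y - min (e/2) (y - x j - of_int l)..y} F"
      by (rule piece[OF j(1), of l]) (use j e in auto)
    then show ?thesis using right
      by (intro regI_sides[of "min (e/2) (y - x j - of_int l)" _ _ "min (e/2) (x (Suc i) + of_int k - y)"] yd) (use i j e in auto)
  qed
qed

lemma sing_circ:
  assumes F: "F \<in> lifts_TA 1" shows "to_circle x \<in> sing (circ F) \<longleftrightarrow> \<not> reg F x"
proof
  assume s: "to_circle x \<in> sing (circ F)"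
  show "\<not> reg F x"
  proof
    assume "reg F x"
    then obtain G e where G: "G \<in> lifts_T 1" "e > 0" "\<And>t. \<bar>t - x\<bar> \<le> e \<Longrightarrow> G t = F t"
      using reg_agrees_lifts_T[OF lifts_TA_rhomeo[OF F]] by blast
    have "eventually (\<lambda>q. circ F q = circ G q) (nhds (to_circle x))"
      unfolding eventually_nhds_to_circle eventually_nhds_real
      using G by (intro exI[of _ e]) (auto simp: circ_lifts_TA F lifts_T_1_lifts_TA_1)
    then show False using s circ_thompson_T[OF G(1)] by (auto simp: sing_def)
  qed
next
  assume n: "\<not> reg F x"
  show "to_circle x \<in> sing (circ F)"
  proof (rule ccontr)
    assume "to_circle x \<notin> sing (circ F)"
    then obtain g where g: "g \<in> thompson_T" "eventually (\<lambda>q. circ F q = g q) (nhds (to_circle x))"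
      by (auto simp: sing_def)
    then obtain e where e: "e > 0" "\<And>t. \<bar>t - x\<bar> < e \<Longrightarrow> circ F (to_circle t) = g (to_circle t)"
      unfolding eventually_nhds_to_circle eventually_nhds_real by blast
    have "reg F x" by (rule agrees_T_reg[OF g(1) e(1)])
      (use e(2) circ_lifts_TA[OF F] rhomeo_continuous[OF lifts_TA_rhomeo[OF F]] in auto)
    then show False using n by simp
  qed
qed

lemma circle_rep01: obtains t where "p = to_circle t" "0 \<le> t" "t < 1"
proof -
  have "p = to_circle (rep_circle p + of_int (- \<lfloor>rep_circle p\<rfloor>))" by (simp only: to_circle_add_int to_rep)
  then show ?thesis by (rule that) (simp_all, linarith)
qed

lemma circ_TA:
  assumes F: "F \<in> lifts_TA 1" shows "circ F \<in> TA"
proof -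
  have "sing (circ F) \<subseteq> to_circle ` {x \<in> {0..1}. \<not> reg F x}"
  proof
    fix p assume p: "p \<in> sing (circ F)"
    obtain t where t: "p = to_circle t" "0 \<le> t" "t < 1" by (rule circle_rep01)
    then show "p \<in> to_circle ` {x \<in> {0..1}. \<not> reg F x}" using p sing_circ[OF F, of t] by auto
  qed
  moreover have "finite {x \<in> {0..1}. \<not> reg F x}" by (rule finite_singular[OF lifts_TA_loc[OF F]]) simp
  ultimately have fin: "finite (sing (circ F))" using finite_subset by blast
  have D: "\<exists>x. p = to_circle x \<and> x \<in> dyadics \<and> dbl F x" if p: "p \<in> sing (circ F)" for p
  proof -
    obtain t where t: "p = to_circle t" "0 \<le> t" "t < 1" by (rule circle_rep01)
    then have "\<not> reg F t" using p sing_circ[OF F, of t] by simp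
    then show ?thesis using lifts_TA_loc[OF F, of t] t(1) by (auto simp: loc_def split: if_splits)
  qed
  have "eventually (\<lambda>q. expand_at (circ F p) (circ F q) = circ F (expand_at p q)) (nhds p)" if p: "p \<in> sing (circ F)" for p
  proof -
    obtain x where x: "p = to_circle x" "dbl F x" using D[OF p] by blast
    then obtain e where e: "e > 0" "\<And>t. \<bar>t\<bar> < e \<Longrightarrow> F (x + 2 * t) - F x = 2 * (F (x + t) - F x)"
      unfolding dbl_def by blast
    have "expand_at (circ F p) (circ F (to_circle t)) = circ F (expand_at p (to_circle t))" if "\<bar>t - x\<bar> < e" for t
    proof -
      have xt: "x + (t - x) = t" by simp
      have eq: "F x + 2 * (F t - F x) = F (x + 2 * (t - x))"
        using e(2)[OF that] unfolding xt by linarith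
      have "expand_at (circ F p) (circ F (to_circle t)) = expand_at (to_circle (F x)) (to_circle (F x + (F t - F x)))"
        by (simp add: x circ_lifts_TA[OF F])
      also have "\<dots> = circ F (to_circle (x + 2 * (t - x)))"
        unfolding expand_at_to_circle eq by (rule circ_lifts_TA[OF F, symmetric])
      also have "\<dots> = circ F (expand_at p (to_circle t))"
        using expand_at_to_circle[of x "t - x"] unfolding xt x(1) by simp
      finally show ?thesis .
    qed
    then show ?thesis unfolding x(1) eventually_nhds_to_circle eventually_nhds_real using e(1) by blast
  qed
  then show ?thesis unfolding TA_def using circ_carrier[OF F] fin D by blast
qed


text \<open>The lift is built on the unit interval as \<open>c + u\<close>, where \<open>u\<close> takes values in \<open>[0, 1)\<close> and vanishes exactly at integers.
  Continuity of \<open>u\<close> on \<open>(0, 1)\<close> comes from openness of the projection; injectivity makes \<open>u\<close> strictly monotone. It is increasing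
  because it is regular, hence of positive slope, at some point, as there are only finitely many singular points. The commutation with doubling
  holds on the circle only, so on the line it holds up to an integer, which is zero by continuity.\<close>

lemma TA_lift:
  assumes f: "f \<in> TA"
  obtains F where "F \<in> lifts_TA 1" "f = circ F"
proof -
  obtain f' where hom: "homeomorphism UNIV UNIV f f'" using f by (auto simp: TA_def homeo_circle_def)
  have cont: "continuous_on UNIV f" and inv: "\<And>p. f' (f p) = p" "\<And>p. f (f' p) = p"
    using hom by (auto simp: homeomorphism_def)
  have inj: "f p = f q \<longleftrightarrow> p = q" for p q using inv by metis
  define c where "c = rep_circle (f (to_circle 0))"
  define u where "u t = frac (rep_circle (f (to_circle t)) - c)" for t
  have u01: "0 \<le> u t" "u t < 1" for t by (auto simp: u_def frac_lt_1)
  have fu: "f (to_circle t) = to_circle (c + u t)" for t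
  proof -
    have "c + u t = rep_circle (f (to_circle t)) + of_int (- \<lfloor>rep_circle (f (to_circle t)) - c\<rfloor>)"
      by (simp add: u_def frac_def)
    then show ?thesis by (simp only: to_circle_add_int to_rep)
  qed
  have ueq: "to_circle s = to_circle t" if "u s = u t" for s t using fu[of s] fu[of t] that inj[of "to_circle s" "to_circle t"] by simp
  have u_add: "u (t + of_int k) = u t" for t k by (simp add: u_def)
  have u0: "u 0 = 0" by (simp add: u_def c_def)
  have upos: "0 < u t" if "0 < t" "t < 1" for t
  proof (rule ccontr)
    assume "\<not> 0 < u t"
    then have "u t = u 0" using u01(1)[of t] u0 by simp
    then have "t \<in> \<int>" using ueq[of t 0] by (simp add: to_circle_eq)
    then show False using that by (auto elim!: Ints_cases)
  qed
  have ucont: "continuous_on {0<..<1} u"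
  proof (rule continuous_at_imp_continuous_on, rule ballI)
    fix t :: real assume t: "t \<in> {0<..<1}"
    show "isCont u t" unfolding isCont_def LIM_eq
    proof (intro allI impI)
      fix e :: real assume e: "e > 0"
      \<comment> \<open>inside \<open>(0, 1)\<close> a point of the circle determines its representative\<close>
      define V where "V = {max 0 (u t - e)<..<min 1 (u t + e)}"
      have "open (to_circle ` ((\<lambda>v. v + - c) -` V))"
        by (rule open_to_circle_image, rule open_vimage) (auto simp: V_def intro!: continuous_intros)
      then have "open (f -` (to_circle ` ((\<lambda>v. v + - c) -` V)))" using cont by (rule open_vimage)
      then have o: "open (to_circle -` (f -` (to_circle ` ((\<lambda>v. v + - c) -` V))))" by (simp add: open_circle_def)
      have "c + u t \<in> (\<lambda>v. v + - c) -` V" using upos[of t] u01[of t] t e by (simp add: V_def)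
      then have "t \<in> to_circle -` (f -` (to_circle ` ((\<lambda>v. v + - c) -` V)))" using fu[of t] by auto
      then obtain d where d: "d > 0" "\<And>s. \<bar>s - t\<bar> < d \<Longrightarrow> s \<in> to_circle -` (f -` (to_circle ` ((\<lambda>v. v + - c) -` V)))"
        using o unfolding open_dist dist_real_def by blast
      have "\<bar>u s - u t\<bar> < e" if s: "\<bar>s - t\<bar> < d" for s
      proof -
        obtain w where w: "w + - c \<in> V" "f (to_circle s) = to_circle w" using d(2)[OF s] by auto
        then have "c + u s - w \<in> \<int>" using fu[of s] by (simp add: to_circle_eq[symmetric])
        then obtain k where k: "c + u s - w = of_int k" by (auto elim: Ints_cases)
        have "of_int k < (1::real)" "(-1::real) < of_int k" using k w(1) u01[of s] by (auto simp: V_def)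
        then have "k = 0" by simp
        then show ?thesis using k w(1) by (auto simp: V_def)
      qed
      then show "\<exists>d>0. \<forall>s. s \<noteq> t \<and> norm (s - t) < d \<longrightarrow> norm (u s - u t) < e" using d(1) by auto
    qed
  qed
  have uinj: "inj_on u {0<..<1}"
  proof (rule inj_onI)
    fix s t :: real assume st: "s \<in> {0<..<1}" "t \<in> {0<..<1}" "u s = u t"
    then obtain k where "s - t = of_int k" using ueq[of s t] by (auto simp: to_circle_eq elim: Ints_cases)
    moreover from this have "of_int k < (1::real)" "(-1::real) < of_int k" using st by auto
    then have "k = 0" by simp
    ultimately show "s = t" by simp
  qed
  have fin: "finite (sing f)" using f by (simp add: TA_def)
  have "\<exists>t\<in>{0<..<1}. to_circle t \<notin> sing f"
  proof (rule ccontr)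
    assume "\<not> (\<exists>t\<in>{0<..<1}. to_circle t \<notin> sing f)"
    then have "to_circle ` {0<..<1} \<subseteq> sing f" by auto
    moreover have "inj_on to_circle {0<..<1}"
    proof (rule inj_onI)
      fix s t :: real assume "s \<in> {0<..<1}" "t \<in> {0<..<1}" "to_circle s = to_circle t"
      then show "s = t" using inj_onD[OF uinj, of s t] by (simp add: u_def)
    qed
    ultimately have "finite ({0<..<1} :: real set)" using fin finite_subset finite_imageD by metis
    then show False using infinite_Ioo[of 0 "1::real"] by simp
  qed
  then obtain t0 where t0: "0 < t0" "t0 < 1" "to_circle t0 \<notin> sing f" by auto
  have reg_u: "reg (\<lambda>s. c + u s) t" if t: "0 < t" "t < 1" "to_circle t \<notin> sing f" for t
  proof -
    obtain g where g: "g \<in> thompson_T" "eventually (\<lambda>q. f q = g q) (nhds (to_circle t))"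
      using t by (auto simp: sing_def)
    then obtain e where e: "e > 0" "\<And>s. \<bar>s - t\<bar> < e \<Longrightarrow> f (to_circle s) = g (to_circle s)"
      unfolding eventually_nhds_to_circle eventually_nhds_real by blast
    define d where "d = min e (min t (1 - t))"
    show ?thesis
    proof (rule agrees_T_reg[OF g(1), of d])
      show "continuous_on {t - d<..<t + d} (\<lambda>s. c + u s)"
        by (intro continuous_intros continuous_on_subset[OF ucont]) (auto simp: d_def)
      show "g (to_circle s) = to_circle (c + u s)" if "\<bar>s - t\<bar> < d" for s
        using e(2)[of s] fu[of s] that by (simp add: d_def)
    qed (use e t in \<open>auto simp: d_def\<close>)
  qed
  have mono: "u s < u t" if "0 < s" "s < t" "t < 1" for s t
  proof -
    have "strict_mono_on {0<..<1} u \<or> strict_antimono_on {0<..<1} u"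
      using injective_eq_monotone_map[OF _ ucont] uinj by (auto simp: is_interval_convex_1)
    moreover have "\<not> strict_antimono_on {0<..<1} u"
    proof
      assume a: "strict_antimono_on {0<..<1} u"
      obtain d where d: "0 < d" "d \<le> (1 - t0) / 2" "daff {t0..t0 + d} (\<lambda>s. c + u s)"
        using reg_small[OF reg_u[OF t0], of "(1 - t0) / 2"] t0 by auto
      then have "u t0 < u (t0 + d)" using daff_image(2)[OF d(3)] by simp
      moreover have "u (t0 + d) < u t0" by (rule monotone_onD[OF a]) (use d t0 in auto)
      ultimately show False by simp
    qed
    ultimately have "strict_mono_on {0<..<1} u" by blast
    then show ?thesis using that by (auto simp: strict_mono_on_def)
  qed
  define F where "F t = of_int \<lfloor>t\<rfloor> + (c + u t)" for t
  have Fadd: "F (t + 1) = F t + 1" for t using u_add[of t 1] by (simp add: F_def)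
  have fF: "f (to_circle t) = to_circle (F t)" for t
    using fu[of t] to_circle_add_int[of "c + u t" "\<lfloor>t\<rfloor>"] by (simp add: F_def add.commute)
  have "strict_mono F"
  proof (rule strict_monoI)
    fix s t :: real assume st: "s < t"
    show "F s < F t"
    proof (cases "\<lfloor>s\<rfloor> = \<lfloor>t\<rfloor>")
      case True
      define k where "k = \<lfloor>s\<rfloor>"
      have k: "of_int k \<le> s" "t < of_int k + 1" unfolding k_def using True by (linarith, metis floor_correct of_int_add of_int_1)
      have us: "u s = u (s - of_int k)" "u t = u (t - of_int k)"
        using u_add[of "s - of_int k" k] u_add[of "t - of_int k" k] by simp_all
      have "u (s - of_int k) < u (t - of_int k)"
      proof (cases "s = of_int k")
        case True
        then show ?thesis using upos[of "t - of_int k"] st k u0 by simp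
      next
        case False
        then show ?thesis using mono[of "s - of_int k" "t - of_int k"] st k by simp
      qed
      then show ?thesis using us True by (simp add: F_def)
    next
      case False
      then have "\<lfloor>s\<rfloor> + 1 \<le> \<lfloor>t\<rfloor>" using floor_mono[of s t] st by linarith
      then have "of_int \<lfloor>s\<rfloor> + 1 \<le> (of_int \<lfloor>t\<rfloor> :: real)" by linarith
      then show ?thesis using u01[of s] u01[of t] by (simp add: F_def)
    qed
  qed
  moreover have "\<exists>x. y = F x" for y
  proof -
    obtain t where "f' (to_circle y) = to_circle t" using circle_rep01 by metis
    then have "to_circle y = to_circle (F t)" using inv(2) fF by metis
    then obtain k where k: "y - F t = of_int k" by (auto simp: to_circle_eq elim: Ints_cases)
    have "F (t + 1 * of_int k) = F t + 1 * of_int k" by (rule periodic_int[of F]) (rule Fadd)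
    then show ?thesis using k by (intro exI[of _ "t + of_int k"]) simp
  qed
  ultimately have Fr: "F \<in> rhomeo" unfolding rhomeo_def surj_def by blast
  have regF: "reg F t" if nt: "to_circle t \<notin> sing f" for t
  proof -
    obtain g where g: "g \<in> thompson_T" "eventually (\<lambda>q. f q = g q) (nhds (to_circle t))"
      using nt by (auto simp: sing_def)
    then obtain e where e: "e > 0" "\<And>s. \<bar>s - t\<bar> < e \<Longrightarrow> f (to_circle s) = g (to_circle s)"
      unfolding eventually_nhds_to_circle eventually_nhds_real by blast
    show ?thesis
      by (rule agrees_T_reg[OF g(1) e(1) rhomeo_continuous[OF Fr]]) (use e(2) fF in metis)
  qed
  have "loc F x" for x
  proof (cases "to_circle x \<in> sing f")
    case False
    then show ?thesis by (intro reg_loc regF)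
  next
    case True
    have "finite {y \<in> {x - 1/3<..<x + 1/3}. to_circle y \<in> sing f}"
    proof (rule finite_imageD)
      show "finite (to_circle ` {y \<in> {x - 1/3<..<x + 1/3}. to_circle y \<in> sing f})"
        by (rule finite_subset[OF _ fin]) auto
      show "inj_on to_circle {y \<in> {x - 1/3<..<x + 1/3}. to_circle y \<in> sing f}"
      proof (rule inj_onI)
        fix s t assume st: "s \<in> {y \<in> {x - 1/3<..<x + 1/3}. to_circle y \<in> sing f}"
          "t \<in> {y \<in> {x - 1/3<..<x + 1/3}. to_circle y \<in> sing f}" "to_circle s = to_circle t"
        then have "s - t \<in> \<int>" by (simp only: to_circle_eq)
        then obtain k where k: "s - t = of_int k" by (auto elim: Ints_cases)
        have "x - 1/3 < s" "s < x + 1/3" "x - 1/3 < t" "t < x + 1/3" using st by auto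
        then have "of_int k < (1::real)" "(-1::real) < of_int k" using k by linarith+
        then have "k = 0" by simp
        then show "s = t" using k by simp
      qed
    qed
    then obtain d where d: "d > 0" "\<And>y. y \<in> {x - 1/3<..<x + 1/3} \<Longrightarrow> to_circle y \<in> sing f \<Longrightarrow> y \<noteq> x \<Longrightarrow> d \<le> dist x y"
      using finite_set_avoid[of "{y \<in> {x - 1/3<..<x + 1/3}. to_circle y \<in> sing f}" x] by auto
    have "reg F y" if "0 < \<bar>y - x\<bar>" "\<bar>y - x\<bar> < min d (1/3)" for y
    proof (rule regF)
      show "to_circle y \<notin> sing f"
      proof
        assume "to_circle y \<in> sing f"
        moreover have "y \<in> {x - 1/3<..<x + 1/3}" "y \<noteq> x" using that unfolding greaterThanLessThan_iff by linarith+
        ultimately show False using d(2)[of y] that by (simp add: dist_real_def)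
      qed
    qed
    moreover have "x \<in> dyadics"
    proof -
      obtain z where z: "z \<in> dyadics" "to_circle x = to_circle z" using f True by (auto simp: TA_def)
      then have "x - z \<in> dyadics" using to_circle_eq dyadics_Ints by blast
      then have "(x - z) + z \<in> dyadics" using z(1) by (rule dyadics_add)
      then show ?thesis by simp
    qed
    moreover have "dbl F x"
    proof -
      have "eventually (\<lambda>q. expand_at (f (to_circle x)) (f q) = f (expand_at (to_circle x) q)) (nhds (to_circle x))"
        using f True by (simp add: TA_def)
      then obtain e where e: "e > 0" "\<And>t. \<bar>t - x\<bar> < e \<Longrightarrow> expand_at (f (to_circle x)) (f (to_circle t)) = f (expand_at (to_circle x) (to_circle t))"
        unfolding eventually_nhds_to_circle eventually_nhds_real by blast
      have Z: "(F x + 2 * (F (x + s) - F x)) - F (x + 2 * s) \<in> \<int>" if "\<bar>s\<bar> < e" for s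
      proof -
        have "expand_at (to_circle (F x)) (to_circle (F x + (F (x + s) - F x))) = f (expand_at (to_circle x) (to_circle (x + s)))"
          using e(2)[of "x + s"] that fF by simp
        then have "to_circle (F x + 2 * (F (x + s) - F x)) = to_circle (F (x + 2 * s))"
          by (simp only: expand_at_to_circle fF)
        then show ?thesis by (simp only: to_circle_eq)
      qed
      have "F (x + 2 * s) - F x = 2 * (F (x + s) - F x)" if s: "\<bar>s\<bar> < e" for s
      proof -
        have "(F x + 2 * (F (x + s) - F x)) - F (x + 2 * s) = (F x + 2 * (F (x + 0) - F x)) - F (x + 2 * 0)"
          by (rule integer_valued_constant[of "{- e<..<e}" "\<lambda>s. (F x + 2 * (F (x + s) - F x)) - F (x + 2 * s)"])
            (use Z s e(1) in \<open>auto intro!: continuous_intros continuous_on_compose2[OF rhomeo_continuous[OF Fr]]\<close>)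
        then show ?thesis by simp
      qed
      then show ?thesis unfolding dbl_def using e(1) by blast
    qed
    ultimately show ?thesis unfolding loc_def using d(1) by (intro conjI exI[of _ "min d (1/3)"]) auto
  qed
  then have FL: "F \<in> lifts_TA 1" using Fr Fadd by (intro lifts_TA_I)
  moreover have "f = circ F" by (rule circle_ext) (simp add: fF circ_lifts_TA[OF FL])
  ultimately show ?thesis by (rule that)
qed

section \<open>Two generators\<close>

text \<open>Conjugation by \<open>2^m\<close>; it passes between circles of length \<open>M\<close> and \<open>2^m M\<close>.\<close>

definition scale :: "int \<Rightarrow> (real \<Rightarrow> real) \<Rightarrow> real \<Rightarrow> real"
  where "scale m F = (\<lambda>t. 2 powi m * t + 0) \<circ> F \<circ> (\<lambda>t. 2 powi (- m) * t + 0)"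

lemma powi_cancel [simp]: "2 powi (- m) * (2 powi m * x) = (x::real)" "2 powi m * (2 powi (- m) * x) = (x::real)"
  by (simp_all add: power_int_minus)

lemma scale_lifts_TA:
  assumes F: "F \<in> lifts_TA M" shows "scale m F \<in> lifts_TA (2 powi m * M)"
proof (rule lifts_TA_I)
  have a: "(\<lambda>t. 2 powi k * t + 0) \<in> plh" for k by (rule plh_affine) simp
  have Fr: "F \<in> rhomeo" by (rule lifts_TA_rhomeo[OF F])
  show "scale m F \<in> rhomeo" unfolding scale_def by (intro rhomeo_comp Fr plh_rhomeo[OF a])
  show "loc (scale m F) x" for x unfolding scale_def
    by (rule loc_comp[OF plh_rhomeo[OF a] reg_loc[OF plh_reg[OF a]]], rule loc_comp[OF Fr lifts_TA_loc[OF F] reg_loc[OF plh_reg[OF a]]])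
  fix x :: real
  have "2 powi (- m) * (x + 2 powi m * M) = 2 powi (- m) * x + M" by (simp add: power_int_minus distrib_left)
  then have "scale m F (x + 2 powi m * M) = 2 powi m * F (2 powi (- m) * x + M)" by (simp add: scale_def)
  also have "\<dots> = scale m F x + 2 powi m * M" by (simp add: scale_def lifts_TA_add[OF F] distrib_left)
  finally show "scale m F (x + 2 powi m * M) = scale m F x + 2 powi m * M" .
qed

lemma scale_scale: "scale (- m) (scale m F) = F"
  unfolding scale_def by (rule ext) (simp del: mult_minus_left add: minus_minus powi_cancel)

lemma scale_comp: "scale m (F \<circ> G) = scale m F \<circ> scale m G"
  unfolding scale_def by (rule ext) simp

lemma scale_inv:
  assumes "F \<in> rhomeo" shows "scale m (inv F) = inv (scale m F)"
  by (rule inv_equality[symmetric]) (simp_all add: scale_def assms)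

lemma circ_m_inv:
  assumes "F \<in> lifts_TA 1" shows "m_inv homeo_circle (circ F) = circ (inv F)"
proof (rule group.inv_equality[OF group_homeo_circle])
  show "circ (inv F) \<otimes>\<^bsub>homeo_circle\<^esub> circ F = \<one>\<^bsub>homeo_circle\<^esub>"
    using circ_inverse(1)[OF assms] by (simp add: homeo_circle_def)
  show "circ F \<in> carrier homeo_circle" "circ (inv F) \<in> carrier homeo_circle"
    using circ_carrier assms fun_groupD(3)[OF fun_group_lifts_TA assms] by auto
qed

theorem theorem4p9:
  "\<exists>a\<in>TA. \<exists>b\<in>TA. generate homeo_circle {a, b} = TA"
proof -
  let ?A = "blocks (layout 8 pieces)" and ?B = "\<lambda>t. t + 1/2 :: real"
  define c where "c F = circ (scale (- 9) F)" for F
  define M :: real where "M = 2 ^ 9"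
  have M: "2 powi (- 9) * M = 1" "2 powi 9 * 1 = M" by (simp_all add: M_def power_int_minus)
  have sL: "scale (- 9) F \<in> lifts_TA 1" if "F \<in> lifts_TA M" for F using scale_lifts_TA[OF that, of "- 9"] M by simp
  have A: "?A \<in> lifts_TA M"
  proof -
    have "blocks (layout 8 pieces) \<in> lifts_TA (of_int (2 ^ 9))"
    proof (rule blocks_lifts_TA)
      show "layout 8 pieces q \<in> equi_ends" for q by (rule layout_equi_ends[OF pieces_equi_ends])
      show "layout 8 pieces (q + 2 ^ 9) = layout 8 pieces q" for q
      proof -
        have "(q + 2 ^ 9) mod 2 ^ (8 + 1) = q mod 2 ^ (8 + 1)" by simp
        then show ?thesis unfolding layout_def by (simp only:)
      qed
    qed
    then show ?thesis by (simp add: M_def)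
  qed
  have B: "?B \<in> lifts_TA M" using lifts_T_translation[of "1/2" M] lifts_T_subset_lifts_TA dyadics_divide_2[of 1] by auto
  define H where "H = generate homeo_circle {c ?A, c ?B}"
  have TA: "c ?A \<in> TA" "c ?B \<in> TA" using circ_TA sL A B by (auto simp: c_def)
  have "H \<subseteq> TA"
  proof
    fix f assume "f \<in> H"
    then show "f \<in> TA" unfolding H_def
    proof (induction rule: generate.induct)
      case one
      have "circ id \<in> TA" by (rule circ_TA[OF fun_groupD(1)[OF fun_group_lifts_TA]])
      moreover have "\<one>\<^bsub>homeo_circle\<^esub> = id" by (simp add: homeo_circle_def)
      ultimately show ?case by (simp only: circ_id)
    next
      case (incl h)
      then show ?case using TA by auto
    next
      case (inv h)
      then have "h \<in> TA" using TA by auto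
      then obtain F where F: "F \<in> lifts_TA 1" "h = circ F" by (rule TA_lift)
      then show ?case using circ_m_inv[OF F(1)] circ_TA[OF fun_groupD(3)[OF fun_group_lifts_TA F(1)]] by simp
    next
      case (eng h1 h2)
      obtain F1 where F1: "F1 \<in> lifts_TA 1" "h1 = circ F1" using eng.IH(1) by (rule TA_lift)
      obtain F2 where F2: "F2 \<in> lifts_TA 1" "h2 = circ F2" using eng.IH(2) by (rule TA_lift)
      have "circ (F1 \<circ> F2) \<in> TA" by (rule circ_TA[OF fun_groupD(2)[OF fun_group_lifts_TA F1(1) F2(1)]])
      moreover have "h1 \<otimes>\<^bsub>homeo_circle\<^esub> h2 = h1 \<circ> h2" by (simp add: homeo_circle_def)
      ultimately show ?case by (simp only: circ_comp[OF F1(1) F2(1)] F1(2) F2(2))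
    qed
  qed
  moreover have "TA \<subseteq> H"
  proof -
    define G where "G = {F \<in> lifts_TA M. c F \<in> H}"
    have "fun_group G" unfolding fun_group_def
    proof (intro conjI ballI)
      have "c id = id" unfolding c_def by (simp add: scale_def circ_id[symmetric] id_def comp_def power_int_minus)
      then show "id \<in> G" using generate.one[of homeo_circle "{c ?A, c ?B}"] fun_groupD(1)[OF fun_group_lifts_TA]
        by (simp add: G_def H_def homeo_circle_def)
      fix F assume F: "F \<in> G"
      then have FL: "F \<in> lifts_TA M" "c F \<in> H" by (auto simp: G_def)
      have "c (inv F) = m_inv homeo_circle (c F)"
        unfolding c_def circ_m_inv[OF sL[OF FL(1)]] scale_inv[OF lifts_TA_rhomeo[OF FL(1)]] ..
      moreover have "m_inv homeo_circle (c F) \<in> H"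
        unfolding H_def by (rule group.generate_m_inv_closed[OF group_homeo_circle]) (use TA FL in \<open>auto simp: TA_def H_def\<close>)
      ultimately show "inv F \<in> G" using fun_groupD(3)[OF fun_group_lifts_TA FL(1)] by (simp add: G_def)
      fix F2 assume F2: "F2 \<in> G"
      then have FL2: "F2 \<in> lifts_TA M" "c F2 \<in> H" by (auto simp: G_def)
      have "c (F \<circ> F2) = c F \<circ> c F2" unfolding c_def scale_comp by (rule circ_comp[OF sL sL]) (use FL FL2 in auto)
      moreover have "c F \<otimes>\<^bsub>homeo_circle\<^esub> c F2 \<in> H" using FL(2) FL2(2) unfolding H_def by (rule generate.eng)
      ultimately show "F \<circ> F2 \<in> G" using fun_groupD(2)[OF fun_group_lifts_TA FL(1) FL2(1)] by (simp add: G_def homeo_circle_def)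
    qed
    moreover have "?A \<in> G" "?B \<in> G" using A B by (auto simp: G_def H_def intro: generate.incl)
    ultimately have "lifts_TA (2 ^ 9) \<subseteq> G" by (intro lifts_generated)
    then have LG: "lifts_TA M \<subseteq> G" by (simp add: M_def)
    show ?thesis
    proof
      fix f assume "f \<in> TA"
      then obtain F where F: "F \<in> lifts_TA 1" "f = circ F" by (rule TA_lift)
      have "scale 9 F \<in> lifts_TA M" using scale_lifts_TA[OF F(1), of 9] M by simp
      then have "c (scale 9 F) \<in> H" using LG by (auto simp: G_def)
      then show "f \<in> H" using scale_scale[of 9 F] F(2) by (simp add: c_def)
    qed
  qed
  ultimately show ?thesis using TA unfolding H_def by blast
qed

end
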